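(* Let $(X,\mathsf d,\mathfrak m)$ be an infinitesimally Hilbertian, complete and separable metric space equipped with a non-negative Borel measure which is finite on bounded sets. Let $K\in\mathbb R$ and assume that the heat flow $(\mathsf h_t)$ of $(X,\mathsf d,\mathfrak m)$ has a heat kernel $\mathsf r_t[x](y)$ (in the sense of the context) and satisfies the dimension-free Harnack inequality: for every $p\in(1,\infty)$, $t>0$, $x,y\in X$ and $f\in L^1\cap L^\infty(X)$, $$|\mathsf h_t f(x)|^p\le (\mathsf h_t|f|^p)(y)\,\exp\Big(\frac{pK\,\mathsf d^2(x,y)}{2(p-1)(e^{2Kt}-1)}\Big).$$ Then for any $\varepsilon>0$ there exist constants $C_\varepsilon>0$ and $C_K\ge 0$ such that, for every $x,y\in X$ and $t>0$, it holds $$\mathsf r_t[x](y)\le \frac{1}{\sqrt{\mathfrak m(B_{\sqrt t}(x))\,\mathfrak m(B_{\sqrt t}(y))}}\exp\Big(C_\varepsilon(1+C_Kt)-\frac{\mathsf d^2(x,y)}{(4+\varepsilon)t}\Big).$$ If $K\ge 0$, then $C_K$ can be chosen equal to $0$.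
   Context: $B_r(x)$ is the ball of radius $r$ centred at $x$. When $K=0$, the quotient $\frac{K}{e^{2Kt}-1}$ is understood as its limit $\frac1{2t}$. Sobolev class: a test plan is a Borel probability measure $\pi$ on $C([0,1],X)$, concentrated on absolutely continuous curves, with $\int\int_0^1|\dot\gamma_t|^2\,dt\,d\pi(\gamma)<\infty$ and such that for some $C>0$ one has $(e_t)_*\pi\le C\mathfrak m$ for all $t\in[0,1]$, where $e_t(\gamma)=\gamma_t$. A Borel function $f$ belongs to $S^2(X)$ if there is a non-negative $G\in L^2(X)$ with $\int|f(\gamma_1)-f(\gamma_0)|\,d\pi\le\int\int_0^1G(\gamma_t)|\dot\gamma_t|\,dt\,d\pi$ for every test plan $\pi$; the $\mathfrak m$-a.e. minimal such $G$ is the minimal weak upper gradient $|Df|$. $W^{1,2}(X)=L^2(X)\cap S^2(X)$ with norm $\|f\|_{W^{1,2}}^2=\|f\|_{L^2}^2+\||Df|\|_{L^2}^2$. The space is infinitesimally Hilbertian if $W^{1,2}(X)$ is a Hilbert space. The Cheeger energy is $E(f)=\frac12\int|Df|^2\,d\mathfrak m$ for $f\in W^{1,2}(X)$ and $+\infty$ otherwise on $L^2(X)$; in the infinitesimally Hilbertian case it is a quadratic (Dirichlet) form, with associated bilinear form $\int\langle\nabla f,\nabla g\rangle\,d\mathfrak m$ obtained by polarization. The Laplacian $\Delta$ is defined by $f\in D(\Delta)$, $g=\Delta f\in L^2(X)$ iff $f\in W^{1,2}(X)$ and $\int\phi g\,d\mathfrak m=-\int\langle\nabla\phi,\nabla f\rangle\,d\mathfrak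 m$ for all $\phi\in W^{1,2}(X)$. The heat flow $(\mathsf h_t)$ on $L^2(X)$ is the semigroup with $\frac{d}{dt}\mathsf h_tf=\Delta\mathsf h_tf$, $\mathsf h_tf\to f$ in $L^2(X)$ as $t\downarrow0$. Heat kernel: a function $(0,\infty)\times X^2\ni(t,x,y)\mapsto\mathsf r_t[x](y)\in(0,\infty)$ such that for every $x\in X$ and $t>0$, $\mathsf r_t[x]$ is a probability density with respect to $\mathfrak m$, and $\mathsf h_tf(x)=\int f(y)\,\mathsf r_t[x](y)\,d\mathfrak m(y)$ for all $t>0$, $f\in L^2(X)$. Values of $\mathsf h_tf$ at points are those given by this formula.
   Formalization: The heat kernel is also assumed to satisfy r_{s+t}[x](y)=∫r_s[x](z) r_t[y](z)dm(z) for all s,t>0 and all x,y; without fixing its values on null sets the bound for every y is false (e.g. Gaussian on R altered on the diagonal). *)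

theory Defs
  imports "HOL-Probability.Probability"
begin

text \<open>Elements of \<open>L\<^sup>2\<close> and of the Sobolev spaces are Borel functions; identification up to null sets
  is made explicit by \<open>AE\<close> or by the seminorms below.\<close>

definition metric_measure :: "'a::{complete_space, second_countable_topology} measure \<Rightarrow> bool" where
  "metric_measure m \<longleftrightarrow> sets m = sets borel \<and> (\<forall>A. bounded A \<longrightarrow> emeasure m A < \<infinity>)"

definition L2 :: "'a measure \<Rightarrow> ('a \<Rightarrow> real) set" where
  "L2 m = {f \<in> borel_measurable m. integrable m (\<lambda>x. (f x)\<^sup>2)}"

definition L2_norm :: "'a measure \<Rightarrow> ('a \<Rightarrow> real) \<Rightarrow> real" where
  "L2_norm m f = sqrt (\<integral>x. (f x)\<^sup>2 \<partial>m)"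

definition L1_Linf :: "'a measure \<Rightarrow> ('a \<Rightarrow> real) set" where
  "L1_Linf m = {f. integrable m f \<and> (\<exists>C. AE x in m. \<bar>f x\<bar> \<le> C)}"


section \<open>Curves and test plans\<close>

text \<open>\<open>C([0,1],X)\<close> with the supremum distance; its elements are extended by \<open>undefined\<close> outside \<open>[0,1]\<close>.\<close>

definition curves :: "(real \<Rightarrow> 'a::metric_space) metric" where
  "curves = cfunspace (top_of_set {0..1}) euclidean_metric"

definition curves_borel :: "(real \<Rightarrow> 'a::metric_space) measure" where
  "curves_borel = sigma (mspace curves) {U. openin (mtopology_of curves) U}"

definition abs_cont_curve :: "(real \<Rightarrow> 'a::metric_space) \<Rightarrow> bool" where
  "abs_cont_curve \<gamma> \<longleftrightarrow> (\<exists>g. set_integrable lborel {0..1} g \<and>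
     (\<forall>s t. 0 \<le> s \<and> s \<le> t \<and> t \<le> 1 \<longrightarrow> dist (\<gamma> s) (\<gamma> t) \<le> (LINT r:{s..t}|lborel. g r)))"

text \<open>For an absolutely continuous curve the limit of the difference quotients exists for almost
  every \<open>t\<close>; the upper limit gives a value also at the remaining \<open>t\<close>.\<close>

definition metric_speed :: "(real \<Rightarrow> 'a::metric_space) \<Rightarrow> real \<Rightarrow> ennreal" where
  "metric_speed \<gamma> t = Limsup (at t within {0..1}) (\<lambda>s. ennreal (dist (\<gamma> s) (\<gamma> t) / \<bar>s - t\<bar>))"

definition test_plan ::
  "'a::{complete_space, second_countable_topology} measure \<Rightarrow> (real \<Rightarrow> 'a) measure \<Rightarrow> bool" where
  "test_plan m \<pi> \<longleftrightarrow>
     sets \<pi> = sets curves_borel \<and> prob_space \<pi> \<and>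
     (AE \<gamma> in \<pi>. abs_cont_curve \<gamma>) \<and>
     (\<integral>\<^sup>+\<gamma>. (\<integral>\<^sup>+t\<in>{0..1}. (metric_speed \<gamma> t)\<^sup>2 \<partial>lborel) \<partial>\<pi>) < \<infinity> \<and>
     (\<exists>C>0. \<forall>t\<in>{0..1}. \<forall>A\<in>sets borel.
        emeasure (distr \<pi> borel (\<lambda>\<gamma>. \<gamma> t)) A \<le> ennreal C * emeasure m A)"


section \<open>Sobolev functions\<close>

definition weak_upper_gradient ::
  "'a::{complete_space, second_countable_topology} measure \<Rightarrow> ('a \<Rightarrow> real) \<Rightarrow> ('a \<Rightarrow> real) \<Rightarrow> bool" where
  "weak_upper_gradient m f G \<longleftrightarrow> G \<in> L2 m \<and> (\<forall>x. 0 \<le> G x) \<and>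
     (\<forall>\<pi>. test_plan m \<pi> \<longrightarrow>
        (\<integral>\<^sup>+\<gamma>. ennreal \<bar>f (\<gamma> 1) - f (\<gamma> 0)\<bar> \<partial>\<pi>)
          \<le> (\<integral>\<^sup>+\<gamma>. (\<integral>\<^sup>+t\<in>{0..1}. ennreal (G (\<gamma> t)) * metric_speed \<gamma> t \<partial>lborel) \<partial>\<pi>))"

definition S2 :: "'a::{complete_space, second_countable_topology} measure \<Rightarrow> ('a \<Rightarrow> real) set" where
  "S2 m = {f \<in> borel_measurable borel. \<exists>G. weak_upper_gradient m f G}"

definition min_weak_upper_gradient ::
  "'a::{complete_space, second_countable_topology} measure \<Rightarrow> ('a \<Rightarrow> real) \<Rightarrow> 'a \<Rightarrow> real" where
  "min_weak_upper_gradient m f = (SOME G. weak_upper_gradient m f G \<and>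
     (\<forall>G'. weak_upper_gradient m f G' \<longrightarrow> (AE x in m. G x \<le> G' x)))"

definition W12 :: "'a::{complete_space, second_countable_topology} measure \<Rightarrow> ('a \<Rightarrow> real) set" where
  "W12 m = L2 m \<inter> S2 m"

definition W12_norm ::
  "'a::{complete_space, second_countable_topology} measure \<Rightarrow> ('a \<Rightarrow> real) \<Rightarrow> real" where
  "W12_norm m f = sqrt ((L2_norm m f)\<^sup>2 + (L2_norm m (min_weak_upper_gradient m f))\<^sup>2)"

definition infinitesimally_hilbertian ::
  "'a::{complete_space, second_countable_topology} measure \<Rightarrow> bool" where
  "infinitesimally_hilbertian m \<longleftrightarrow>
     (\<exists>ip :: ('a \<Rightarrow> real) \<Rightarrow> ('a \<Rightarrow> real) \<Rightarrow> real.
        (\<forall>f\<in>W12 m. \<forall>g\<in>W12 m. ip f g = ip g f) \<and>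
        (\<forall>f\<in>W12 m. \<forall>g\<in>W12 m. \<forall>k\<in>W12 m. ip (\<lambda>x. f x + g x) k = ip f k + ip g k) \<and>
        (\<forall>c. \<forall>f\<in>W12 m. \<forall>g\<in>W12 m. ip (\<lambda>x. c * f x) g = c * ip f g) \<and>
        (\<forall>f\<in>W12 m. ip f f = (W12_norm m f)\<^sup>2)) \<and>
     (\<forall>u. (\<forall>n::nat. u n \<in> W12 m) \<and>
          (\<forall>e>0. \<exists>N. \<forall>i\<ge>N. \<forall>j\<ge>N. W12_norm m (\<lambda>x. u i x - u j x) < e) \<longrightarrow>
          (\<exists>f\<in>W12 m. (\<lambda>n. W12_norm m (\<lambda>x. u n x - f x)) \<longlonglongrightarrow> 0))"


section \<open>Laplacian and heat flow\<close>

definition cheeger_energy ::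
  "'a::{complete_space, second_countable_topology} measure \<Rightarrow> ('a \<Rightarrow> real) \<Rightarrow> ennreal" where
  "cheeger_energy m f =
     (if f \<in> W12 m then ennreal ((1/2) * (\<integral>x. (min_weak_upper_gradient m f x)\<^sup>2 \<partial>m)) else \<infinity>)"

text \<open>The bilinear form \<open>\<integral>\<langle>\<nabla>f,\<nabla>g\<rangle> dm\<close>, used for \<open>f\<close>, \<open>g\<close> in \<open>W12 m\<close>. The energy carries a factor
  \<open>1/2\<close>, so \<open>dirichlet_form m f f\<close> is \<open>\<integral>|Df|\<^sup>2 dm\<close>.\<close>

definition dirichlet_form ::
  "'a::{complete_space, second_countable_topology} measure \<Rightarrow> ('a \<Rightarrow> real) \<Rightarrow> ('a \<Rightarrow> real) \<Rightarrow> real" where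
  "dirichlet_form m f g =
     (enn2real (cheeger_energy m (\<lambda>x. f x + g x)) - enn2real (cheeger_energy m (\<lambda>x. f x - g x))) / 2"

definition has_laplacian ::
  "'a::{complete_space, second_countable_topology} measure \<Rightarrow> ('a \<Rightarrow> real) \<Rightarrow> ('a \<Rightarrow> real) \<Rightarrow> bool" where
  "has_laplacian m f g \<longleftrightarrow> f \<in> W12 m \<and> g \<in> L2 m \<and>
     (\<forall>\<phi>\<in>W12 m. (\<integral>x. \<phi> x * g x \<partial>m) = - dirichlet_form m \<phi> f)"

text \<open>\<open>h t f\<close> is a representative of the class of the heat flow at time \<open>t\<close> started from \<open>f\<close>.\<close>

definition heat_flow ::
  "'a::{complete_space, second_countable_topology} measure \<Rightarrow> (real \<Rightarrow> ('a \<Rightarrow> real) \<Rightarrow> 'a \<Rightarrow> real) \<Rightarrow> bool" where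
  "heat_flow m h \<longleftrightarrow>
     (\<forall>f\<in>L2 m.
        (\<forall>t>0. \<exists>g. has_laplacian m (h t f) g \<and>
           ((\<lambda>s. L2_norm m (\<lambda>x. (h (t + s) f x - h t f x) / s - g x)) \<longlongrightarrow> 0) (at 0)) \<and>
        ((\<lambda>t. L2_norm m (\<lambda>x. h t f x - f x)) \<longlongrightarrow> 0) (at_right 0) \<and>
        (\<forall>s>0. \<forall>t>0. AE x in m. h (s + t) f x = h t (h s f) x))"

text \<open>In the second clause the equation holds at every point: it fixes the representative of
  \<open>h t f\<close>. The last clause applies the same convention to the kernel. As a density
  \<open>r (s + t) x\<close> is only determined up to null sets; it is the heat flow at time \<open>t\<close> of
  \<open>r s x\<close>, and its value at \<open>y\<close> is the one that the second clause gives for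
  \<open>h t (r s x) y\<close>. This is the Chapman--Kolmogorov identity combined with the symmetry of the
  kernel, at all points. Without it no bound on \<open>r t x y\<close> for every \<open>y\<close> could hold, since
  \<open>r t x\<close> could be altered at will on a null set.\<close>

definition heat_kernel ::
  "'a::{complete_space, second_countable_topology} measure \<Rightarrow> (real \<Rightarrow> ('a \<Rightarrow> real) \<Rightarrow> 'a \<Rightarrow> real) \<Rightarrow>
    (real \<Rightarrow> 'a \<Rightarrow> 'a \<Rightarrow> real) \<Rightarrow> bool" where
  "heat_kernel m h r \<longleftrightarrow>
     (\<forall>t>0. \<forall>x. (\<forall>y. 0 < r t x y) \<and> r t x \<in> borel_measurable m \<and>
        (\<integral>\<^sup>+y. ennreal (r t x y) \<partial>m) = 1) \<and>
     (\<forall>t>0. \<forall>f\<in>L2 m. \<forall>x. h t f x = (\<integral>y. f y * r t x y \<partial>m)) \<and>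
     (\<forall>s>0. \<forall>t>0. \<forall>x y. r (s + t) x y = (\<integral>z. r s x z * r t y z \<partial>m))"

text \<open>The quotient \<open>K / (e\<^sup>2\<^sup>K\<^sup>t - 1)\<close>, extended by its limit at \<open>K = 0\<close>.\<close>

definition harnack_coeff :: "real \<Rightarrow> real \<Rightarrow> real" where
  "harnack_coeff K t = (if K = 0 then 1 / (2 * t) else K / (exp (2 * K * t) - 1))"

definition dimension_free_harnack ::
  "'a::{complete_space, second_countable_topology} measure \<Rightarrow> (real \<Rightarrow> ('a \<Rightarrow> real) \<Rightarrow> 'a \<Rightarrow> real) \<Rightarrow>
    real \<Rightarrow> bool" where
  "dimension_free_harnack m h K \<longleftrightarrow>
     (\<forall>p>1. \<forall>t>0. \<forall>x y. \<forall>f\<in>L1_Linf m.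
        \<bar>h t f x\<bar> powr p
          \<le> h t (\<lambda>z. \<bar>f z\<bar> powr p) y * exp (p * (dist x y)\<^sup>2 / (2 * (p - 1)) * harnack_coeff K t))"

end

theory Submission
  imports Defs "HOL-Real_Asymp.Real_Asymp"
begin

text \<open>The Gaussian factor comes from the locality of the energy, the factor with the two balls from the
Harnack inequality.

\<^emph>\<open>Locality.\<close> Let \<open>\<psi>\<close> be bounded and 1-Lipschitz and put \<open>\<phi> = exp (2 * \<alpha> * \<psi>)\<close>. Then
\<open>F t = \<integral> \<phi> (h\<^sub>t f)\<^sup>2\<close> has the derivative \<open>- 2 * \<E>(\<phi> h\<^sub>t f, h\<^sub>t f)\<close>, where \<open>\<E>\<close> is the polarized energy, and
Davies' estimate \<open>F t \<le> exp (2 * \<alpha>\<^sup>2 * t) * F 0\<close> follows from \<open>\<E>(\<phi> f, f) \<ge> - \<alpha>\<^sup>2 * \<integral> \<phi> f\<^sup>2\<close>. By the definition of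
\<open>\<E>\<close>, the left-hand side is a quarter of \<open>\<integral>|Dw|\<^sup>2 - \<integral>|D(\<chi> w)|\<^sup>2\<close> with \<open>w = (\<phi> + 1) f\<close> and
\<open>\<chi> = (\<phi> - 1) / (\<phi> + 1) = tanh (\<alpha> * \<psi>)\<close>. The Leibniz bound \<open>|D(\<chi> w)| \<le> |\<chi>| |Dw| + |\<alpha>| (1 - \<chi>\<^sup>2) |w|\<close>, squared
by the Cauchy--Schwarz inequality with the weights \<open>\<chi>\<^sup>2\<close> and \<open>1 - \<chi>\<^sup>2\<close>, gives exactly what is needed, as
\<open>(1 - \<chi>\<^sup>2) w\<^sup>2 = 4 \<phi> f\<^sup>2\<close> (lemmas \<open>dirichlet_form_exp_weight_ge\<close> and \<open>heat_flow_exp_weight_L2_bound\<close>).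

The Leibniz bound, and the existence of a minimal weak upper gradient, are proved along curves:
restricting a test plan to a Borel set of curves and to a subinterval of time gives a test plan, so
the integrated inequality that defines weak upper gradients holds along almost every curve, between
almost all pairs of times (lemma \<open>weak_upper_gradient_along_curves\<close>). What remains is a statement
about real functions whose increments are bounded by an integral, and these are proved with the
Henstock lemma.

\<^emph>\<open>Harnack inequality.\<close> Let \<open>1 < q < 2\<close> and \<open>p = 2 / q\<close>. The Harnack inequality with exponent \<open>p\<close>,
raised to the power \<open>q\<close> and integrated over a ball \<open>B\<close> around \<open>x\<close> of radius \<open>\<rho>\<close>, bounds \<open>m(B) (h\<^sub>t f x)\<^sup>2\<close> by the
integral of \<open>(h\<^sub>t f\<^sup>p)\<^sup>q\<close> over \<open>B\<close>, and \<open>q < 2\<close> can be as close to \<open>2\<close> as we like. Since \<open>h\<^sub>t\<close> is given by a positive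
kernel, Hoelder's inequality interpolates between the weighted \<open>L\<^sup>2\<close> bound and the contraction of the
mass, which gives a weighted \<open>L\<^sup>q\<close> bound. The outcome is
\<open>m(B) (h\<^sub>t f x)\<^sup>2 \<le> C exp (2 * \<beta>\<^sup>2 * t / (q - 1) + 2 * \<beta> * \<psi> x + 2 * |\<beta>| * \<rho>) \<integral> f\<^sup>2 exp (- 2 * \<beta> * \<psi>)\<close>
(lemma \<open>ball_measure_heat_flow_sq_le\<close>). For \<open>f = r\<^sub>t(x,\<cdot>) exp (2 * \<beta> * \<psi>)\<close>, suitably truncated, both sides
contain the same integral, and dividing by it bounds the weighted \<open>L\<^sup>2\<close> norm of \<open>r\<^sub>t(x,\<cdot>)\<close>.

\<^emph>\<open>Conclusion.\<close> As \<open>r\<^sub>2\<^sub>t(x,y)\<close> is the \<open>L\<^sup>2\<close> product of \<open>r\<^sub>t(x,\<cdot>)\<close> and \<open>r\<^sub>t(y,\<cdot>)\<close>, the Cauchy--Schwarz inequality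
applies with the weights \<open>exp (2 * \<beta> * \<psi>)\<close> and \<open>exp (- 2 * \<beta> * \<psi>)\<close>, where \<open>\<psi>\<close> is the distance from \<open>x\<close> cut off at
the value \<open>d(x,y)\<close>. Optimizing \<open>\<beta>\<close> gives the exponent \<open>d\<^sup>2(x,y) / (4 + \<epsilon>)\<close>; the loss \<open>\<epsilon>\<close> is that of
\<open>q < 2\<close> and of the radius of the balls.\<close>

section \<open>Real functions with increments controlled by an integral\<close>

text \<open>A sum over a fine tagged division telescopes on the left. On the right the terms with \<open>w\<close> form a
Riemann sum, and the deviations of \<open>(s' - s) * g t\<close> from the integral of \<open>g\<close> add up to an arbitrarily
small number by the Henstock lemma. So these deviations may be allowed as local errors. This replaces
the almost everywhere differentiability of indefinite integrals in the proofs below.\<close>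

lemma increment_le_integral_of_gauge_local_bound:
  fixes F w g1 g2 :: "real \<Rightarrow> real"
  assumes "a \<le> b" and w: "w integrable_on {a..b}" and g1: "g1 integrable_on {a..b}" and g2: "g2 integrable_on {a..b}"
    and loc: "\<And>t e. t \<in> {a..b} \<Longrightarrow> e > 0 \<Longrightarrow> \<exists>d>0. \<forall>s s'. a \<le> s \<and> s \<le> t \<and> t \<le> s' \<and> s' \<le> b \<and> s' - s < d \<longrightarrow>
      \<bar>F s' - F s\<bar> \<le> (w t + e) * (s' - s) + \<bar>integral {s..s'} g1 - (s' - s) * g1 t\<bar>
         + \<bar>integral {s..s'} g2 - (s' - s) * g2 t\<bar>"
  shows "\<bar>F b - F a\<bar> \<le> integral {a..b} w"
proof (rule field_le_epsilon)
  fix e :: real assume e: "e > 0"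
  \<comment> \<open>the error \<open>\<eta>\<close> is made four times: in the Riemann sum, in each of the two deviations, and as \<open>\<eta> * (b - a)\<close>\<close>
  define \<eta> where "\<eta> = e / (3 + (b - a))"
  have \<eta>: "\<eta> > 0" using e \<open>a \<le> b\<close> by (simp add: \<eta>_def)
  have "\<forall>t\<in>{a..b}. \<exists>d>0. \<forall>s s'. a \<le> s \<and> s \<le> t \<and> t \<le> s' \<and> s' \<le> b \<and> s' - s < d \<longrightarrow>
      \<bar>F s' - F s\<bar> \<le> (w t + \<eta>) * (s' - s) + \<bar>integral {s..s'} g1 - (s' - s) * g1 t\<bar>
         + \<bar>integral {s..s'} g2 - (s' - s) * g2 t\<bar>"
    using loc[OF _ \<eta>] by blast
  then obtain d where d: "\<And>t. t \<in> {a..b} \<Longrightarrow> d t > 0"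
    and dF: "\<And>t s s'. t \<in> {a..b} \<Longrightarrow> a \<le> s \<Longrightarrow> s \<le> t \<Longrightarrow> t \<le> s' \<Longrightarrow> s' \<le> b \<Longrightarrow> s' - s < d t \<Longrightarrow>
      \<bar>F s' - F s\<bar> \<le> (w t + \<eta>) * (s' - s) + \<bar>integral {s..s'} g1 - (s' - s) * g1 t\<bar>
         + \<bar>integral {s..s'} g2 - (s' - s) * g2 t\<bar>"
    by metis
  define \<delta> where "\<delta> t = (if t \<in> {a..b} then d t / 2 else 1)" for t
  have \<delta>: "\<delta> t > 0" for t using d by (simp add: \<delta>_def)
  obtain \<gamma>1 where \<gamma>1: "gauge \<gamma>1" "\<And>p. \<lbrakk>p tagged_partial_division_of (cbox a b); \<gamma>1 fine p\<rbrakk> \<Longrightarrow>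
             sum (\<lambda>(x,k). norm(measure lborel k *\<^sub>R g1 x - integral k g1)) p < \<eta>"
    by (rule Henstock_lemma[OF _ \<eta>, of g1 a b]) (use g1 in auto)
  obtain \<gamma>2 where \<gamma>2: "gauge \<gamma>2" "\<And>p. \<lbrakk>p tagged_partial_division_of (cbox a b); \<gamma>2 fine p\<rbrakk> \<Longrightarrow>
             sum (\<lambda>(x,k). norm(measure lborel k *\<^sub>R g2 x - integral k g2)) p < \<eta>"
    by (rule Henstock_lemma[OF _ \<eta>, of g2 a b]) (use g2 in auto)
  have "(w has_integral integral {a..b} w) (cbox a b)"
    using w by (simp add: integrable_integral)
  then obtain \<gamma>3 where \<gamma>3: "gauge \<gamma>3" "\<And>p. \<lbrakk>p tagged_division_of (cbox a b); \<gamma>3 fine p\<rbrakk> \<Longrightarrow>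
             norm ((\<Sum>(x,k)\<in>p. measure lborel k *\<^sub>R w x) - integral {a..b} w) < \<eta>"
    unfolding has_integral using \<eta> by meson
  define \<gamma> where "\<gamma> t = ball t (\<delta> t) \<inter> (\<gamma>1 t \<inter> (\<gamma>2 t \<inter> \<gamma>3 t))" for t
  have "gauge \<gamma>"
    unfolding \<gamma>_def gauge_def using \<gamma>1(1) \<gamma>2(1) \<gamma>3(1) \<delta>
    by (intro allI conjI open_Int) (auto simp: gauge_def)
  then obtain p where p: "p tagged_division_of cbox a b" "\<gamma> fine p"
    using fine_division_exists by blast
  have fine: "\<gamma>1 fine p" "\<gamma>2 fine p" "\<gamma>3 fine p" "(\<lambda>t. ball t (\<delta> t)) fine p"
    using p(2) by (auto simp: fine_def \<gamma>_def)
  have part: "p tagged_partial_division_of cbox a b"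
    using p(1) by (simp add: tagged_division_of_def)
  have fin: "finite p" using p(1) by (rule tagged_division_of_finite)
  have piece: "\<bar>F (Sup k) - F (Inf k)\<bar> \<le> measure lborel k * w x + \<eta> * measure lborel k
      + norm(measure lborel k *\<^sub>R g1 x - integral k g1) + norm(measure lborel k *\<^sub>R g2 x - integral k g2)"
    if xk: "(x, k) \<in> p" for x k
  proof -
    obtain s s' where k: "k = {s..s'}" using tagged_division_ofD(4)[OF p(1) xk] by auto
    have "x \<in> k" "k \<subseteq> {a..b}" using tagged_division_ofD(2,3)[OF p(1) xk] by auto
    then have b: "s \<le> x" "x \<le> s'" "a \<le> s" "s' \<le> b" by (auto simp: k)
    have kb: "k \<subseteq> ball x (\<delta> x)" using fine(4) xk by (auto simp: fine_def)
    moreover have "s \<in> k" "s' \<in> k" using b by (auto simp: k)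
    ultimately have "s \<in> ball x (\<delta> x)" "s' \<in> ball x (\<delta> x)" by blast+
    moreover have "x \<in> {a..b}" using b by auto
    ultimately have "s' - s < d x" by (auto simp: dist_real_def \<delta>_def abs_if split: if_splits)
    from dF[OF \<open>x \<in> {a..b}\<close> b(3,1,2,4) this] b
    show ?thesis by (simp add: k algebra_simps abs_minus_commute)
  qed
  have c: "(\<Sum>(x,k)\<in>p. measure lborel k) = b - a"
    using additive_content_tagged_division[OF p(1)] \<open>a \<le> b\<close> by simp
  have "\<bar>F b - F a\<bar> = \<bar>\<Sum>(x,k)\<in>p. F (Sup k) - F (Inf k)\<bar>"
    using additive_tagged_division_1[OF \<open>a \<le> b\<close>, of p F] p(1) by simp
  also have "\<dots> \<le> (\<Sum>(x,k)\<in>p. \<bar>F (Sup k) - F (Inf k)\<bar>)"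
    by (rule order_trans[OF sum_abs]) (auto intro!: sum_mono)
  also have "\<dots> \<le> (\<Sum>(x,k)\<in>p. measure lborel k * w x + \<eta> * measure lborel k
      + norm(measure lborel k *\<^sub>R g1 x - integral k g1) + norm(measure lborel k *\<^sub>R g2 x - integral k g2))"
    using piece by (intro sum_mono) auto
  also have "\<dots> = (\<Sum>(x,k)\<in>p. measure lborel k *\<^sub>R w x) + \<eta> * (\<Sum>(x,k)\<in>p. measure lborel k)
      + (\<Sum>(x,k)\<in>p. norm(measure lborel k *\<^sub>R g1 x - integral k g1)) + (\<Sum>(x,k)\<in>p. norm(measure lborel k *\<^sub>R g2 x - integral k g2))"
    by (simp add: sum.distrib sum_distrib_left case_prod_unfold)
  also have "\<dots> \<le> (integral {a..b} w + \<eta>) + \<eta> * (b - a) + \<eta> + \<eta>"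
    using \<gamma>1(2)[OF part fine(1)] \<gamma>2(2)[OF part fine(2)] \<gamma>3(2)[OF p(1) fine(3)] c
    by (auto simp: abs_less_iff)
  also have "\<dots> = integral {a..b} w + \<eta> * (3 + (b - a))" by (simp add: algebra_simps)
  also have "\<dots> = integral {a..b} w + e" using \<open>a \<le> b\<close> by (simp add: \<eta>_def)
  finally show "\<bar>F b - F a\<bar> \<le> integral {a..b} w + e" .
qed

text \<open>Curves carry information only on \<open>[0,1]\<close>; evaluating them at clamped times gives maps on all of
\<open>\<real>\<close>, for which joint measurability and continuity can be stated without restricted spaces.\<close>

definition unit_clamp :: "real \<Rightarrow> real" where "unit_clamp t = max 0 (min 1 t)"

lemma unit_clamp: "unit_clamp t \<in> {0..1}" "t \<in> {0..1} \<Longrightarrow> unit_clamp t = t"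
  by (auto simp: unit_clamp_def)

text \<open>For integrable \<open>g\<close> this means that \<open>u\<close> is absolutely continuous on \<open>[0,1]\<close> with \<open>|u'| \<le> g\<close> almost
everywhere. The form with increments needs no derivative of \<open>u\<close>, and it is the form in which the bounds
on Sobolev functions along curves arise.\<close>

definition controlled :: "(real \<Rightarrow> real) \<Rightarrow> (real \<Rightarrow> ennreal) \<Rightarrow> bool" where
  "controlled u g \<longleftrightarrow> (\<forall>s t. 0 \<le> s \<and> s \<le> t \<and> t \<le> 1 \<longrightarrow>
     ennreal \<bar>u t - u s\<bar> \<le> (\<integral>\<^sup>+r\<in>{s..t}. g r \<partial>lborel))"

lemma controlledD:
  "controlled u g \<Longrightarrow> 0 \<le> s \<Longrightarrow> s \<le> t \<Longrightarrow> t \<le> 1 \<Longrightarrow> ennreal \<bar>u t - u s\<bar> \<le> (\<integral>\<^sup>+r\<in>{s..t}. g r \<partial>lborel)"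
  by (auto simp: controlled_def)

text \<open>Bounds are stated with the Lebesgue integral of extended values, as in the definition of weak upper
gradients, while the Henstock lemma speaks of gauge integrals of real functions.\<close>

lemma nn_integral_interval_eq_HK:
  fixes g :: "real \<Rightarrow> ennreal"
  assumes [measurable]: "g \<in> borel_measurable borel" and fin: "(\<integral>\<^sup>+r\<in>{0..1}. g r \<partial>lborel) < \<infinity>"
    and "0 \<le> s" "t \<le> 1"
  shows "(\<lambda>r. enn2real (g r)) integrable_on {s..t}"
    and "(\<integral>\<^sup>+r\<in>{s..t}. g r \<partial>lborel) = ennreal (integral {s..t} (\<lambda>r. enn2real (g r)))"
proof -
  have le: "(\<integral>\<^sup>+r\<in>{s..t}. g r \<partial>lborel) \<le> (\<integral>\<^sup>+r\<in>{0..1}. g r \<partial>lborel)"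
    using assms(3,4) by (intro nn_integral_mono) (auto split: split_indicator)
  have "AE r in lborel. g r * indicator {s..t} r \<noteq> \<infinity>"
    using le fin by (intro nn_integral_PInf_AE) auto
  then have "(\<integral>\<^sup>+r\<in>{s..t}. g r \<partial>lborel) = (\<integral>\<^sup>+r. ennreal (enn2real (g r) * indicator {s..t} r) \<partial>lborel)"
    by (intro nn_integral_cong_AE) (auto split: split_indicator simp: less_top)
  moreover then obtain I where I: "(\<integral>\<^sup>+r\<in>{s..t}. g r \<partial>lborel) = ennreal I" "0 \<le> I"
    using le fin by (metis ennreal_cases infinity_ennreal_def le_less_trans less_irrefl)
  ultimately have "((\<lambda>r. enn2real (g r) * indicator {s..t} r) has_integral I) UNIV"
    by (intro nn_integral_has_integral) auto
  then have *: "((\<lambda>r. enn2real (g r)) has_integral I) {s..t}"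
    using has_integral_restrict_UNIV[of "{s..t}" "\<lambda>r. enn2real (g r)" I]
    by (simp add: indicator_def of_bool_def if_distrib cong: if_cong)
  then show "(\<lambda>r. enn2real (g r)) integrable_on {s..t}" by blast
  show "(\<integral>\<^sup>+r\<in>{s..t}. g r \<partial>lborel) = ennreal (integral {s..t} (\<lambda>r. enn2real (g r)))"
    using * I by (simp add: integral_unique)
qed

lemma controlled_cong_AE:
  assumes "controlled u g" "AE r in lborel. r \<in> {0..1} \<longrightarrow> g r = g' r"
  shows "controlled u g'"
  unfolding controlled_def
proof safe
  fix s t :: real assume st: "0 \<le> s" "s \<le> t" "t \<le> 1"
  have "(\<integral>\<^sup>+r\<in>{s..t}. g r \<partial>lborel) = (\<integral>\<^sup>+r\<in>{s..t}. g' r \<partial>lborel)"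
    using assms(2) st by (intro nn_integral_cong_AE) (auto split: split_indicator)
  then show "ennreal \<bar>u t - u s\<bar> \<le> (\<integral>\<^sup>+r\<in>{s..t}. g' r \<partial>lborel)"
    using controlledD[OF assms(1) st] by simp
qed

lemma controlled_mono_AE:
  assumes "controlled u g" "AE r in lborel. r \<in> {0..1} \<longrightarrow> g r \<le> g' r"
  shows "controlled u g'"
  unfolding controlled_def
proof safe
  fix s t :: real assume st: "0 \<le> s" "s \<le> t" "t \<le> 1"
  have "(\<integral>\<^sup>+r\<in>{s..t}. g r \<partial>lborel) \<le> (\<integral>\<^sup>+r\<in>{s..t}. g' r \<partial>lborel)"
    using assms(2) st by (intro nn_integral_mono_AE) (auto split: split_indicator)
  then show "ennreal \<bar>u t - u s\<bar> \<le> (\<integral>\<^sup>+r\<in>{s..t}. g' r \<partial>lborel)"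
    using controlledD[OF assms(1) st] by (rule order_trans[rotated])
qed

lemma controlled_real:
  assumes "controlled u g" and [measurable]: "g \<in> borel_measurable borel"
    and fin: "(\<integral>\<^sup>+r\<in>{0..1}. g r \<partial>lborel) < \<infinity>"
    and st: "0 \<le> s" "s \<le> t" "t \<le> 1"
  shows "\<bar>u t - u s\<bar> \<le> integral {s..t} (\<lambda>r. enn2real (g r))"
proof -
  have "ennreal \<bar>u t - u s\<bar> \<le> ennreal (integral {s..t} (\<lambda>r. enn2real (g r)))"
    using controlledD[OF assms(1) st] nn_integral_interval_eq_HK(2)[OF assms(2) fin, of s t] st by simp
  moreover have "0 \<le> integral {s..t} (\<lambda>r. enn2real (g r))"
    using nn_integral_interval_eq_HK(1)[OF assms(2) fin, of s t] st by (intro integral_nonneg) auto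
  ultimately show ?thesis by simp
qed

text \<open>For each tag the increment is compared with the smaller of the two functions at that tag; the
deviations of both integrals are allowed as errors.\<close>

lemma controlled_min:
  assumes u1: "controlled u g1" and u2: "controlled u g2"
    and [measurable]: "g1 \<in> borel_measurable borel" "g2 \<in> borel_measurable borel"
    and fin1: "(\<integral>\<^sup>+r\<in>{0..1}. g1 r \<partial>lborel) < \<infinity>" and fin2: "(\<integral>\<^sup>+r\<in>{0..1}. g2 r \<partial>lborel) < \<infinity>"
  shows "controlled u (\<lambda>r. min (g1 r) (g2 r))"
  unfolding controlled_def
proof safe
  fix s t :: real assume st: "0 \<le> s" "s \<le> t" "t \<le> 1"
  let ?g = "\<lambda>r. min (g1 r) (g2 r)"
  have fin: "(\<integral>\<^sup>+r\<in>{0..1}. ?g r \<partial>lborel) < \<infinity>"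
    using fin1 by (rule le_less_trans[rotated]) (auto intro!: nn_integral_mono split: split_indicator)
  have m: "?g \<in> borel_measurable borel" by simp
  define h1 h2 where "h1 r = enn2real (g1 r)" and "h2 r = enn2real (g2 r)" for r
  have i1: "h1 integrable_on {s..t}" and i2: "h2 integrable_on {s..t}"
    unfolding h1_def h2_def using st by (auto intro!: nn_integral_interval_eq_HK(1) fin1 fin2)
  have b1: "\<bar>u t' - u s'\<bar> \<le> integral {s'..t'} h1" if "s \<le> s'" "s' \<le> t'" "t' \<le> t" for s' t'
    unfolding h1_def using that st by (intro controlled_real u1 fin1) auto
  have b2: "\<bar>u t' - u s'\<bar> \<le> integral {s'..t'} h2" if "s \<le> s'" "s' \<le> t'" "t' \<le> t" for s' t'
    unfolding h2_def using that st by (intro controlled_real u2 fin2) auto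
  have "\<bar>u t - u s\<bar> \<le> integral {s..t} (\<lambda>r. min (h1 r) (h2 r))"
  proof (rule increment_le_integral_of_gauge_local_bound[OF st(2) _ i1 i2])
    show "(\<lambda>r. min (h1 r) (h2 r)) integrable_on {s..t}"
    proof -
      have "h1 absolutely_integrable_on {s..t}" "h2 absolutely_integrable_on {s..t}"
        using i1 i2 by (auto intro!: nonnegative_absolutely_integrable_1 simp: h1_def h2_def)
      then show ?thesis
        by (intro set_lebesgue_integral_eq_integral(1) absolutely_integrable_min_1)
    qed
    fix r e :: real assume r: "r \<in> {s..t}" "e > 0"
    have "\<bar>u s'' - u s'\<bar> \<le> (min (h1 r) (h2 r) + e) * (s'' - s') + \<bar>integral {s'..s''} h1 - (s'' - s') * h1 r\<bar>
         + \<bar>integral {s'..s''} h2 - (s'' - s') * h2 r\<bar>" if "s \<le> s'" "s' \<le> r" "r \<le> s''" "s'' \<le> t" for s' s''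
    proof -
      have "0 \<le> e * (s'' - s')" using r that by simp
      then show ?thesis
        using b1[of s' s''] b2[of s' s''] that
        by (cases "h1 r \<le> h2 r") (auto simp: min_def algebra_simps)
    qed
    then show "\<exists>d>0. \<forall>s' s''. s \<le> s' \<and> s' \<le> r \<and> r \<le> s'' \<and> s'' \<le> t \<and> s'' - s' < d \<longrightarrow>
      \<bar>u s'' - u s'\<bar> \<le> (min (h1 r) (h2 r) + e) * (s'' - s') + \<bar>integral {s'..s''} h1 - (s'' - s') * h1 r\<bar>
         + \<bar>integral {s'..s''} h2 - (s'' - s') * h2 r\<bar>"
      by (intro exI[of _ 1]) auto
  qed
  also have "integral {s..t} (\<lambda>r. min (h1 r) (h2 r)) = integral {s..t} (\<lambda>r. enn2real (?g r))"
  proof -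
    have "AE r in lborel. g1 r * indicator {0..1} r \<noteq> \<infinity>" "AE r in lborel. g2 r * indicator {0..1} r \<noteq> \<infinity>"
      using fin1 fin2 by (intro nn_integral_PInf_AE; simp)+
    then have "AE r in lborel. r \<in> {s..t} \<longrightarrow> min (h1 r) (h2 r) = enn2real (?g r)"
    proof eventually_elim
      case (elim r)
      show ?case
      proof
        assume "r \<in> {s..t}"
        then have "g1 r < \<top>" "g2 r < \<top>" using elim st by (auto simp: less_top split: split_indicator_asm)
        then show "min (h1 r) (h2 r) = enn2real (?g r)"
          unfolding h1_def h2_def by (cases "g1 r"; cases "g2 r") (auto simp: min_def)
      qed
    qed
    then obtain N where N: "N \<in> null_sets lborel" "\<And>r. r \<notin> N \<Longrightarrow> r \<in> {s..t} \<longrightarrow> min (h1 r) (h2 r) = enn2real (?g r)"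
      by (auto elim!: AE_E3)
    then have "negligible N"
      using negligible_iff_null_sets null_sets_completionI by blast
    then show ?thesis
      by (rule integral_spike) (use N(2) in auto)
  qed
  finally show "ennreal \<bar>u t - u s\<bar> \<le> (\<integral>\<^sup>+r\<in>{s..t}. ?g r \<partial>lborel)"
    using nn_integral_interval_eq_HK(2)[OF m fin, of s t] st by (simp add: ennreal_leI)
qed

text \<open>At times where the slope is at most \<open>k\<close> the local bound is the definition of the slope. On the null set
of the other times the bound by \<open>g\<close> is used: after \<open>g\<close> has been set to \<open>0\<close> there, the integral of \<open>g\<close> over a
small interval around such a time is itself one of the admissible errors.\<close>

lemma controlled_by_slope:
  assumes u: "controlled u g"
    and [measurable]: "g \<in> borel_measurable borel" "k \<in> borel_measurable borel"
    and fing: "(\<integral>\<^sup>+r\<in>{0..1}. g r \<partial>lborel) < \<infinity>" and fink: "(\<integral>\<^sup>+r\<in>{0..1}. k r \<partial>lborel) < \<infinity>"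
    and slope: "AE r in lborel. r \<in> {0..1} \<longrightarrow> Limsup (at r within {0..1}) (\<lambda>s. ennreal (\<bar>u s - u r\<bar> / \<bar>s - r\<bar>)) \<le> k r"
  shows "controlled u k"
proof -
  have "AE r in lborel. k r * indicator {0..1} r \<noteq> \<infinity>"
    using fink by (intro nn_integral_PInf_AE; simp)
  with slope have "AE r in lborel. r \<in> {0..1} \<longrightarrow> k r < \<infinity> \<and>
      Limsup (at r within {0..1}) (\<lambda>s. ennreal (\<bar>u s - u r\<bar> / \<bar>s - r\<bar>)) \<le> k r"
    by eventually_elim (auto simp: less_top split: split_indicator_asm)
  then obtain N where N: "N \<in> null_sets lborel" "\<And>r. r \<notin> N \<Longrightarrow> r \<in> {0..1} \<Longrightarrow> k r < \<infinity> \<and>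
      Limsup (at r within {0..1}) (\<lambda>s. ennreal (\<bar>u s - u r\<bar> / \<bar>s - r\<bar>)) \<le> k r"
    by (auto elim!: AE_E3)
  \<comment> \<open>the bounds are redefined on the exceptional null set, which leaves all integrals unchanged\<close>
  define k' where "k' r = (if r \<in> N then 0 else k r)" for r
  define g' where "g' r = (if r \<in> N then 0 else g r)" for r
  have [measurable]: "N \<in> sets borel" using N by auto
  have [measurable]: "k' \<in> borel_measurable borel" "g' \<in> borel_measurable borel"
    unfolding k'_def g'_def by auto
  have aeN: "AE r in lborel. r \<notin> N" using N(1) by (rule AE_not_in)
  then have aek: "AE r in lborel. r \<in> {0..1} \<longrightarrow> k' r = k r" and aeg: "AE r in lborel. r \<in> {0..1} \<longrightarrow> g r = g' r"
    by (auto simp: k'_def g'_def)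
  have u': "controlled u g'" using u aeg by (rule controlled_cong_AE)
  have fing': "(\<integral>\<^sup>+r\<in>{0..1}. g' r \<partial>lborel) < \<infinity>"
    using fing by (rule le_less_trans[rotated]) (auto intro!: nn_integral_mono split: split_indicator simp: g'_def)
  have fink': "(\<integral>\<^sup>+r\<in>{0..1}. k' r \<partial>lborel) < \<infinity>"
    using fink by (rule le_less_trans[rotated]) (auto intro!: nn_integral_mono split: split_indicator simp: k'_def)
  have "controlled u k'"
    unfolding controlled_def
  proof safe
    fix s t :: real assume st: "0 \<le> s" "s \<le> t" "t \<le> 1"
    define h where "h r = enn2real (g' r)" for r
    define w where "w r = enn2real (k' r)" for r
    have i1: "h integrable_on {s..t}" and i2: "w integrable_on {s..t}"
      unfolding h_def w_def using st by (auto intro!: nn_integral_interval_eq_HK(1) fing' fink')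
    have b: "\<bar>u t' - u s'\<bar> \<le> integral {s'..t'} h" if "s \<le> s'" "s' \<le> t'" "t' \<le> t" for s' t'
      unfolding h_def using that st by (intro controlled_real u' fing') auto
    have "\<bar>u t - u s\<bar> \<le> integral {s..t} w"
    proof (rule increment_le_integral_of_gauge_local_bound[OF st(2) i2 i1 i1])
      fix r e :: real assume r: "r \<in> {s..t}" "e > 0"
      show "\<exists>d>0. \<forall>s' s''. s \<le> s' \<and> s' \<le> r \<and> r \<le> s'' \<and> s'' \<le> t \<and> s'' - s' < d \<longrightarrow>
      \<bar>u s'' - u s'\<bar> \<le> (w r + e) * (s'' - s') + \<bar>integral {s'..s''} h - (s'' - s') * h r\<bar>
         + \<bar>integral {s'..s''} h - (s'' - s') * h r\<bar>"
      proof (cases "r \<in> N")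
        case True
        then have "h r = 0" "w r = 0" by (auto simp: h_def w_def g'_def k'_def)
        have "\<bar>u s'' - u s'\<bar> \<le> (w r + e) * (s'' - s') + \<bar>integral {s'..s''} h - (s'' - s') * h r\<bar>
         + \<bar>integral {s'..s''} h - (s'' - s') * h r\<bar>" if "s \<le> s'" "s' \<le> r" "r \<le> s''" "s'' \<le> t" for s' s''
        proof -
          have "0 \<le> e * (s'' - s')" using r that by simp
          then show ?thesis using b[of s' s''] that \<open>h r = 0\<close> \<open>w r = 0\<close> by simp
        qed
        then show ?thesis by (intro exI[of _ 1]) auto
      next
        case False
        with N(2) r st have kr: "k r < \<infinity>"
          and L: "Limsup (at r within {0..1}) (\<lambda>s. ennreal (\<bar>u s - u r\<bar> / \<bar>s - r\<bar>)) \<le> k r" by auto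
        have kw: "k r = ennreal (w r)" "0 \<le> w r" using kr False by (auto simp: w_def k'_def)
        have "Limsup (at r within {0..1}) (\<lambda>s. ennreal (\<bar>u s - u r\<bar> / \<bar>s - r\<bar>)) < ennreal (w r + e)"
          using L r by (auto simp: kw(1) intro!: le_less_trans[OF L] ennreal_lessI add_nonneg_pos kw(2))
        then have "eventually (\<lambda>s. ennreal (\<bar>u s - u r\<bar> / \<bar>s - r\<bar>) < ennreal (w r + e)) (at r within {0..1})"
          by (rule Limsup_lessD)
        then obtain d where d: "d > 0" "\<And>s. s \<in> {0..1} \<Longrightarrow> s \<noteq> r \<Longrightarrow> dist s r < d \<Longrightarrow> ennreal (\<bar>u s - u r\<bar> / \<bar>s - r\<bar>) < ennreal (w r + e)"
          unfolding eventually_at by auto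
        have *: "\<bar>u s - u r\<bar> \<le> (w r + e) * \<bar>s - r\<bar>" if "s \<in> {0..1}" "\<bar>s - r\<bar> < d" for s
        proof (cases "s = r")
          case False
          then show ?thesis using d(2)[of s] that by (simp add: dist_real_def ennreal_less_iff divide_simps split: if_splits)
        qed simp
        have "\<bar>u s'' - u s'\<bar> \<le> (w r + e) * (s'' - s')" if "s \<le> s'" "s' \<le> r" "r \<le> s''" "s'' \<le> t" "s'' - s' < d" for s' s''
        proof -
          have "\<bar>u s'' - u r\<bar> \<le> (w r + e) * (s'' - r)" "\<bar>u s' - u r\<bar> \<le> (w r + e) * (r - s')"
            using *[of s''] *[of s'] that st by auto
          then show ?thesis by (simp add: algebra_simps)
        qed
        then have "\<bar>u s'' - u s'\<bar> \<le> (w r + e) * (s'' - s') + \<bar>integral {s'..s''} h - (s'' - s') * h r\<bar>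
         + \<bar>integral {s'..s''} h - (s'' - s') * h r\<bar>" if "s \<le> s'" "s' \<le> r" "r \<le> s''" "s'' \<le> t" "s'' - s' < d" for s' s''
          using that by (meson abs_ge_zero add_increasing2)
        then show ?thesis using d(1) by blast
      qed
    qed
    then show "ennreal \<bar>u t - u s\<bar> \<le> (\<integral>\<^sup>+r\<in>{s..t}. k' r \<partial>lborel)"
      using nn_integral_interval_eq_HK(2)[OF _ fink', of s t] st by (simp add: ennreal_leI w_def[abs_def])
  qed
  then show ?thesis using aek by (rule controlled_cong_AE)
qed

lemma controlled_continuous_on:
  assumes u: "controlled u g" and [measurable]: "g \<in> borel_measurable borel"
    and fin: "(\<integral>\<^sup>+r\<in>{0..1}. g r \<partial>lborel) < \<infinity>"
  shows "continuous_on {0..1} u"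
proof -
  define A where "A t = integral {0..t} (\<lambda>r. enn2real (g r))" for t
  have i: "(\<lambda>r. enn2real (g r)) integrable_on {0..1}"
    by (rule nn_integral_interval_eq_HK(1)[OF _ fin]) auto
  have A: "continuous_on {0..1} A"
    unfolding A_def by (rule indefinite_integral_continuous_1[OF i])
  have b: "\<bar>u t - u s\<bar> \<le> \<bar>A t - A s\<bar>" if "s \<in> {0..1}" "t \<in> {0..1}" for s t
  proof -
    have *: "\<bar>u t - u s\<bar> \<le> A t - A s" if "0 \<le> s" "s \<le> t" "t \<le> 1" for s t
    proof -
      have "A s + integral {s..t} (\<lambda>r. enn2real (g r)) = A t"
        unfolding A_def using that 
        by (intro Henstock_Kurzweil_Integration.integral_combine integrable_subinterval_real[OF i]) auto
      then show ?thesis using controlled_real[OF u _ fin that] by simp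
    qed
    show ?thesis using *[of s t] *[of t s] that by (cases "s \<le> t") auto
  qed
  show ?thesis
    unfolding continuous_on_iff dist_real_def
  proof safe
    fix t e :: real assume "t \<in> {0..1}" "e > 0"
    then obtain d where "d > 0" "\<And>s. s \<in> {0..1} \<Longrightarrow> \<bar>s - t\<bar> < d \<Longrightarrow> \<bar>A s - A t\<bar> < e"
      using A[unfolded continuous_on_iff dist_real_def] by blast
    then show "\<exists>d>0. \<forall>s\<in>{0..1}. \<bar>s - t\<bar> < d \<longrightarrow> \<bar>u s - u t\<bar> < e"
      using b[OF \<open>t \<in> {0..1}\<close>] by (meson le_less_trans)
  qed
qed

text \<open>Both factors are continuous, so the values of \<open>c\<close> and \<open>u\<close> in a product increment can be replaced by those
at the tag up to a small \<open>\<eta>\<close>. The errors are then deviations for the functions \<open>M * g\<close> and \<open>M * v\<close>, where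
\<open>M\<close> bounds both factors.\<close>

lemma controlled_mult:
  assumes c: "controlled c v" and u: "controlled u g"
    and [measurable]: "v \<in> borel_measurable borel" "g \<in> borel_measurable borel"
    and finv: "(\<integral>\<^sup>+r\<in>{0..1}. v r \<partial>lborel) < \<infinity>" and fing: "(\<integral>\<^sup>+r\<in>{0..1}. g r \<partial>lborel) < \<infinity>"
  shows "controlled (\<lambda>r. c r * u r) (\<lambda>r. ennreal \<bar>c r\<bar> * g r + ennreal \<bar>u r\<bar> * v r)"
proof -
  have cont_clamp: "continuous_on UNIV unit_clamp" unfolding unit_clamp_def by (intro continuous_intros)
  have cc: "continuous_on {0..1} c" using c finv by (intro controlled_continuous_on) auto
  have cu: "continuous_on {0..1} u" using u fing by (intro controlled_continuous_on) auto
  have "continuous_on UNIV (\<lambda>r. c (unit_clamp r))" "continuous_on UNIV (\<lambda>r. u (unit_clamp r))"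
    by (rule continuous_on_compose2[OF cc cont_clamp] continuous_on_compose2[OF cu cont_clamp]; use unit_clamp in auto)+
  then have [measurable]: "(\<lambda>r. c (unit_clamp r)) \<in> borel_measurable borel" "(\<lambda>r. u (unit_clamp r)) \<in> borel_measurable borel"
    by (auto intro: borel_measurable_continuous_onI)
  have "bounded (c ` {0..1})" "bounded (u ` {0..1})"
    using cc cu by (auto intro!: compact_imp_bounded compact_continuous_image)
  then obtain Mc Mu where "\<forall>y\<in>c ` {0..1}. norm y \<le> Mc" "\<forall>y\<in>u ` {0..1}. norm y \<le> Mu"
    unfolding bounded_iff by blast
  then have Mc: "\<bar>c r\<bar> \<le> Mc" and Mu: "\<bar>u r\<bar> \<le> Mu" if "r \<in> {0..1}" for r
    using that by auto
  define M where "M = Mc + Mu + 1"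
  have M0: "0 \<le> Mc" "0 \<le> Mu" using Mc[of 0] Mu[of 0] by auto
  define g' where "g' r = enn2real (g r)" for r
  define v' where "v' r = enn2real (v r)" for r
  have [measurable]: "g' \<in> borel_measurable borel" "v' \<in> borel_measurable borel"
    unfolding g'_def v'_def by auto
  have nn: "0 \<le> g' r" "0 \<le> v' r" for r by (auto simp: g'_def v'_def)
  define w where "w r = \<bar>c (unit_clamp r)\<bar> * g' r + \<bar>u (unit_clamp r)\<bar> * v' r" for r
  have [measurable]: "w \<in> borel_measurable borel" unfolding w_def by measurable
  have w0: "0 \<le> w r" for r by (auto simp: w_def nn)
  have le: "ennreal (g' r) \<le> g r" "ennreal (v' r) \<le> v r" for r
    unfolding g'_def v'_def by (cases "g r"; cases "v r"; simp)+
  have finw: "(\<integral>\<^sup>+r\<in>{0..1}. ennreal (w r) \<partial>lborel) < \<infinity>"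
  proof -
    have "(\<integral>\<^sup>+r\<in>{0..1}. ennreal (w r) \<partial>lborel) \<le> (\<integral>\<^sup>+r. ennreal Mc * (g r * indicator {0..1} r) + ennreal Mu * (v r * indicator {0..1} r) \<partial>lborel)"
    proof (intro nn_integral_mono)
      fix r
      have "ennreal (w r) \<le> ennreal (Mc * g' r + Mu * v' r)"
        unfolding w_def using Mc[OF unit_clamp(1)] Mu[OF unit_clamp(1)] nn by (intro ennreal_leI add_mono mult_right_mono) auto
      also have "\<dots> = ennreal Mc * g' r + ennreal Mu * v' r"
        using M0 nn by (simp add: ennreal_mult)
      also have "\<dots> \<le> ennreal Mc * g r + ennreal Mu * v r"
        by (intro add_mono mult_left_mono le) auto
      finally show "ennreal (w r) * indicator {0..1} r \<le> ennreal Mc * (g r * indicator {0..1} r) + ennreal Mu * (v r * indicator {0..1} r)"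
        by (auto split: split_indicator)
    qed
    also have "\<dots> = ennreal Mc * (\<integral>\<^sup>+r\<in>{0..1}. g r \<partial>lborel) + ennreal Mu * (\<integral>\<^sup>+r\<in>{0..1}. v r \<partial>lborel)"
      by (simp add: nn_integral_add nn_integral_cmult)
    also have "\<dots> < \<infinity>"
      using finv fing by (simp add: ennreal_mult_less_top)
    finally show ?thesis .
  qed
  have "controlled (\<lambda>r. c r * u r) (\<lambda>r. ennreal (w r))"
    unfolding controlled_def
  proof safe
    fix s t :: real assume st: "0 \<le> s" "s \<le> t" "t \<le> 1"
    have iw: "w integrable_on {s..t}"
      using nn_integral_interval_eq_HK(1)[OF _ finw, of s t] st w0 by simp
    have ig: "g' integrable_on {s..t}" and iv: "v' integrable_on {s..t}"
      unfolding g'_def v'_def using st by (auto intro!: nn_integral_interval_eq_HK(1) fing finv)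
    have bu: "\<bar>u t' - u s'\<bar> \<le> integral {s'..t'} g'" if "s \<le> s'" "s' \<le> t'" "t' \<le> t" for s' t'
      unfolding g'_def using that st by (intro controlled_real u fing) auto
    have bc: "\<bar>c t' - c s'\<bar> \<le> integral {s'..t'} v'" if "s \<le> s'" "s' \<le> t'" "t' \<le> t" for s' t'
      unfolding v'_def using that st by (intro controlled_real c finv) auto
    have "\<bar>c t * u t - c s * u s\<bar> \<le> integral {s..t} w"
    proof (rule increment_le_integral_of_gauge_local_bound[OF st(2) iw, where F = "\<lambda>r. c r * u r" and ?g1.0 = "\<lambda>r. M * g' r" and ?g2.0 = "\<lambda>r. M * v' r"])
      show "(\<lambda>r. M * g' r) integrable_on {s..t}" "(\<lambda>r. M * v' r) integrable_on {s..t}"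
        using ig iv by (auto intro: integrable_on_mult_right)
      fix r e :: real assume r: "r \<in> {s..t}" "e > 0"
      define \<eta> where "\<eta> = min 1 (e / (1 + g' r + v' r))"
      have pos: "1 + g' r + v' r > 0" using nn[of r] by simp
      have \<eta>: "0 < \<eta>" "\<eta> \<le> 1" using r pos by (auto simp: \<eta>_def)
      have "\<eta> * (g' r + v' r) \<le> e / (1 + g' r + v' r) * (g' r + v' r)"
        using nn[of r] by (intro mult_right_mono) (auto simp: \<eta>_def)
      also have "\<dots> \<le> e"
        using r pos nn[of r] by (simp add: divide_simps)
      finally have \<eta>e: "\<eta> * (g' r + v' r) \<le> e" .
      have r01: "r \<in> {0..1}" using r st by auto
      obtain d1 where d1: "d1 > 0" "\<And>s. s \<in> {0..1} \<Longrightarrow> \<bar>s - r\<bar> < d1 \<Longrightarrow> \<bar>c s - c r\<bar> < \<eta>"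
        using cc[unfolded continuous_on_iff dist_real_def] r01 \<eta>(1) by meson
      obtain d2 where d2: "d2 > 0" "\<And>s. s \<in> {0..1} \<Longrightarrow> \<bar>s - r\<bar> < d2 \<Longrightarrow> \<bar>u s - u r\<bar> < \<eta>"
        using cu[unfolded continuous_on_iff dist_real_def] r01 \<eta>(1) by meson
      have "\<bar>c s'' * u s'' - c s' * u s'\<bar> \<le> (w r + e) * (s'' - s') + \<bar>integral {s'..s''} (\<lambda>r. M * g' r) - (s'' - s') * (M * g' r)\<bar>
         + \<bar>integral {s'..s''} (\<lambda>r. M * v' r) - (s'' - s') * (M * v' r)\<bar>"
        if *: "s \<le> s'" "s' \<le> r" "r \<le> s''" "s'' \<le> t" "s'' - s' < min d1 d2" for s' s''
      proof -
        have c1: "\<bar>c s''\<bar> \<le> \<bar>c r\<bar> + \<eta>" using d1(2)[of s''] * st by force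
        have u1: "\<bar>u s'\<bar> \<le> \<bar>u r\<bar> + \<eta>" using d2(2)[of s'] * st by force
        have M1: "\<bar>c r\<bar> + \<eta> \<le> M" "\<bar>u r\<bar> + \<eta> \<le> M"
          using Mc[OF r01] Mu[OF r01] M0 \<eta> by (auto simp: M_def)
        let ?I = "s'' - s'" and ?G = "integral {s'..s''} g'" and ?V = "integral {s'..s''} v'"
        have I0: "?I \<ge> 0" using * by simp
        have prod: "(a + \<eta>) * X \<le> (a * y) * ?I + \<eta> * y * ?I + \<bar>M * X - ?I * (M * y)\<bar>" if "0 \<le> a" "a + \<eta> \<le> M" for a X y
        proof -
          have "(a + \<eta>) * (X - ?I * y) \<le> (a + \<eta>) * \<bar>X - ?I * y\<bar>" using that \<eta> by (intro mult_left_mono) auto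
          also have "\<dots> \<le> M * \<bar>X - ?I * y\<bar>" using that by (intro mult_right_mono) auto
          also have "\<dots> = \<bar>M * (X - ?I * y)\<bar>" using that \<eta> by (simp add: abs_mult)
          finally show ?thesis by (simp add: algebra_simps)
        qed
        have "c s'' * u s'' - c s' * u s' = c s'' * (u s'' - u s') + u s' * (c s'' - c s')" by (simp add: algebra_simps)
        then have "\<bar>c s'' * u s'' - c s' * u s'\<bar> \<le> \<bar>c s''\<bar> * \<bar>u s'' - u s'\<bar> + \<bar>u s'\<bar> * \<bar>c s'' - c s'\<bar>"
          by (metis abs_mult abs_triangle_ineq)
        also have "\<dots> \<le> (\<bar>c r\<bar> + \<eta>) * ?G + (\<bar>u r\<bar> + \<eta>) * ?V"
          using c1 u1 bu[of s' s''] bc[of s' s''] * \<eta> by (intro add_mono mult_mono) auto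
        also have "\<dots> \<le> (\<bar>c r\<bar> * g' r * ?I + \<eta> * g' r * ?I + \<bar>M * ?G - ?I * (M * g' r)\<bar>)
            + (\<bar>u r\<bar> * v' r * ?I + \<eta> * v' r * ?I + \<bar>M * ?V - ?I * (M * v' r)\<bar>)"
          by (intro add_mono prod M1) auto
        also have "\<dots> = (w r + \<eta> * (g' r + v' r)) * ?I + \<bar>M * ?G - ?I * (M * g' r)\<bar> + \<bar>M * ?V - ?I * (M * v' r)\<bar>"
          by (simp add: w_def unit_clamp(2)[OF r01] algebra_simps)
        also have "\<dots> \<le> (w r + e) * ?I + \<bar>M * ?G - ?I * (M * g' r)\<bar> + \<bar>M * ?V - ?I * (M * v' r)\<bar>"
          using \<eta>e I0 by (intro add_mono mult_right_mono) auto
        finally show ?thesis by simp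
      qed
      then show "\<exists>d>0. \<forall>s' s''. s \<le> s' \<and> s' \<le> r \<and> r \<le> s'' \<and> s'' \<le> t \<and> s'' - s' < d \<longrightarrow>
        \<bar>c s'' * u s'' - c s' * u s'\<bar> \<le> (w r + e) * (s'' - s') + \<bar>integral {s'..s''} (\<lambda>r. M * g' r) - (s'' - s') * (M * g' r)\<bar>
         + \<bar>integral {s'..s''} (\<lambda>r. M * v' r) - (s'' - s') * (M * v' r)\<bar>"
        using d1(1) d2(1) by (intro exI[of _ "min d1 d2"] conjI allI impI) (simp, blast)
    qed
    then show "ennreal \<bar>c t * u t - c s * u s\<bar> \<le> (\<integral>\<^sup>+r\<in>{s..t}. ennreal (w r) \<partial>lborel)"
      using nn_integral_interval_eq_HK(2)[OF _ finw, of s t] st w0 by (simp add: ennreal_leI)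
  qed
  then show ?thesis
  proof (rule controlled_mono_AE, intro AE_I2 impI)
    fix r :: real assume r: "r \<in> {0..1}"
    have "ennreal (w r) = ennreal \<bar>c r\<bar> * g' r + ennreal \<bar>u r\<bar> * v' r"
      using nn by (simp add: w_def unit_clamp(2)[OF r] ennreal_mult)
    also have "\<dots> \<le> ennreal \<bar>c r\<bar> * g r + ennreal \<bar>u r\<bar> * v r"
      by (intro add_mono mult_left_mono le) auto
    finally show "ennreal (w r) \<le> ennreal \<bar>c r\<bar> * g r + ennreal \<bar>u r\<bar> * v r" .
  qed
qed

text \<open>The values of \<open>u\<close> at rational times and at almost all other times satisfy the bound pairwise, because
between two such times there is a rational one. With respect to the distance \<open>|A t - A s|\<close>, where \<open>A\<close> is
the indefinite integral of \<open>g\<close>, the function is 1-Lipschitz on this set, and McShane's formula extends it.\<close>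

lemma controlled_extension:
  fixes u :: "real \<Rightarrow> real"
  assumes [measurable]: "g \<in> borel_measurable borel"
    and fin: "(\<integral>\<^sup>+r\<in>{0..1}. g r \<partial>lborel) < \<infinity>"
    and rat: "\<And>s t. s \<in> \<rat> \<inter> {0..1} \<Longrightarrow> t \<in> \<rat> \<inter> {0..1} \<Longrightarrow>
        ennreal \<bar>u t - u s\<bar> \<le> (\<integral>\<^sup>+r\<in>{min s t..max s t}. g r \<partial>lborel)"
    and ae: "AE t in lborel. t \<in> {0..1} \<longrightarrow> (\<forall>s\<in>\<rat> \<inter> {0..1}.
        ennreal \<bar>u t - u s\<bar> \<le> (\<integral>\<^sup>+r\<in>{min s t..max s t}. g r \<partial>lborel))"
  obtains U where "controlled U g" "U 0 = u 0" "U 1 = u 1" "AE t in lborel. t \<in> {0..1} \<longrightarrow> U t = u t"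
proof -
  define D where "D = {t\<in>{0..1}. \<forall>s\<in>\<rat> \<inter> {0..1}.
        ennreal \<bar>u t - u s\<bar> \<le> (\<integral>\<^sup>+r\<in>{min s t..max s t}. g r \<partial>lborel)}"
  have QD: "\<rat> \<inter> {0..1} \<subseteq> D" using rat by (auto simp: D_def)
  define A where "A t = integral {0..t} (\<lambda>r. enn2real (g r))" for t
  have i: "(\<lambda>r. enn2real (g r)) integrable_on {0..1}"
    by (rule nn_integral_interval_eq_HK(1)[OF _ fin]) auto
  have A: "A s + integral {s..t} (\<lambda>r. enn2real (g r)) = A t" if "0 \<le> s" "s \<le> t" "t \<le> 1" for s t
    unfolding A_def using that 
    by (intro Henstock_Kurzweil_Integration.integral_combine integrable_subinterval_real[OF i]) auto
  have Ann: "A s \<le> A t" and Aenn: "(\<integral>\<^sup>+r\<in>{s..t}. g r \<partial>lborel) = ennreal (A t - A s)" if "0 \<le> s" "s \<le> t" "t \<le> 1" for s t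
  proof -
    have I: "integral {s..t} (\<lambda>r. enn2real (g r)) = A t - A s" using A[OF that] by simp
    have "0 \<le> integral {s..t} (\<lambda>r. enn2real (g r))"
      by (intro integral_nonneg integrable_subinterval_real[OF i]) (use that in auto)
    then show "A s \<le> A t" using I by simp
    show "(\<integral>\<^sup>+r\<in>{s..t}. g r \<partial>lborel) = ennreal (A t - A s)"
      using nn_integral_interval_eq_HK(2)[OF _ fin, of s t] that I by simp
  qed
  have Dq: "\<bar>u t - u s\<bar> \<le> \<bar>A t - A s\<bar>" if "t \<in> D" "s \<in> \<rat> \<inter> {0..1}" for s t
  proof -
    have "ennreal \<bar>u t - u s\<bar> \<le> (\<integral>\<^sup>+r\<in>{min s t..max s t}. g r \<partial>lborel)"
      using that by (auto simp: D_def)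
    also have "\<dots> = ennreal (A (max s t) - A (min s t))"
      using that by (intro Aenn) (auto simp: D_def)
    finally have "\<bar>u t - u s\<bar> \<le> A (max s t) - A (min s t)"
      using that Ann[of "min s t" "max s t"] by (auto simp: D_def)
    then show ?thesis by (auto simp: max_def min_def split: if_splits)
  qed
  have Dlt: "\<bar>u t - u s\<bar> \<le> \<bar>A t - A s\<bar>" if "t \<in> D" "s \<in> D" "s < t" for s t
  proof -
    obtain q where q: "q \<in> \<rat>" "s < q" "q < t" using Rats_dense_in_real[OF \<open>s < t\<close>] by auto
    then have "q \<in> \<rat> \<inter> {0..1}" using that by (auto simp: D_def)
    moreover have "A s \<le> A q" "A q \<le> A t" using q that by (auto simp: D_def intro!: Ann)
    ultimately show ?thesis using Dq[OF that(1), of q] Dq[OF that(2), of q] by linarith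
  qed
  have DD: "\<bar>u t - u s\<bar> \<le> \<bar>A t - A s\<bar>" if "t \<in> D" "s \<in> D" for s t
    using Dlt[of s t] Dlt[of t s] that by (cases s t rule: linorder_cases) (auto simp: abs_minus_commute)
  define U where "U t = (INF s\<in>D. u s + \<bar>A t - A s\<bar>)" for t
  have D0: "0 \<in> D" "1 \<in> D" using QD by auto
  have bdd: "bdd_below ((\<lambda>s. u s + \<bar>A t - A s\<bar>) ` D)" for t
  proof (rule bdd_belowI2)
    fix s assume "s \<in> D"
    then show "u 0 - \<bar>A t - A 0\<bar> \<le> u s + \<bar>A t - A s\<bar>" using DD[OF D0(1), of s] by linarith
  qed
  have UD: "U t = u t" if "t \<in> D" for t
  proof (rule antisym)
    show "U t \<le> u t" unfolding U_def using cINF_lower[OF bdd that, of t] by simp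
    show "u t \<le> U t" unfolding U_def using DD[OF that] D0 by (intro cINF_greatest) force+
  qed
  have Ule: "U t \<le> U s + \<bar>A t - A s\<bar>" for s t
  proof -
    have "U t - \<bar>A t - A s\<bar> \<le> U s" unfolding U_def[of s]
    proof (rule cINF_greatest)
      fix q assume q: "q \<in> D"
      have "U t \<le> u q + \<bar>A t - A q\<bar>" unfolding U_def by (rule cINF_lower[OF bdd q])
      then show "U t - \<bar>A t - A s\<bar> \<le> u q + \<bar>A s - A q\<bar>" by linarith
    qed (use D0 in auto)
    then show ?thesis by simp
  qed
  show ?thesis
  proof
    show "controlled U g" unfolding controlled_def
    proof safe
      fix s t :: real assume st: "0 \<le> s" "s \<le> t" "t \<le> 1"
      have "\<bar>U t - U s\<bar> \<le> A t - A s" using Ule[of t s] Ule[of s t] Ann[OF st] by linarith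
      then show "ennreal \<bar>U t - U s\<bar> \<le> (\<integral>\<^sup>+r\<in>{s..t}. g r \<partial>lborel)"
        by (simp add: Aenn[OF st] ennreal_leI)
    qed
    show "U 0 = u 0" "U 1 = u 1" using UD D0 by auto
    show "AE t in lborel. t \<in> {0..1} \<longrightarrow> U t = u t"
      using ae by eventually_elim (auto intro!: UD simp: D_def)
  qed
qed

lemma continuous_AE_eq_on_unit_interval:
  fixes u v :: "real \<Rightarrow> real"
  assumes cu: "continuous_on {0..1} u" and cv: "continuous_on {0..1} v"
    and ae: "AE t in lborel. t \<in> {0..1} \<longrightarrow> u t = v t" and t: "t \<in> {0..1}"
  shows "u t = v t"
proof (rule ccontr)
  assume ne: "u t \<noteq> v t"
  have "continuous_on {0..1} (\<lambda>s. u s - v s)" using cu cv by (intro continuous_intros)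
  then obtain d where d: "d > 0" "\<And>s. s \<in> {0..1} \<Longrightarrow> \<bar>s - t\<bar> < d \<Longrightarrow> \<bar>u s - v s - (u t - v t)\<bar> < \<bar>u t - v t\<bar>"
    using t ne unfolding continuous_on_iff dist_real_def by (metis eq_iff_diff_eq_0 zero_less_abs_iff)
  define a where "a = max 0 (t - d)"
  define b where "b = min 1 (t + d)"
  have ab: "a < b" using t d by (auto simp: a_def b_def)
  have "AE s in lborel. s \<notin> {a<..<b}"
    using ae
  proof eventually_elim
    case (elim s)
    show ?case
    proof
      assume "s \<in> {a<..<b}"
      then have "s \<in> {0..1}" "\<bar>s - t\<bar> < d" by (auto simp: a_def b_def)
      then show False using d(2)[of s] elim by auto
    qed
  qed
  then have "emeasure lborel {a<..<b} = 0" by (subst (asm) AE_iff_measurable[where N = "{a<..<b}"]) auto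
  then show False using ab by simp
qed

section \<open>The Borel space of curves\<close>

lemma mspace_curves: "mspace curves = {\<gamma>. \<gamma> \<in> extensional {0..1} \<and> continuous_on {0..1} (\<gamma> :: real \<Rightarrow> 'a::metric_space)}"
proof -
  have "compactin (top_of_set {0..1::real}) (topspace (top_of_set {0..1}))"
    by (simp add: compactin_subtopology)
  from compactin_mspace_cfunspace[OF this, of "euclidean_metric :: 'a metric"] show ?thesis
    by (auto simp: curves_def)
qed

lemma space_curves_borel: "space curves_borel = mspace curves"
  unfolding curves_borel_def by (rule space_measure_of_conv)

text \<open>Open sets in terms of uniform distances, so that the abstract metric on functions is needed nowhere else.\<close>

lemma openin_curves:
  fixes U :: "(real \<Rightarrow> 'a::metric_space) set"
  shows "openin (mtopology_of curves) U \<longleftrightarrow> U \<subseteq> mspace curves \<and>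
     (\<forall>\<gamma>\<in>U. \<exists>e>0. \<forall>\<gamma>'\<in>mspace curves. (\<forall>t\<in>{0..1}. dist (\<gamma> t) (\<gamma>' t) < e) \<longrightarrow> \<gamma>' \<in> U)"
proof -
  interpret M: Metric_space "mspace curves" "mdist (curves :: (real \<Rightarrow> 'a) metric)"
    by (rule Metric_space_mspace_mdist)
  have *: "openin (mtopology_of curves) U \<longleftrightarrow> U \<subseteq> mspace curves \<and> (\<forall>\<gamma>\<in>U. \<exists>e>0. M.mball \<gamma> e \<subseteq> U)"
    unfolding mtopology_of_def M.openin_mtopology by auto
  have **: "(\<exists>e>0. M.mball \<gamma> e \<subseteq> U) \<longleftrightarrow> (\<exists>e>0. \<forall>\<gamma>'\<in>mspace curves. (\<forall>t\<in>{0..1}. dist (\<gamma> t) (\<gamma>' t) < e) \<longrightarrow> \<gamma>' \<in> U)"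
    if \<gamma>: "\<gamma> \<in> mspace curves" for \<gamma>
  proof
    assume "\<exists>e>0. M.mball \<gamma> e \<subseteq> U"
    then obtain e where e: "e > 0" "M.mball \<gamma> e \<subseteq> U" by blast
    show "\<exists>e>0. \<forall>\<gamma>'\<in>mspace curves. (\<forall>t\<in>{0..1}. dist (\<gamma> t) (\<gamma>' t) < e) \<longrightarrow> \<gamma>' \<in> U"
    proof (intro exI[of _ "e/2"] conjI ballI impI)
      fix \<gamma>' assume g: "\<gamma>' \<in> mspace curves" "\<forall>t\<in>{0..1}. dist (\<gamma> t) (\<gamma>' t) < e / 2"
      have "mdist curves \<gamma> \<gamma>' \<le> e / 2"
        unfolding curves_def using g e by (intro mdist_cfunspace_le) (auto intro: less_imp_le)
      then show "\<gamma>' \<in> U" using e g \<gamma> by auto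
    qed (use e in simp)
  next
    assume "\<exists>e>0. \<forall>\<gamma>'\<in>mspace curves. (\<forall>t\<in>{0..1}. dist (\<gamma> t) (\<gamma>' t) < e) \<longrightarrow> \<gamma>' \<in> U"
    then obtain e where e: "e > 0" "\<And>\<gamma>'. \<gamma>'\<in>mspace curves \<Longrightarrow> (\<forall>t\<in>{0..1}. dist (\<gamma> t) (\<gamma>' t) < e) \<Longrightarrow> \<gamma>' \<in> U" by blast
    have "\<gamma>' \<in> U" if "\<gamma>' \<in> M.mball \<gamma> e" for \<gamma>'
    proof (rule e(2))
      show g: "\<gamma>' \<in> mspace curves" using that by simp
      show "\<forall>t\<in>{0..1}. dist (\<gamma> t) (\<gamma>' t) < e"
      proof
        fix t :: real assume "t \<in> {0..1}"
        have "mdist euclidean_metric (\<gamma> t) (\<gamma>' t) \<le> mdist curves \<gamma> \<gamma>'"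
          using mdist_cfunspace_imp_mdist_le[of \<gamma> "top_of_set {0..1}" euclidean_metric \<gamma>' "mdist curves \<gamma> \<gamma>'" t]
            g \<gamma> \<open>t \<in> {0..1}\<close> by (auto simp: curves_def)
        then show "dist (\<gamma> t) (\<gamma>' t) < e" using that by simp
      qed
    qed
    then show "\<exists>e>0. M.mball \<gamma> e \<subseteq> U" using e(1) by blast
  qed
  show ?thesis
    unfolding * by (intro conj_cong refl ball_cong) (rule **, blast)
qed

lemma open_in_curves_borel: "openin (mtopology_of curves) U \<Longrightarrow> U \<in> sets curves_borel"
  unfolding curves_borel_def
  by (rule in_measure_of[rotated]) (auto dest: openin_curves[THEN iffD1, THEN conjunct1])

lemma measurable_curve_eval:
  assumes "t \<in> {0..1}"
  shows "(\<lambda>\<gamma>. \<gamma> t) \<in> borel_measurable (curves_borel :: (real \<Rightarrow> 'a::metric_space) measure)"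
proof (rule borel_measurableI)
  fix S :: "'a set" assume "open S"
  show "(\<lambda>\<gamma>. \<gamma> t) -` S \<inter> space curves_borel \<in> sets curves_borel"
  proof (rule open_in_curves_borel, unfold openin_curves, safe)
    fix \<gamma> :: "real \<Rightarrow> 'a" assume "\<gamma> t \<in> S"
    then obtain e where e: "e > 0" "ball (\<gamma> t) e \<subseteq> S" using \<open>open S\<close> openE by blast
    show "\<exists>e>0. \<forall>\<gamma>'\<in>mspace curves. (\<forall>t\<in>{0..1}. dist (\<gamma> t) (\<gamma>' t) < e) \<longrightarrow> \<gamma>' \<in> (\<lambda>\<gamma>. \<gamma> t) -` S \<inter> space curves_borel"
      using e assms by (intro exI[of _ e]) (auto simp: space_curves_borel subset_iff)
  qed (auto simp: space_curves_borel)
qed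

text \<open>Each curve is continuous and each evaluation is measurable, so the evaluation is the limit of the
jointly measurable maps that round the time down to a multiple of \<open>1 / (n + 1)\<close>.\<close>

lemma measurable_curve_eval_clamp:
  "(\<lambda>(\<gamma>, t). \<gamma> (unit_clamp t)) \<in> borel_measurable ((curves_borel :: (real \<Rightarrow> 'a::{metric_space,second_countable_topology}) measure) \<Otimes>\<^sub>M borel)"
proof -
  have meas: "(\<lambda>x. fst x (unit_clamp (of_int \<lfloor>real (Suc n) * snd x\<rfloor> / real (Suc n)))) \<in> borel_measurable ((curves_borel :: (real \<Rightarrow> 'a) measure) \<Otimes>\<^sub>M borel)" for n
  proof -
    have A: "(\<lambda>x. fst x (unit_clamp (of_int i / real (Suc n)))) \<in> borel_measurable ((curves_borel :: (real \<Rightarrow> 'a) measure) \<Otimes>\<^sub>M borel)" for i :: int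
      by (rule measurable_compose[OF measurable_fst measurable_curve_eval]) (rule unit_clamp)
    have "(\<lambda>x. \<lfloor>real (Suc n) * snd x\<rfloor>) \<in> (curves_borel :: (real \<Rightarrow> 'a) measure) \<Otimes>\<^sub>M borel \<rightarrow>\<^sub>M count_space UNIV"
      by measurable
    from measurable_compose_countable[OF A this] show ?thesis .
  qed
  have lim: "(\<lambda>n. fst x (unit_clamp (of_int \<lfloor>real (Suc n) * snd x\<rfloor> / real (Suc n)))) \<longlonglongrightarrow> (case x of (\<gamma>, t) \<Rightarrow> \<gamma> (unit_clamp t))"
    if x: "x \<in> space ((curves_borel :: (real \<Rightarrow> 'a) measure) \<Otimes>\<^sub>M borel)" for x
  proof -
  obtain \<gamma> t where [simp]: "x = (\<gamma>, t)" by (cases x)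
  have c: "continuous_on {0..1} \<gamma>" using x by (auto simp: space_pair_measure space_curves_borel mspace_curves)
  have lim: "(\<lambda>n. of_int \<lfloor>real (Suc n) * t\<rfloor> / real (Suc n)) \<longlonglongrightarrow> t"
  proof (rule tendsto_sandwich)
    show "\<forall>\<^sub>F n in sequentially. t - 1 / real (Suc n) \<le> of_int \<lfloor>real (Suc n) * t\<rfloor> / real (Suc n)"
    proof (rule always_eventually, rule allI)
      fix n
      have "real (Suc n) * t - 1 \<le> of_int \<lfloor>real (Suc n) * t\<rfloor>" by linarith
      then have "(real (Suc n) * t - 1) / real (Suc n) \<le> of_int \<lfloor>real (Suc n) * t\<rfloor> / real (Suc n)"
        by (rule divide_right_mono) simp
      then show "t - 1 / real (Suc n) \<le> of_int \<lfloor>real (Suc n) * t\<rfloor> / real (Suc n)"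
        by (simp add: diff_divide_distrib del: of_nat_Suc)
    qed
    show "\<forall>\<^sub>F n in sequentially. of_int \<lfloor>real (Suc n) * t\<rfloor> / real (Suc n) \<le> t"
    proof (rule always_eventually, rule allI)
      fix n
      have "of_int \<lfloor>real (Suc n) * t\<rfloor> \<le> real (Suc n) * t" by linarith
      then have "of_int \<lfloor>real (Suc n) * t\<rfloor> / real (Suc n) \<le> real (Suc n) * t / real (Suc n)"
        by (rule divide_right_mono) simp
      then show "of_int \<lfloor>real (Suc n) * t\<rfloor> / real (Suc n) \<le> t" by (simp del: of_nat_Suc)
    qed
    show "(\<lambda>n. t - 1 / real (Suc n)) \<longlonglongrightarrow> t"
      using LIMSEQ_inverse_real_of_nat tendsto_diff[OF tendsto_const, of "\<lambda>n. inverse (real (Suc n))" 0 sequentially t]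
      by (simp add: inverse_eq_divide)
  qed simp
  have "(\<lambda>n. unit_clamp (of_int \<lfloor>real (Suc n) * t\<rfloor> / real (Suc n))) \<longlonglongrightarrow> unit_clamp t"
    unfolding unit_clamp_def by (intro tendsto_intros lim)
  then have "(\<lambda>n. \<gamma> (unit_clamp (of_int \<lfloor>real (Suc n) * t\<rfloor> / real (Suc n)))) \<longlonglongrightarrow> \<gamma> (unit_clamp t)"
    by (rule continuous_on_tendsto_compose[OF c]) (use unit_clamp(1) in auto)
  then show ?thesis by simp
  qed
  show ?thesis
    by (rule borel_measurable_LIMSEQ_metric[OF meas lim])
qed

lemma metric_speed_outside: "t \<notin> {0..1} \<Longrightarrow> metric_speed \<gamma> t = 0"
proof -
  assume t: "t \<notin> {0..1::real}"
  then have "at t within {0..1} = bot"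
    by (subst at_within_eq_bot_iff) simp
  then show ?thesis by (simp add: metric_speed_def bot_ennreal)
qed

text \<open>For a continuous curve the difference quotient is continuous off the base point, so rational times
suffice for the suprema; this exhibits the speed as a countable combination of evaluations.\<close>

lemma metric_speed_eq_rational:
  fixes \<gamma> :: "real \<Rightarrow> 'a::metric_space"
  assumes c: "continuous_on {0..1} \<gamma>" and t: "t \<in> {0..1}"
  shows "metric_speed \<gamma> t = (INF n. SUP q\<in>\<rat> \<inter> {0..1}.
     if q \<noteq> t \<and> \<bar>q - t\<bar> < inverse (real (Suc n)) then ennreal (dist (\<gamma> q) (\<gamma> t) / \<bar>q - t\<bar>) else 0)"
proof -
  define f where "f z = ennreal (dist (\<gamma> z) (\<gamma> t) / \<bar>z - t\<bar>)" for z
  have S: "(SUP y\<in>({0..1} \<inter> ball t e - {t}). f y) = (SUP q\<in>\<rat> \<inter> {0..1}. if q \<noteq> t \<and> \<bar>q - t\<bar> < e then f q else 0)" (is "?L = ?R")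
    if e: "e > 0" for e
  proof (rule antisym)
    show "?R \<le> ?L"
      by (intro SUP_least) (auto intro!: SUP_upper simp: dist_real_def abs_minus_commute)
    show "?L \<le> ?R"
    proof (rule SUP_least, rule ccontr)
      fix y assume y: "y \<in> {0..1} \<inter> ball t e - {t}" and "\<not> f y \<le> ?R"
      then have lt: "?R < f y" by simp
      have "continuous_on ({0..1} - {t}) f" unfolding f_def
        by (intro continuous_on_ennreal continuous_intros continuous_on_subset[OF c]) auto
      then have "(f \<longlongrightarrow> f y) (at y within {0..1} - {t})"
        using y by (auto simp: continuous_on_def)
      then have "eventually (\<lambda>z. ?R < f z) (at y within {0..1} - {t})"
        by (rule order_tendstoD(1)[OF _ lt])
      then obtain d where d: "d > 0" "\<And>z. z \<in> {0..1} - {t} \<Longrightarrow> z \<noteq> y \<Longrightarrow> dist z y < d \<Longrightarrow> ?R < f z"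
        unfolding eventually_at by auto
      define d' where "d' = min d (min (e - \<bar>t - y\<bar>) \<bar>t - y\<bar>)"
      have d': "d' > 0" using d y by (auto simp: d'_def dist_real_def)
      have "max 0 (y - d') < min 1 (y + d')" using d' y by auto
      then obtain q where q: "q \<in> \<rat>" "max 0 (y - d') < q" "q < min 1 (y + d')"
        using Rats_dense_in_real by blast
      then have q': "q \<in> {0..1} - {t}" "\<bar>q - t\<bar> < e" "dist q y < d"
        by (auto simp: d'_def dist_real_def abs_if split: if_splits)
      have "?R < f q" using d(2)[OF q'(1) _ q'(3)] lt by (cases "q = y") auto
      moreover have "f q \<le> ?R" using q q' by (intro SUP_upper2[of q]) auto
      ultimately show False by simp
    qed
  qed
  have "metric_speed \<gamma> t = (INF e\<in>{0<..}. SUP y\<in>({0..1} \<inter> ball t e - {t}). f y)"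
    unfolding metric_speed_def Limsup_within f_def ..
  also have "\<dots> = (INF n. SUP y\<in>({0..1} \<inter> ball t (inverse (real (Suc n))) - {t}). f y)"
  proof (rule INF_eq)
    fix e :: real assume "e \<in> {0<..}"
    then obtain n where "inverse (real (Suc n)) < e" using reals_Archimedean by auto
    then show "\<exists>n\<in>UNIV. (SUP y\<in>({0..1} \<inter> ball t (inverse (real (Suc n))) - {t}). f y) \<le> (SUP y\<in>({0..1} \<inter> ball t e - {t}). f y)"
      by (intro bexI[of _ n] SUP_subset_mono) auto
  next
    fix n :: nat
    show "\<exists>e\<in>{0<..}. (SUP y\<in>({0..1} \<inter> ball t e - {t}). f y) \<le> (SUP y\<in>({0..1} \<inter> ball t (inverse (real (Suc n))) - {t}). f y)"
      by (intro bexI[of _ "inverse (real (Suc n))"]) auto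
  qed
  also have "\<dots> = (INF n. SUP q\<in>\<rat> \<inter> {0..1}. if q \<noteq> t \<and> \<bar>q - t\<bar> < inverse (real (Suc n)) then f q else 0)"
    by (intro INF_cong refl S) simp
  finally show ?thesis unfolding f_def .
qed

lemma measurable_metric_speed:
  "(\<lambda>(\<gamma>, t). metric_speed \<gamma> t) \<in> borel_measurable ((curves_borel :: (real \<Rightarrow> 'a::{metric_space,second_countable_topology}) measure) \<Otimes>\<^sub>M borel)"
proof -
  let ?M = "(curves_borel :: (real \<Rightarrow> 'a) measure) \<Otimes>\<^sub>M (borel :: real measure)"
  note [measurable] = measurable_curve_eval_clamp[unfolded case_prod_beta', where 'a='a]
  have [measurable]: "(\<lambda>x. fst x q) \<in> borel_measurable ?M" if "q \<in> {0..1}" for q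
    by (rule measurable_compose[OF measurable_fst measurable_curve_eval[OF that]])
  have "(\<lambda>x. if snd x \<in> {0..1} then (INF n. SUP q\<in>\<rat> \<inter> {0..1}.
     if q \<noteq> snd x \<and> \<bar>q - snd x\<bar> < inverse (real (Suc n)) then ennreal (dist (fst x q) (fst x (unit_clamp (snd x))) / \<bar>q - snd x\<bar>) else 0) else 0)
    \<in> borel_measurable ?M" (is "?f \<in> _")
  proof -
    have [measurable]: "(\<lambda>x. SUP q\<in>\<rat> \<inter> {0..1}.
     if q \<noteq> snd x \<and> \<bar>q - snd x\<bar> < inverse (real (Suc n)) then ennreal (dist (fst x q) (fst x (unit_clamp (snd x))) / \<bar>q - snd x\<bar>) else 0)
     \<in> borel_measurable ?M" for n
      by (intro borel_measurable_SUP countable_Int1 countable_rat) measurable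
    show ?thesis by measurable
  qed
  also have "?f \<in> borel_measurable ?M \<longleftrightarrow> ?thesis"
  proof (rule measurable_cong)
    fix x assume x: "x \<in> space ?M"
    then have c: "continuous_on {0..1} (fst x)" by (auto simp: space_pair_measure space_curves_borel mspace_curves)
    show "?f x = (case x of (\<gamma>, t) \<Rightarrow> metric_speed \<gamma> t)"
      using metric_speed_eq_rational[OF c, of "snd x"] metric_speed_outside[of "snd x" "fst x"]
      by (simp add: case_prod_beta unit_clamp)
  qed
  finally show ?thesis .
qed

definition restrict_curve :: "real \<Rightarrow> real \<Rightarrow> (real \<Rightarrow> 'a) \<Rightarrow> real \<Rightarrow> 'a" where
  "restrict_curve s t \<gamma> = restrict (\<lambda>r. \<gamma> (s + (t - s) * r)) {0..1}"

lemma convex_comb_unit: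
  fixes s t r :: real
  assumes "0 \<le> s" "s < t" "t \<le> 1" "r \<in> {0..1}"
  shows "s + (t - s) * r \<in> {s..t}" "s + (t - s) * r \<in> {0..1}"
proof -
  have "(t - s) * r \<le> t - s" using assms by (intro mult_left_le) auto
  moreover have "0 \<le> (t - s) * r" using assms by simp
  ultimately have "s \<le> s + (t - s) * r" "s + (t - s) * r \<le> t" by linarith+
  then show "s + (t - s) * r \<in> {s..t}" "s + (t - s) * r \<in> {0..1}" using assms by auto
qed

lemma restrict_curve_in_mspace:
  assumes "0 \<le> s" "s < t" "t \<le> 1" "\<gamma> \<in> mspace curves"
  shows "restrict_curve s t \<gamma> \<in> mspace (curves :: (real \<Rightarrow> 'a::metric_space) metric)"
proof -
  have "continuous_on {0..1} (\<lambda>r. \<gamma> (s + (t - s) * r))"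
    by (rule continuous_on_compose2[of "{0..1}" \<gamma>])
       (use assms convex_comb_unit(2)[OF assms(1-3)] in \<open>auto simp: mspace_curves intro: continuous_intros\<close>)
  then have "continuous_on {0..1} (restrict_curve s t \<gamma>)"
    by (rule continuous_on_eq) (simp add: restrict_curve_def)
  then show ?thesis
    by (simp add: mspace_curves restrict_curve_def)
qed

lemma measurable_restrict_curve:
  assumes st: "0 \<le> s" "s < t" "t \<le> 1"
  shows "restrict_curve s t \<in> (curves_borel :: (real \<Rightarrow> 'a::metric_space) measure) \<rightarrow>\<^sub>M curves_borel"
  unfolding curves_borel_def
proof (rule measurable_measure_of)
  fix U :: "(real \<Rightarrow> 'a) set" assume "U \<in> {U. openin (mtopology_of curves) U}"
  then have U: "openin (mtopology_of curves) U" by simp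
  have "restrict_curve s t -` U \<inter> mspace curves \<in> sets curves_borel"
  proof (rule open_in_curves_borel, unfold openin_curves, safe)
    fix \<gamma> assume g: "restrict_curve s t \<gamma> \<in> U" "\<gamma> \<in> mspace curves"
    then obtain e where e: "e > 0" "\<And>\<gamma>'. \<gamma>'\<in>mspace curves \<Longrightarrow> (\<And>r. r\<in>{0..1} \<Longrightarrow> dist (restrict_curve s t \<gamma> r) (\<gamma>' r) < e) \<Longrightarrow> \<gamma>' \<in> U"
      using U unfolding openin_curves by meson
    show "\<exists>e>0. \<forall>\<gamma>'\<in>mspace curves. (\<forall>r\<in>{0..1}. dist (\<gamma> r) (\<gamma>' r) < e) \<longrightarrow> \<gamma>' \<in> restrict_curve s t -` U \<inter> mspace curves"
    proof (intro exI[of _ e] conjI ballI impI e(1))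
      fix \<gamma>' assume g': "\<gamma>' \<in> mspace curves" "\<forall>r\<in>{0..1}. dist (\<gamma> r) (\<gamma>' r) < e"
      have "restrict_curve s t \<gamma>' \<in> U"
      proof (rule e(2)[OF restrict_curve_in_mspace[OF st g'(1)]])
        fix r :: real assume "r \<in> {0..1}"
        then show "dist (restrict_curve s t \<gamma> r) (restrict_curve s t \<gamma>' r) < e"
          using g'(2) convex_comb_unit[OF st] by (auto simp: restrict_curve_def)
      qed
      then show "\<gamma>' \<in> restrict_curve s t -` U \<inter> mspace curves" using g' by simp
    qed
  qed
  then show "restrict_curve s t -` U \<inter> space (sigma (mspace curves) {U. openin (mtopology_of curves) U})
    \<in> sets (sigma (mspace curves) {U. openin (mtopology_of curves) U})"
    by (simp add: curves_borel_def space_measure_of_conv)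
qed (use st in \<open>auto simp: openin_curves space_measure_of_conv intro: restrict_curve_in_mspace\<close>)

text \<open>Only an inequality, since at the end points the restricted curve sees one side of the original one.\<close>

lemma metric_speed_restrict_curve:
  assumes st: "0 \<le> s" "s < t" "t \<le> 1" and r: "r \<in> {0..1}"
  shows "metric_speed (restrict_curve s t \<gamma>) r \<le> ennreal (t - s) * metric_speed \<gamma> (s + (t - s) * r)"
proof (rule ennreal_le_epsilon)
  fix e :: real assume fin: "ennreal (t - s) * metric_speed \<gamma> (s + (t - s) * r) < top" and e: "e > 0"
  define \<theta> where "\<theta> y = s + (t - s) * y" for y
  have "metric_speed \<gamma> (\<theta> r) < top" using fin st by (auto simp: ennreal_mult_less_top \<theta>_def)
  then obtain l where l: "metric_speed \<gamma> (\<theta> r) = ennreal l" "l \<ge> 0" by (cases "metric_speed \<gamma> (\<theta> r)") auto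
  define \<eta> where "\<eta> = e / (t - s)"
  have \<eta>: "\<eta> > 0" using e st by (simp add: \<eta>_def)
  have "Limsup (at (\<theta> r) within {0..1}) (\<lambda>z. ennreal (dist (\<gamma> z) (\<gamma> (\<theta> r)) / \<bar>z - \<theta> r\<bar>)) < ennreal (l + \<eta>)"
    using l \<eta> by (simp add: metric_speed_def ennreal_lessI)
  then have "eventually (\<lambda>z. ennreal (dist (\<gamma> z) (\<gamma> (\<theta> r)) / \<bar>z - \<theta> r\<bar>) < ennreal (l + \<eta>)) (at (\<theta> r) within {0..1})"
    by (rule Limsup_lessD)
  then obtain d where d: "d > 0" "\<And>z. z \<in> {0..1} \<Longrightarrow> z \<noteq> \<theta> r \<Longrightarrow> dist z (\<theta> r) < d \<Longrightarrow>
      ennreal (dist (\<gamma> z) (\<gamma> (\<theta> r)) / \<bar>z - \<theta> r\<bar>) < ennreal (l + \<eta>)"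
    unfolding eventually_at by auto
  have "eventually (\<lambda>y. ennreal (dist (restrict_curve s t \<gamma> y) (restrict_curve s t \<gamma> r) / \<bar>y - r\<bar>) \<le> ennreal ((t - s) * (l + \<eta>))) (at r within {0..1})"
    unfolding eventually_at
  proof (intro exI[of _ "d / (t - s)"] conjI ballI impI)
    show "0 < d / (t - s)" using d st by simp
    fix y assume y: "y \<in> {0..1}" "y \<noteq> r \<and> dist y r < d / (t - s)"
    have \<theta>y: "\<theta> y \<in> {0..1}" using convex_comb_unit[OF st y(1)] by (simp add: \<theta>_def)
    have diff: "\<bar>\<theta> y - \<theta> r\<bar> = (t - s) * \<bar>y - r\<bar>"
    proof -
      have "\<theta> y - \<theta> r = (t - s) * (y - r)" by (simp add: \<theta>_def algebra_simps)
      then show ?thesis using st by (simp add: abs_mult)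
    qed
    have ne: "\<theta> y \<noteq> \<theta> r" using y st by (auto simp: \<theta>_def)
    have "dist (\<theta> y) (\<theta> r) < d" using y st diff by (simp add: dist_real_def field_simps)
    from d(2)[OF \<theta>y ne this] have "dist (\<gamma> (\<theta> y)) (\<gamma> (\<theta> r)) / \<bar>\<theta> y - \<theta> r\<bar> < l + \<eta>"
      by (simp add: ennreal_less_iff)
    then have "dist (\<gamma> (\<theta> y)) (\<gamma> (\<theta> r)) / \<bar>y - r\<bar> \<le> (t - s) * (l + \<eta>)"
      using y st unfolding diff by (simp add: field_simps)
    then show "ennreal (dist (restrict_curve s t \<gamma> y) (restrict_curve s t \<gamma> r) / \<bar>y - r\<bar>) \<le> ennreal ((t - s) * (l + \<eta>))"
      using y r by (simp add: restrict_curve_def \<theta>_def ennreal_leI)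
  qed
  then have "metric_speed (restrict_curve s t \<gamma>) r \<le> ennreal ((t - s) * (l + \<eta>))"
    unfolding metric_speed_def by (rule Limsup_bounded)
  also have "(t - s) * (l + \<eta>) = (t - s) * l + e"
    using st by (simp add: \<eta>_def distrib_left)
  also have "ennreal \<dots> = ennreal (t - s) * metric_speed \<gamma> (s + (t - s) * r) + ennreal e"
    using l st e by (simp add: \<theta>_def ennreal_mult)
  finally show "metric_speed (restrict_curve s t \<gamma>) r \<le> ennreal (t - s) * metric_speed \<gamma> (s + (t - s) * r) + ennreal e" .
qed

lemma abs_cont_restrict_curve:
  assumes st: "0 \<le> s" "s < t" "t \<le> 1" and ac: "abs_cont_curve \<gamma>"
  shows "abs_cont_curve (restrict_curve s t \<gamma>)"
proof -
  obtain g where g: "set_integrable lborel {0..1} g"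
    "\<And>a b. 0 \<le> a \<Longrightarrow> a \<le> b \<Longrightarrow> b \<le> 1 \<Longrightarrow> dist (\<gamma> a) (\<gamma> b) \<le> (LINT r:{a..b}|lborel. g r)"
    using ac by (auto simp: abs_cont_curve_def)
  define \<theta> where "\<theta> r = s + (t - s) * r" for r
  have ind: "indicator {a..b} r = (indicator {\<theta> a..\<theta> b} (\<theta> r) :: real)" for a b r
    using st by (auto simp: \<theta>_def indicator_def mult_le_cancel_left_pos)
  have eq: "(LINT r:{a..b}|lborel. (t - s) * g (\<theta> r)) = (LINT r:{\<theta> a..\<theta> b}|lborel. g r)" for a b
  proof -
    have "(LINT r:{\<theta> a..\<theta> b}|lborel. g r) = \<bar>t - s\<bar> *\<^sub>R (LINT r|lborel. indicator {\<theta> a..\<theta> b} (\<theta> r) *\<^sub>R g (\<theta> r))"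
      unfolding set_lebesgue_integral_def \<theta>_def using st by (intro lborel_integral_real_affine) auto
    then show ?thesis
      using st unfolding set_lebesgue_integral_def ind[symmetric] by (simp add: mult.left_commute)
  qed
  have "integrable lborel (\<lambda>r. indicator {s..t} r *\<^sub>R g r)"
    using set_integrable_subset[OF g(1), of "{s..t}"] st by (auto simp: set_integrable_def)
  then have "integrable lborel (\<lambda>r. indicator {s..t} (s + (t - s) * r) *\<^sub>R g (s + (t - s) * r))"
    using st by (subst lborel_integrable_real_affine_iff) auto
  then have "integrable lborel (\<lambda>r. (t - s) * (indicator {s..t} (s + (t - s) * r) *\<^sub>R g (s + (t - s) * r)))"
    by (rule integrable_mult_right)
  moreover have "indicator {s..t} (s + (t - s) * r) = (indicator {0..1} r :: real)" for r
    using ind[of 0 1 r] by (simp add: \<theta>_def)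
  ultimately have int: "set_integrable lborel {0..1} (\<lambda>r. (t - s) * g (\<theta> r))"
    unfolding set_integrable_def by (simp add: \<theta>_def mult.left_commute)
  show ?thesis
    unfolding abs_cont_curve_def
  proof (intro exI[of _ "\<lambda>r. (t - s) * g (\<theta> r)"] conjI allI impI int)
    fix a b :: real assume ab: "0 \<le> a \<and> a \<le> b \<and> b \<le> 1"
    then have "\<theta> a \<in> {0..1}" "\<theta> b \<in> {0..1}" "\<theta> a \<le> \<theta> b"
      using convex_comb_unit[OF st, of a] convex_comb_unit[OF st, of b] st
      by (auto simp: \<theta>_def intro: mult_left_mono)
    then have "dist (\<gamma> (\<theta> a)) (\<gamma> (\<theta> b)) \<le> (LINT r:{\<theta> a..\<theta> b}|lborel. g r)" by (intro g(2)) auto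
    then show "dist (restrict_curve s t \<gamma> a) (restrict_curve s t \<gamma> b) \<le> (LINT r:{a..b}|lborel. (t - s) * g (\<theta> r))"
      using ab unfolding eq by (simp add: restrict_curve_def \<theta>_def)
  qed
qed

section \<open>Test plans and weak upper gradients along curves\<close>

definition weighted_speed :: "('a::metric_space \<Rightarrow> real) \<Rightarrow> (real \<Rightarrow> 'a) \<Rightarrow> real \<Rightarrow> ennreal" where
  "weighted_speed G \<gamma> t = ennreal (G (\<gamma> t)) * metric_speed \<gamma> t"

lemma measurable_weighted_speed:
  fixes G :: "'a::{metric_space,second_countable_topology} \<Rightarrow> real"
  assumes [measurable]: "G \<in> borel_measurable borel" and M: "sets M = sets curves_borel"
  shows "(\<lambda>(\<gamma>, t). weighted_speed G \<gamma> t) \<in> borel_measurable (M \<Otimes>\<^sub>M lborel)"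
proof -
  have eq: "borel_measurable (M \<Otimes>\<^sub>M lborel) = (borel_measurable (curves_borel \<Otimes>\<^sub>M borel) :: ((real \<Rightarrow> 'a) \<times> real \<Rightarrow> ennreal) set)"
    using M by (intro measurable_cong_sets sets_pair_measure_cong) auto
  note [measurable] = measurable_curve_eval_clamp[where 'a='a] measurable_metric_speed[where 'a='a]
  have "(\<lambda>x. ennreal (G ((\<lambda>(\<gamma>, t). \<gamma> (unit_clamp t)) x)) * (\<lambda>(\<gamma>, t). metric_speed \<gamma> t) x) \<in> borel_measurable (curves_borel \<Otimes>\<^sub>M borel)"
    by measurable
  also have "(\<lambda>x. ennreal (G ((\<lambda>(\<gamma>, t). \<gamma> (unit_clamp t)) x)) * (\<lambda>(\<gamma>, t). metric_speed \<gamma> t) x) = (\<lambda>(\<gamma>, t). weighted_speed G \<gamma> t)"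
  proof (rule ext)
    fix x :: "(real \<Rightarrow> 'a) \<times> real"
    obtain \<gamma> t where x: "x = (\<gamma>, t)" by (cases x)
    show "ennreal (G ((\<lambda>(\<gamma>, t). \<gamma> (unit_clamp t)) x)) * (\<lambda>(\<gamma>, t). metric_speed \<gamma> t) x = (\<lambda>(\<gamma>, t). weighted_speed G \<gamma> t) x"
    proof (cases "t \<in> {0..1}")
      case True
      then show ?thesis by (simp only: x prod.case weighted_speed_def unit_clamp(2))
    next
      case False
      show ?thesis by (simp only: x prod.case weighted_speed_def metric_speed_outside[OF False] mult_zero_right)
    qed
  qed
  finally show ?thesis using eq by simp
qed

lemma measurable_metric_speed_lborel:
  fixes M :: "(real \<Rightarrow> 'a::{metric_space,second_countable_topology}) measure"
  assumes M: "sets M = sets curves_borel"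
  shows "(\<lambda>(\<gamma>, t). metric_speed \<gamma> t) \<in> borel_measurable (M \<Otimes>\<^sub>M lborel)"
  using measurable_weighted_speed[of "\<lambda>x. 1" M] M by (simp add: weighted_speed_def)

lemma weighted_speed_borel:
  fixes G :: "'a::{metric_space,second_countable_topology} \<Rightarrow> real"
  assumes "G \<in> borel_measurable borel" and \<gamma>: "\<gamma> \<in> mspace curves"
  shows "weighted_speed G \<gamma> \<in> borel_measurable borel"
proof -
  have "\<gamma> \<in> space curves_borel" using \<gamma> by (simp add: space_curves_borel)
  from measurable_compose_Pair1[OF this measurable_weighted_speed[OF assms(1) refl]]
  show ?thesis by simp
qed

lemma measurable_integral_weighted_speed:
  fixes G :: "'a::{metric_space,second_countable_topology} \<Rightarrow> real"
  assumes "G \<in> borel_measurable borel" "sets M = sets curves_borel"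
  shows "(\<lambda>\<gamma>. \<integral>\<^sup>+r\<in>{s..t}. weighted_speed G \<gamma> r \<partial>lborel) \<in> borel_measurable M"
proof -
  note [measurable] = measurable_weighted_speed[OF assms]
  have [measurable]: "(\<lambda>x. weighted_speed G (fst x) (snd x)) \<in> borel_measurable (M \<Otimes>\<^sub>M lborel)"
    using measurable_weighted_speed[OF assms] by (simp add: case_prod_beta')
  show ?thesis by (intro lborel.borel_measurable_nn_integral) (simp add: case_prod_beta')
qed

lemma test_planD:
  assumes "test_plan m \<pi>"
  shows "sets \<pi> = sets curves_borel" "space \<pi> = mspace curves" "prob_space \<pi>" "AE \<gamma> in \<pi>. abs_cont_curve \<gamma>"
    "(\<integral>\<^sup>+\<gamma>. (\<integral>\<^sup>+t\<in>{0..1}. (metric_speed \<gamma> t)\<^sup>2 \<partial>lborel) \<partial>\<pi>) < \<infinity>"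
  using assms sets_eq_imp_space_eq[of \<pi> curves_borel] by (auto simp: test_plan_def space_curves_borel)

lemma test_plan_nn_integral_eval_le:
  fixes m :: "'a::{complete_space, second_countable_topology} measure"
  assumes "test_plan m \<pi>" and m: "sets m = sets borel"
  obtains C where "C > 0" "\<And>t f. t \<in> {0..1} \<Longrightarrow> f \<in> borel_measurable borel \<Longrightarrow>
    (\<integral>\<^sup>+\<gamma>. f (\<gamma> t) \<partial>\<pi>) \<le> ennreal C * (\<integral>\<^sup>+x. f x \<partial>m)"
proof -
  obtain C where C: "C > 0" "\<And>t A. t\<in>{0..1} \<Longrightarrow> A\<in>sets borel \<Longrightarrow>
        emeasure (distr \<pi> borel (\<lambda>\<gamma>. \<gamma> t)) A \<le> ennreal C * emeasure m A"
    using assms by (auto simp: test_plan_def)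
  show ?thesis
  proof (rule that[OF C(1)])
    fix t :: real and f :: "'a \<Rightarrow> ennreal" assume t: "t \<in> {0..1}" and f[measurable]: "f \<in> borel_measurable borel"
    have [measurable]: "(\<lambda>\<gamma>. \<gamma> t) \<in> borel_measurable \<pi>"
      using measurable_curve_eval[OF t] measurable_cong_sets[OF test_planD(1)[OF assms(1)] refl] by blast
    have "(\<integral>\<^sup>+\<gamma>. f (\<gamma> t) \<partial>\<pi>) = (\<integral>\<^sup>+x. f x \<partial>distr \<pi> borel (\<lambda>\<gamma>. \<gamma> t))"
      by (subst nn_integral_distr) auto
    also have "\<dots> \<le> (\<integral>\<^sup>+x. f x \<partial>scale_measure C m)"
    proof (rule nn_integral_mono_measure)
      show "sets (distr \<pi> borel (\<lambda>\<gamma>. \<gamma> t)) = sets (scale_measure (ennreal C) m)" by (simp add: m)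
      then show "distr \<pi> borel (\<lambda>\<gamma>. \<gamma> t) \<le> scale_measure (ennreal C) m"
        using C(2)[OF t] by (simp add: le_measure le_fun_def m)
    qed
    also have "\<dots> = ennreal C * (\<integral>\<^sup>+x. f x \<partial>m)"
      using f measurable_cong_sets[OF m refl] by (intro nn_integral_scale_measure) blast
    finally show "(\<integral>\<^sup>+\<gamma>. f (\<gamma> t) \<partial>\<pi>) \<le> ennreal C * (\<integral>\<^sup>+x. f x \<partial>m)" .
  qed
qed

lemma ennreal_mult_le_sum_squares: "(a::ennreal) * b \<le> a\<^sup>2 + b\<^sup>2"
proof (cases "a \<le> b")
  case True
  then have "a * b \<le> b\<^sup>2" unfolding power2_eq_square by (rule mult_right_mono) simp
  then show ?thesis by (rule order_trans) simp
next
  case False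
  then have "a * b \<le> a\<^sup>2" unfolding power2_eq_square by (intro mult_left_mono) auto
  then show ?thesis by (rule order_trans) simp
qed

lemma L2_nn_integral_finite:
  "f \<in> L2 m \<Longrightarrow> (\<integral>\<^sup>+x. (ennreal (f x))\<^sup>2 \<partial>m) < \<infinity>"
proof -
  assume f: "f \<in> L2 m"
  have "(\<integral>\<^sup>+x. (ennreal (f x))\<^sup>2 \<partial>m) \<le> (\<integral>\<^sup>+x. ennreal (norm ((f x)\<^sup>2)) \<partial>m)"
  proof (rule nn_integral_mono)
    fix x
    show "(ennreal (f x))\<^sup>2 \<le> ennreal (norm ((f x)\<^sup>2))"
      by (cases "f x \<ge> 0") (auto simp: ennreal_power ennreal_neg)
  qed
  also have "\<dots> < \<infinity>" using f by (simp add: L2_def integrable_iff_bounded)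
  finally show ?thesis .
qed

lemma L2_borel: "f \<in> L2 m \<Longrightarrow> sets m = sets borel \<Longrightarrow> f \<in> borel_measurable borel"
  using measurable_cong_sets[of m borel borel borel] by (auto simp: L2_def)

text \<open>Bound the product \<open>G * |\<gamma>'|\<close> by \<open>G\<^sup>2 + |\<gamma>'|\<^sup>2\<close>. The first term is integrable because the laws of the
plan at all times have uniformly bounded densities, the second because the plan has finite energy.\<close>

lemma test_plan_weighted_speed_finite:
  fixes m :: "'a::{complete_space, second_countable_topology} measure"
  assumes \<pi>: "test_plan m \<pi>" and m: "sets m = sets borel" and G: "G \<in> L2 m"
  shows "(\<integral>\<^sup>+\<gamma>. (\<integral>\<^sup>+t\<in>{0..1}. weighted_speed G \<gamma> t \<partial>lborel) \<partial>\<pi>) < \<infinity>"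
proof -
  interpret P: prob_space \<pi> using test_planD[OF \<pi>] by simp
  interpret pair_sigma_finite \<pi> lborel ..
  have [measurable]: "G \<in> borel_measurable borel" using G m by (rule L2_borel)
  note setsp = test_planD(1)[OF \<pi>]
  have eval: "(\<lambda>x. fst x (unit_clamp (snd x))) \<in> borel_measurable (\<pi> \<Otimes>\<^sub>M lborel)"
    using measurable_curve_eval_clamp[where 'a='a]
      measurable_cong_sets[OF sets_pair_measure_cong[OF setsp sets_lborel] refl]
    unfolding case_prod_beta' by blast
  note [measurable] = eval
  have [measurable]: "(\<lambda>x. metric_speed (fst x) (snd x)) \<in> borel_measurable (\<pi> \<Otimes>\<^sub>M lborel)"
    using measurable_metric_speed_lborel[OF setsp] by (simp add: case_prod_beta')
  obtain C where C: "C > 0" "\<And>t f. t \<in> {0..1} \<Longrightarrow> f \<in> borel_measurable borel \<Longrightarrow>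
    (\<integral>\<^sup>+\<gamma>. f (\<gamma> t) \<partial>\<pi>) \<le> ennreal C * (\<integral>\<^sup>+x. f x \<partial>m)"
    using test_plan_nn_integral_eval_le[OF \<pi> m] by blast
  define A where "A \<gamma> t = (ennreal (G (\<gamma> (unit_clamp t))))\<^sup>2 * indicator {0..1} t" for \<gamma> :: "real \<Rightarrow> 'a" and t
  define B where "B \<gamma> t = (metric_speed \<gamma> t)\<^sup>2 * indicator {0..1} t" for \<gamma> :: "real \<Rightarrow> 'a" and t
  have mA[measurable]: "case_prod A \<in> borel_measurable (\<pi> \<Otimes>\<^sub>M lborel)"
    unfolding A_def case_prod_beta' by measurable
  have mB[measurable]: "case_prod B \<in> borel_measurable (\<pi> \<Otimes>\<^sub>M lborel)"
    unfolding B_def case_prod_beta' by measurable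
  have [measurable]: "A \<gamma> \<in> borel_measurable lborel" "B \<gamma> \<in> borel_measurable lborel" if "\<gamma> \<in> space \<pi>" for \<gamma>
    using measurable_compose_Pair1[OF that mA] measurable_compose_Pair1[OF that mB] by simp_all
  have "(\<integral>\<^sup>+\<gamma>. (\<integral>\<^sup>+t\<in>{0..1}. weighted_speed G \<gamma> t \<partial>lborel) \<partial>\<pi>) \<le> (\<integral>\<^sup>+\<gamma>. (\<integral>\<^sup>+t. A \<gamma> t + B \<gamma> t \<partial>lborel) \<partial>\<pi>)"
  proof (intro nn_integral_mono)
    fix \<gamma> :: "real \<Rightarrow> 'a" and t :: real
    show "weighted_speed G \<gamma> t * indicator {0..1} t \<le> A \<gamma> t + B \<gamma> t"
      by (cases "t \<in> {0..1}") (auto simp: A_def B_def unit_clamp weighted_speed_def intro: ennreal_mult_le_sum_squares)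
  qed
  also have "\<dots> = (\<integral>\<^sup>+\<gamma>. (\<integral>\<^sup>+t. A \<gamma> t \<partial>lborel) + (\<integral>\<^sup>+t. B \<gamma> t \<partial>lborel) \<partial>\<pi>)"
    by (intro nn_integral_cong nn_integral_add) auto
  also have "\<dots> = (\<integral>\<^sup>+\<gamma>. (\<integral>\<^sup>+t. A \<gamma> t \<partial>lborel) \<partial>\<pi>) + (\<integral>\<^sup>+\<gamma>. (\<integral>\<^sup>+t. B \<gamma> t \<partial>lborel) \<partial>\<pi>)"
    by (intro nn_integral_add lborel.borel_measurable_nn_integral) auto
  also have "\<dots> < \<infinity>"
  proof -
    have "(\<integral>\<^sup>+\<gamma>. (\<integral>\<^sup>+t. B \<gamma> t \<partial>lborel) \<partial>\<pi>) < \<infinity>"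
      unfolding B_def by (rule test_planD(5)[OF \<pi>])
    moreover have "(\<integral>\<^sup>+\<gamma>. (\<integral>\<^sup>+t. A \<gamma> t \<partial>lborel) \<partial>\<pi>) < \<infinity>"
    proof -
      have "(\<integral>\<^sup>+\<gamma>. (\<integral>\<^sup>+t. A \<gamma> t \<partial>lborel) \<partial>\<pi>) = (\<integral>\<^sup>+t. (\<integral>\<^sup>+\<gamma>. A \<gamma> t \<partial>\<pi>) \<partial>lborel)"
        using Fubini'[OF mA] by simp
      also have "\<dots> \<le> (\<integral>\<^sup>+t. (ennreal C * (\<integral>\<^sup>+x. (ennreal (G x))\<^sup>2 \<partial>m)) * indicator {0..1::real} t \<partial>lborel)"
      proof (rule nn_integral_mono)
        fix t :: real
        have "(\<integral>\<^sup>+\<gamma>. (ennreal (G (\<gamma> t)))\<^sup>2 \<partial>\<pi>) \<le> ennreal C * (\<integral>\<^sup>+x. (ennreal (G x))\<^sup>2 \<partial>m)" if "t \<in> {0..1}"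
          using C(2)[OF that, of "\<lambda>x. (ennreal (G x))\<^sup>2"] by simp
        then show "(\<integral>\<^sup>+\<gamma>. A \<gamma> t \<partial>\<pi>) \<le> (ennreal C * (\<integral>\<^sup>+x. (ennreal (G x))\<^sup>2 \<partial>m)) * indicator {0..1} t"
          by (cases "t \<in> {0..1}") (auto simp: A_def unit_clamp)
      qed
      also have "\<dots> = ennreal C * (\<integral>\<^sup>+x. (ennreal (G x))\<^sup>2 \<partial>m)"
        by (subst nn_integral_cmult_indicator) auto
      also have "\<dots> < \<infinity>" using L2_nn_integral_finite[OF G] by (simp add: ennreal_mult_less_top)
      finally show ?thesis .
    qed
    ultimately show ?thesis by simp
  qed
  finally show ?thesis .
qed

lemma nn_integral_weighted_speed_restrict_curve_le:
  fixes G :: "'a::{metric_space,second_countable_topology} \<Rightarrow> real"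
  assumes st: "0 \<le> s" "s < t" "t \<le> 1" and \<gamma>: "\<gamma> \<in> mspace curves" and G: "G \<in> borel_measurable borel"
  shows "(\<integral>\<^sup>+r\<in>{0..1}. weighted_speed G (restrict_curve s t \<gamma>) r \<partial>lborel) \<le> (\<integral>\<^sup>+r\<in>{s..t}. weighted_speed G \<gamma> r \<partial>lborel)"
proof -
  note [measurable] = weighted_speed_borel[OF G \<gamma>]
  have "(\<integral>\<^sup>+r\<in>{0..1}. weighted_speed G (restrict_curve s t \<gamma>) r \<partial>lborel)
     \<le> (\<integral>\<^sup>+r. ennreal (t - s) * (weighted_speed G \<gamma> (s + (t - s) * r) * indicator {s..t} (s + (t - s) * r)) \<partial>lborel)"
  proof (rule nn_integral_mono)
    fix r :: real
    show "weighted_speed G (restrict_curve s t \<gamma>) r * indicator {0..1} r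
      \<le> ennreal (t - s) * (weighted_speed G \<gamma> (s + (t - s) * r) * indicator {s..t} (s + (t - s) * r))"
    proof (cases "r \<in> {0..1}")
      case True
      have "ennreal (G (\<gamma> (s + (t - s) * r))) * metric_speed (restrict_curve s t \<gamma>) r
        \<le> ennreal (G (\<gamma> (s + (t - s) * r))) * (ennreal (t - s) * metric_speed \<gamma> (s + (t - s) * r))"
        by (intro mult_left_mono metric_speed_restrict_curve st True) simp
      then show ?thesis
        using True convex_comb_unit(1)[OF st True] by (simp add: weighted_speed_def restrict_curve_def mult.left_commute)
    qed simp
  qed
  also have "\<dots> = ennreal \<bar>t - s\<bar> * (\<integral>\<^sup>+r. weighted_speed G \<gamma> (s + (t - s) * r) * indicator {s..t} (s + (t - s) * r) \<partial>lborel)"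
    using st by (subst nn_integral_cmult) auto
  also have "\<dots> = (\<integral>\<^sup>+r\<in>{s..t}. weighted_speed G \<gamma> r \<partial>lborel)"
    using st by (intro nn_integral_real_affine[symmetric]) auto
  finally show ?thesis .
qed

lemma nn_integral_metric_speed_sq_restrict_curve_le:
  fixes \<gamma> :: "real \<Rightarrow> 'a::{metric_space,second_countable_topology}"
  assumes st: "0 \<le> s" "s < t" "t \<le> 1" and \<gamma>: "\<gamma> \<in> mspace curves"
  shows "(\<integral>\<^sup>+r\<in>{0..1}. (metric_speed (restrict_curve s t \<gamma>) r)\<^sup>2 \<partial>lborel) \<le> (\<integral>\<^sup>+r\<in>{0..1}. (metric_speed \<gamma> r)\<^sup>2 \<partial>lborel)"
proof -
  have [measurable]: "metric_speed \<gamma> \<in> borel_measurable borel"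
    using weighted_speed_borel[of "\<lambda>x. 1", OF _ \<gamma>] by (simp add: weighted_speed_def[abs_def])
  have "(\<integral>\<^sup>+r\<in>{0..1}. (metric_speed (restrict_curve s t \<gamma>) r)\<^sup>2 \<partial>lborel)
     \<le> (\<integral>\<^sup>+r. ennreal (t - s) * ((metric_speed \<gamma> (s + (t - s) * r))\<^sup>2 * indicator {0..1} (s + (t - s) * r)) \<partial>lborel)"
  proof (rule nn_integral_mono)
    fix r :: real
    show "(metric_speed (restrict_curve s t \<gamma>) r)\<^sup>2 * indicator {0..1} r
      \<le> ennreal (t - s) * ((metric_speed \<gamma> (s + (t - s) * r))\<^sup>2 * indicator {0..1} (s + (t - s) * r))"
    proof (cases "r \<in> {0..1}")
      case True
      have "(metric_speed (restrict_curve s t \<gamma>) r)\<^sup>2 \<le> (ennreal (t - s) * metric_speed \<gamma> (s + (t - s) * r))\<^sup>2"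
        by (intro power_mono metric_speed_restrict_curve st True) simp
      also have "\<dots> = ennreal (t - s) * (ennreal (t - s) * (metric_speed \<gamma> (s + (t - s) * r))\<^sup>2)"
        by (simp add: power2_eq_square mult_ac)
      also have "\<dots> \<le> ennreal (t - s) * (1 * (metric_speed \<gamma> (s + (t - s) * r))\<^sup>2)"
        using st by (intro mult_left_mono mult_right_mono) auto
      finally show ?thesis
        using True convex_comb_unit(2)[OF st True] by simp
    qed simp
  qed
  also have "\<dots> = ennreal \<bar>t - s\<bar> * (\<integral>\<^sup>+r. (metric_speed \<gamma> (s + (t - s) * r))\<^sup>2 * indicator {0..1} (s + (t - s) * r) \<partial>lborel)"
    using st by (subst nn_integral_cmult) auto
  also have "\<dots> = (\<integral>\<^sup>+r\<in>{0..1}. (metric_speed \<gamma> r)\<^sup>2 \<partial>lborel)"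
    using st by (intro nn_integral_real_affine[symmetric]) auto
  finally show ?thesis .
qed

lemma nn_integral_metric_speed_finite:
  fixes \<gamma> :: "real \<Rightarrow> 'a::{metric_space,second_countable_topology}"
  assumes \<gamma>: "\<gamma> \<in> mspace curves" and fin: "(\<integral>\<^sup>+r\<in>{0..1}. (metric_speed \<gamma> r)\<^sup>2 \<partial>lborel) < \<infinity>"
  shows "(\<integral>\<^sup>+r\<in>{0..1}. metric_speed \<gamma> r \<partial>lborel) < \<infinity>"
proof -
  have [measurable]: "metric_speed \<gamma> \<in> borel_measurable borel"
    using weighted_speed_borel[of "\<lambda>x. 1", OF _ \<gamma>] by (simp add: weighted_speed_def[abs_def])
  have "(\<integral>\<^sup>+r\<in>{0..1}. metric_speed \<gamma> r \<partial>lborel) \<le> (\<integral>\<^sup>+r. indicator {0..1} r + (metric_speed \<gamma> r)\<^sup>2 * indicator {0..1} r \<partial>lborel)"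
    by (intro nn_integral_mono) (use ennreal_mult_le_sum_squares[of 1] in \<open>auto split: split_indicator\<close>)
  also have "\<dots> = (\<integral>\<^sup>+r. indicator {0..1::real} r \<partial>lborel) + (\<integral>\<^sup>+r\<in>{0..1}. (metric_speed \<gamma> r)\<^sup>2 \<partial>lborel)"
    by (rule nn_integral_add) auto
  also have "\<dots> < \<infinity>" using fin by simp
  finally show ?thesis .
qed

text \<open>The distance to a fixed point of the curve is controlled by the dominating function from the
definition of absolute continuity, and its slope is at most the speed.\<close>

lemma abs_cont_curve_dist_le_speed:
  fixes \<gamma> :: "real \<Rightarrow> 'a::{metric_space,second_countable_topology}"
  assumes \<gamma>: "\<gamma> \<in> mspace curves" and ac: "abs_cont_curve \<gamma>"
    and fin: "(\<integral>\<^sup>+r\<in>{0..1}. metric_speed \<gamma> r \<partial>lborel) < \<infinity>"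
    and st: "0 \<le> s" "s \<le> t" "t \<le> 1"
  shows "ennreal (dist (\<gamma> s) (\<gamma> t)) \<le> (\<integral>\<^sup>+r\<in>{s..t}. metric_speed \<gamma> r \<partial>lborel)"
proof -
  have [measurable]: "metric_speed \<gamma> \<in> borel_measurable borel"
    using weighted_speed_borel[of "\<lambda>x. 1", OF _ \<gamma>] by (simp add: weighted_speed_def[abs_def])
  obtain g where g: "set_integrable lborel {0..1} g"
    "\<And>a b. 0 \<le> a \<Longrightarrow> a \<le> b \<Longrightarrow> b \<le> 1 \<Longrightarrow> dist (\<gamma> a) (\<gamma> b) \<le> (LINT r:{a..b}|lborel. g r)"
    using ac by (auto simp: abs_cont_curve_def)
  define k where "k r = norm (indicator {0..1} r *\<^sub>R g r)" for r
  have int: "integrable lborel (\<lambda>r. indicator {0..1} r *\<^sub>R g r)" using g(1) by (simp add: set_integrable_def)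
  then have [measurable]: "k \<in> borel_measurable borel" unfolding k_def by simp
  define u where "u r = dist (\<gamma> s) (\<gamma> r)" for r
  have "controlled u (\<lambda>r. ennreal (k r))"
    unfolding controlled_def
  proof safe
    fix a b :: real assume ab: "0 \<le> a" "a \<le> b" "b \<le> 1"
    have "\<bar>u b - u a\<bar> \<le> dist (\<gamma> a) (\<gamma> b)"
      unfolding u_def by (metis abs_dist_diff_le dist_commute)
    also have "\<dots> \<le> (LINT r:{a..b}|lborel. g r)" by (rule g(2)[OF ab])
    also have "\<dots> \<le> norm (LINT r:{a..b}|lborel. g r)" by simp
    finally have "ennreal \<bar>u b - u a\<bar> \<le> ennreal (norm (LINT r:{a..b}|lborel. g r))" by (rule ennreal_leI)
    also have "\<dots> \<le> (\<integral>\<^sup>+r. ennreal (norm (indicator {a..b} r *\<^sub>R g r)) \<partial>lborel)"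
      unfolding set_lebesgue_integral_def by (rule integral_norm_bound_ennreal)
       (use set_integrable_subset[OF g(1), of "{a..b}"] ab in \<open>auto simp: set_integrable_def\<close>)
    also have "\<dots> = (\<integral>\<^sup>+r\<in>{a..b}. ennreal (k r) \<partial>lborel)"
      using ab by (intro nn_integral_cong) (auto simp: k_def split: split_indicator)
    finally show "ennreal \<bar>u b - u a\<bar> \<le> (\<integral>\<^sup>+r\<in>{a..b}. ennreal (k r) \<partial>lborel)" .
  qed
  then have "controlled u (metric_speed \<gamma>)"
  proof (rule controlled_by_slope)
    have "(\<integral>\<^sup>+r\<in>{0..1}. ennreal (k r) \<partial>lborel) \<le> (\<integral>\<^sup>+r. ennreal (norm (indicator {0..1} r *\<^sub>R g r)) \<partial>lborel)"
      unfolding k_def by (intro nn_integral_mono) (auto split: split_indicator)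
    also have "\<dots> < \<infinity>" using int by (simp add: integrable_iff_bounded)
    finally show "(\<integral>\<^sup>+r\<in>{0..1}. ennreal (k r) \<partial>lborel) < \<infinity>" .
    show "AE r in lborel. r \<in> {0..1} \<longrightarrow> Limsup (at r within {0..1}) (\<lambda>s. ennreal (\<bar>u s - u r\<bar> / \<bar>s - r\<bar>)) \<le> metric_speed \<gamma> r"
    proof (intro AE_I2 impI)
      fix r :: real
      have "\<bar>u q - u r\<bar> \<le> dist (\<gamma> q) (\<gamma> r)" for q
        unfolding u_def by (metis abs_dist_diff_le dist_commute)
      then show "Limsup (at r within {0..1}) (\<lambda>s. ennreal (\<bar>u s - u r\<bar> / \<bar>s - r\<bar>)) \<le> metric_speed \<gamma> r"
        unfolding metric_speed_def by (intro Limsup_mono always_eventually allI ennreal_leI divide_right_mono) auto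
    qed
  qed (use fin in auto)
  from controlledD[OF this st] show ?thesis by (simp add: u_def)
qed

text \<open>The converse, with countably many conditions. They define a Borel set of curves, so that an almost sure
statement about them passes to image measures.\<close>

lemma abs_cont_curve_of_rational_times:
  fixes \<gamma> :: "real \<Rightarrow> 'a::{metric_space,second_countable_topology}"
  assumes \<gamma>: "\<gamma> \<in> mspace curves"
    and fin: "(\<integral>\<^sup>+r\<in>{0..1}. metric_speed \<gamma> r \<partial>lborel) < \<infinity>"
    and rat: "\<forall>s\<in>\<rat>\<inter>{0..1}. \<forall>t\<in>\<rat>\<inter>{0..1}. s \<le> t \<longrightarrow> ennreal (dist (\<gamma> s) (\<gamma> t)) \<le> (\<integral>\<^sup>+r\<in>{s..t}. metric_speed \<gamma> r \<partial>lborel)"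
  shows "abs_cont_curve \<gamma>"
proof -
  have cont: "continuous_on {0..1} \<gamma>" using \<gamma> by (simp add: mspace_curves)
  have [measurable]: "metric_speed \<gamma> \<in> borel_measurable borel"
    using weighted_speed_borel[of "\<lambda>x. 1", OF _ \<gamma>] by (simp add: weighted_speed_def[abs_def])
  have all: "ennreal (dist (\<gamma> s) (\<gamma> t)) \<le> (\<integral>\<^sup>+r\<in>{s..t}. metric_speed \<gamma> r \<partial>lborel)" (is "_ \<le> ?I s t")
    if st: "0 \<le> s" "s < t" "t \<le> 1" for s t
  proof -
    define d where "d n = (t - s) / (real n + 2)" for n
    have d: "d n > 0" "2 * d n \<le> t - s" for n using st mult_right_mono[of s t "real n"] by (auto simp: d_def field_simps)
    have d0: "d \<longlonglongrightarrow> 0" unfolding d_def by real_asymp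
    have "\<exists>q. q \<in> \<rat> \<and> s < q \<and> q < s + d n" for n
      using Rats_dense_in_real[of s "s + d n"] d(1)[of n] by auto
    then obtain q where q: "\<And>n. q n \<in> \<rat>" "\<And>n. s < q n" "\<And>n. q n < s + d n" by metis
    have "\<exists>p. p \<in> \<rat> \<and> t - d n < p \<and> p < t" for n
      using Rats_dense_in_real[of "t - d n" t] d(1)[of n] by auto
    then obtain p where p: "\<And>n. p n \<in> \<rat>" "\<And>n. t - d n < p n" "\<And>n. p n < t" by metis
    have ord: "q n \<le> p n" "q n \<in> {0..1}" "p n \<in> {0..1}" for n
      using q(2,3)[of n] p(2,3)[of n] d[of n] st by auto
    have "q \<longlonglongrightarrow> s"
      by (rule tendsto_sandwich[of "\<lambda>n. s" _ _ "\<lambda>n. s + d n"])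
         (use q tendsto_add[OF tendsto_const d0, of s] in \<open>auto intro!: always_eventually less_imp_le\<close>)
    then have 1: "(\<lambda>n. \<gamma> (q n)) \<longlonglongrightarrow> \<gamma> s"
      by (rule continuous_on_tendsto_compose[OF cont]) (use ord st in auto)
    have "p \<longlonglongrightarrow> t"
      by (rule tendsto_sandwich[of "\<lambda>n. t - d n" _ _ "\<lambda>n. t"])
         (use p tendsto_diff[OF tendsto_const d0, of t] in \<open>auto intro!: always_eventually less_imp_le\<close>)
    then have 2: "(\<lambda>n. \<gamma> (p n)) \<longlonglongrightarrow> \<gamma> t"
      by (rule continuous_on_tendsto_compose[OF cont]) (use ord st in auto)
    have "(\<lambda>n. ennreal (dist (\<gamma> (q n)) (\<gamma> (p n)))) \<longlonglongrightarrow> ennreal (dist (\<gamma> s) (\<gamma> t))"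
      by (intro tendsto_ennrealI tendsto_dist 1 2)
    then show ?thesis
    proof (rule LIMSEQ_le_const2, intro exI[of _ 0] allI impI)
      fix n
      have "ennreal (dist (\<gamma> (q n)) (\<gamma> (p n))) \<le> ?I (q n) (p n)"
        using rat q(1) p(1) ord by blast
      also have "\<dots> \<le> ?I s t"
        using q(2)[of n] p(3)[of n] by (intro nn_integral_mono) (auto split: split_indicator)
      finally show "ennreal (dist (\<gamma> (q n)) (\<gamma> (p n))) \<le> ?I s t" .
    qed
  qed
  define g where "g r = enn2real (metric_speed \<gamma> r)" for r
  have [measurable]: "g \<in> borel_measurable borel" unfolding g_def by simp
  have "AE r in lborel. metric_speed \<gamma> r * indicator {0..1} r \<noteq> \<infinity>"
    using fin by (intro nn_integral_PInf_AE) auto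
  then have ae: "AE r in lborel. r \<in> {0..1} \<longrightarrow> ennreal (g r) = metric_speed \<gamma> r"
    by eventually_elim (auto simp: g_def less_top split: split_indicator_asm)
  have eqI: "(\<integral>\<^sup>+r. ennreal (norm (indicator {s..t} r *\<^sub>R g r)) \<partial>lborel) = (\<integral>\<^sup>+r\<in>{s..t}. metric_speed \<gamma> r \<partial>lborel)"
    if "0 \<le> s" "t \<le> 1" for s t
  proof (rule nn_integral_cong_AE)
    show "AE r in lborel. ennreal (norm (indicator {s..t} r *\<^sub>R g r)) = metric_speed \<gamma> r * indicator {s..t} r"
      using ae by eventually_elim (use that in \<open>auto simp: g_def split: split_indicator\<close>)
  qed
  have int: "set_integrable lborel {s..t} g" if "0 \<le> s" "t \<le> 1" for s t
  proof -
    have "(\<integral>\<^sup>+r\<in>{s..t}. metric_speed \<gamma> r \<partial>lborel) \<le> (\<integral>\<^sup>+r\<in>{0..1}. metric_speed \<gamma> r \<partial>lborel)"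
      using that by (intro nn_integral_mono) (auto split: split_indicator)
    then show ?thesis
      using fin eqI[OF that] by (auto simp: set_integrable_def integrable_iff_bounded intro: le_less_trans)
  qed
  show ?thesis unfolding abs_cont_curve_def
  proof (intro exI[of _ g] conjI allI impI int)
    fix s t :: real assume st: "0 \<le> s \<and> s \<le> t \<and> t \<le> 1"
    have nn: "0 \<le> (LINT r:{s..t}|lborel. g r)"
      unfolding set_lebesgue_integral_def by (intro integral_nonneg_AE) (auto simp: g_def)
    have eq: "ennreal (LINT r:{s..t}|lborel. g r) = (\<integral>\<^sup>+r\<in>{s..t}. metric_speed \<gamma> r \<partial>lborel)"
      unfolding set_lebesgue_integral_def using int[of s t] st eqI[of s t, symmetric]
      by (subst nn_integral_eq_integral[symmetric]) (auto simp: set_integrable_def g_def)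
    show "dist (\<gamma> s) (\<gamma> t) \<le> (LINT r:{s..t}|lborel. g r)"
    proof (cases "s = t")
      case False
      then have "ennreal (dist (\<gamma> s) (\<gamma> t)) \<le> ennreal (LINT r:{s..t}|lborel. g r)"
        using all[of s t] st unfolding eq by auto
      then show ?thesis using nn by simp
    qed (use nn in simp)
  qed auto
qed

text \<open>Conditioning a test plan on a set of positive probability multiplies the compression constant and
the kinetic energy by at most a constant, and so does restricting time to a subinterval.\<close>

lemma test_plan_restrict:
  fixes m :: "'a::{complete_space, second_countable_topology} measure"
  assumes \<pi>: "test_plan m \<pi>" and st: "0 \<le> s" "s < t" "t \<le> 1"
    and B: "B \<in> sets \<pi>" "emeasure \<pi> B \<noteq> 0"
  shows "test_plan m (distr (uniform_measure \<pi> B) curves_borel (restrict_curve s t))" (is "test_plan m ?\<pi>")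
proof -
  interpret P: prob_space \<pi> using test_planD[OF \<pi>] by simp
  note setsp = test_planD(1)[OF \<pi>]
  have Bfin: "emeasure \<pi> B < \<infinity>" by (metis P.emeasure_finite infinity_ennreal_def top.not_eq_extremum)
  let ?U = "uniform_measure \<pi> B"
  interpret U: prob_space ?U using B Bfin by (intro prob_space_uniform_measure) auto
  have setsU: "sets ?U = sets curves_borel" using setsp by simp
  have rU[measurable]: "restrict_curve s t \<in> ?U \<rightarrow>\<^sub>M curves_borel"
    using measurable_restrict_curve[OF st] measurable_cong_sets[OF setsU refl] by blast
  have r\<pi>[measurable]: "restrict_curve s t \<in> \<pi> \<rightarrow>\<^sub>M curves_borel"
    using measurable_restrict_curve[OF st] measurable_cong_sets[OF setsp refl] by blast
    define b where "b = measure \<pi> B"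
    have b: "emeasure \<pi> B = ennreal b" "b > 0"
      using B by (auto simp: b_def P.emeasure_eq_measure zero_less_measure_iff)
  have div_fin: "a / emeasure \<pi> B < \<infinity>" if "a < \<infinity>" for a
    using that b by (simp add: divide_ennreal_def inverse_ennreal ennreal_mult_less_top)
  have ms: "(\<lambda>\<gamma>. \<integral>\<^sup>+t\<in>{0..1}. (metric_speed \<gamma> t)\<^sup>2 \<partial>lborel) \<in> borel_measurable M"
    if "sets M = sets (curves_borel :: (real \<Rightarrow> 'a) measure)" for M
  proof -
    have [measurable]: "(\<lambda>x. metric_speed (fst x) (snd x)) \<in> borel_measurable (M \<Otimes>\<^sub>M lborel)"
      using measurable_metric_speed_lborel[OF that] by (simp add: case_prod_beta')
    show ?thesis by (intro lborel.borel_measurable_nn_integral) (simp add: case_prod_beta')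
  qed
  show ?thesis unfolding test_plan_def
  proof (intro conjI)
    show "sets ?\<pi> = sets curves_borel" by simp
    show "prob_space ?\<pi>" by (rule U.prob_space_distr) measurable
    \<comment> \<open>absolute continuity is not known to be a Borel property; this one is, and implies it\<close>
    define Q where "Q \<gamma> \<longleftrightarrow> (\<integral>\<^sup>+r\<in>{0..1}. metric_speed \<gamma> r \<partial>lborel) < \<infinity> \<and> (\<forall>s\<in>\<rat>\<inter>{0..1}. \<forall>t\<in>\<rat>\<inter>{0..1}.
      s \<le> t \<longrightarrow> ennreal (dist (\<gamma> s) (\<gamma> t)) \<le> (\<integral>\<^sup>+r\<in>{s..t}. metric_speed \<gamma> r \<partial>lborel))" for \<gamma> :: "real \<Rightarrow> 'a"
    have Qmeas: "{\<gamma> \<in> space curves_borel. Q \<gamma>} \<in> sets curves_borel"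
    proof -
      have intm: "(\<lambda>\<gamma>. \<integral>\<^sup>+r\<in>{s..t}. metric_speed \<gamma> r \<partial>lborel) \<in> borel_measurable (curves_borel :: (real \<Rightarrow> 'a) measure)" for s t
        using measurable_integral_weighted_speed[of "\<lambda>x::'a. 1" curves_borel s t] by (simp add: weighted_speed_def)
      have each: "Measurable.pred curves_borel (\<lambda>\<gamma> :: real \<Rightarrow> 'a. s \<le> t \<longrightarrow> ennreal (dist (\<gamma> s) (\<gamma> t)) \<le> (\<integral>\<^sup>+r\<in>{s..t}. metric_speed \<gamma> r \<partial>lborel))"
        if "s \<in> \<rat>\<inter>{0..1}" "t \<in> \<rat>\<inter>{0..1}" for s t
      proof -
        have [measurable]: "(\<lambda>\<gamma>. \<gamma> s) \<in> borel_measurable (curves_borel :: (real \<Rightarrow> 'a) measure)" "(\<lambda>\<gamma>. \<gamma> t) \<in> borel_measurable (curves_borel :: (real \<Rightarrow> 'a) measure)"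
          using that by (auto intro!: measurable_curve_eval)
        then have 1: "(\<lambda>\<gamma>. ennreal (dist (\<gamma> s) (\<gamma> t))) \<in> borel_measurable (curves_borel :: (real \<Rightarrow> 'a) measure)"
          by (intro measurable_compose[OF borel_measurable_dist measurable_ennreal])
        show ?thesis
        proof (cases "s \<le> t")
          case True
          show ?thesis
            using borel_measurable_le[OF 1 intm[of s t]] True by (simp add: pred_def)
        qed simp
      qed
      have [measurable]: "Measurable.pred curves_borel (\<lambda>\<gamma> :: real \<Rightarrow> 'a. \<forall>s\<in>\<rat>\<inter>{0..1}. \<forall>t\<in>\<rat>\<inter>{0..1}.
          s \<le> t \<longrightarrow> ennreal (dist (\<gamma> s) (\<gamma> t)) \<le> (\<integral>\<^sup>+r\<in>{s..t}. metric_speed \<gamma> r \<partial>lborel))"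
        by (intro measurable_pred_countable each countable_Int1 countable_rat)
      have "Measurable.pred curves_borel Q"
        unfolding Q_def using intm[of 0 1] by measurable
      then show ?thesis by (simp add: pred_def)
    qed
    have "AE \<gamma> in \<pi>. Q (restrict_curve s t \<gamma>)"
    proof -
      have "AE \<gamma> in \<pi>. (\<integral>\<^sup>+t\<in>{0..1}. (metric_speed \<gamma> t)\<^sup>2 \<partial>lborel) \<noteq> \<infinity>"
        using test_planD(5)[OF \<pi>] ms[OF setsp] by (intro nn_integral_PInf_AE) auto
      with test_planD(4)[OF \<pi>] AE_space show ?thesis
      proof eventually_elim
        case (elim \<gamma>)
        have \<gamma>: "\<gamma> \<in> mspace curves" using elim test_planD(2)[OF \<pi>] by simp
        have r: "restrict_curve s t \<gamma> \<in> mspace curves" using \<gamma> by (rule restrict_curve_in_mspace[OF st])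
        have "(\<integral>\<^sup>+r\<in>{0..1}. (metric_speed (restrict_curve s t \<gamma>) r)\<^sup>2 \<partial>lborel) < \<infinity>"
          using nn_integral_metric_speed_sq_restrict_curve_le[OF st \<gamma>] elim by (auto simp: less_top intro: le_less_trans)
        from nn_integral_metric_speed_finite[OF r this]
        show ?case unfolding Q_def
          using abs_cont_curve_dist_le_speed[OF r abs_cont_restrict_curve[OF st elim(1)]] by auto
      qed
    qed
    then have "AE \<gamma> in ?U. Q (restrict_curve s t \<gamma>)"
      using B by (intro AE_uniform_measureI) auto
    then have "AE \<gamma> in ?\<pi>. Q \<gamma>" using AE_distr_iff[OF rU Qmeas] by simp
    with AE_space show "AE \<gamma> in ?\<pi>. abs_cont_curve \<gamma>"
      by eventually_elim (auto simp: Q_def space_curves_borel intro: abs_cont_curve_of_rational_times)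
    show "(\<integral>\<^sup>+\<gamma>. (\<integral>\<^sup>+t\<in>{0..1}. (metric_speed \<gamma> t)\<^sup>2 \<partial>lborel) \<partial>?\<pi>) < \<infinity>"
    proof -
      have "(\<integral>\<^sup>+\<gamma>. (\<integral>\<^sup>+t\<in>{0..1}. (metric_speed \<gamma> t)\<^sup>2 \<partial>lborel) \<partial>?\<pi>)
        = (\<integral>\<^sup>+\<gamma>. (\<integral>\<^sup>+r\<in>{0..1}. (metric_speed (restrict_curve s t \<gamma>) r)\<^sup>2 \<partial>lborel) \<partial>?U)"
        by (rule nn_integral_distr[OF rU]) (rule ms, simp)
      also have "\<dots> \<le> (\<integral>\<^sup>+\<gamma>. (\<integral>\<^sup>+t\<in>{0..1}. (metric_speed \<gamma> t)\<^sup>2 \<partial>lborel) \<partial>?U)"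
        using test_planD(2)[OF \<pi>] by (intro nn_integral_mono nn_integral_metric_speed_sq_restrict_curve_le st) simp
      also have "\<dots> = (\<integral>\<^sup>+\<gamma>. (\<integral>\<^sup>+t\<in>{0..1}. (metric_speed \<gamma> t)\<^sup>2 \<partial>lborel) * indicator B \<gamma> \<partial>\<pi>) / emeasure \<pi> B"
        using B ms[OF setsp] by (intro nn_integral_uniform_measure) auto
      also have "\<dots> < \<infinity>"
      proof (rule div_fin)
        have "(\<integral>\<^sup>+\<gamma>. (\<integral>\<^sup>+t\<in>{0..1}. (metric_speed \<gamma> t)\<^sup>2 \<partial>lborel) * indicator B \<gamma> \<partial>\<pi>) \<le> (\<integral>\<^sup>+\<gamma>. (\<integral>\<^sup>+t\<in>{0..1}. (metric_speed \<gamma> t)\<^sup>2 \<partial>lborel) \<partial>\<pi>)"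
          by (intro nn_integral_mono) (auto split: split_indicator)
        also note test_planD(5)[OF \<pi>]
        finally show "(\<integral>\<^sup>+\<gamma>. (\<integral>\<^sup>+t\<in>{0..1}. (metric_speed \<gamma> t)\<^sup>2 \<partial>lborel) * indicator B \<gamma> \<partial>\<pi>) < \<infinity>" .
      qed
      finally show ?thesis .
    qed
    obtain C where C: "C > 0" "\<And>t A. t\<in>{0..1} \<Longrightarrow> A\<in>sets borel \<Longrightarrow>
        emeasure (distr \<pi> borel (\<lambda>\<gamma>. \<gamma> t)) A \<le> ennreal C * emeasure m A"
      using \<pi> by (auto simp: test_plan_def)
    show "\<exists>C>0. \<forall>r\<in>{0..1}. \<forall>A\<in>sets borel. emeasure (distr ?\<pi> borel (\<lambda>\<gamma>. \<gamma> r)) A \<le> ennreal C * emeasure m A"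
    proof (intro exI[of _ "C / b"] conjI ballI)
      show "0 < C / b" using C b by simp
      fix r :: real and A :: "'a set" assume r: "r \<in> {0..1}" and A[measurable]: "A \<in> sets borel"
      let ?r = "s + (t - s) * r"
      have r': "?r \<in> {0..1}" using convex_comb_unit(2)[OF st r] .
      have e\<pi>[measurable]: "(\<lambda>\<gamma>. \<gamma> ?r) \<in> borel_measurable \<pi>"
        using measurable_curve_eval[OF r'] measurable_cong_sets[OF setsp refl] by blast
      have e\<pi>'[measurable]: "(\<lambda>\<gamma>. \<gamma> ?r) \<in> borel_measurable ?U"
        using measurable_curve_eval[OF r'] measurable_cong_sets[OF setsU refl] by blast
      note [measurable] = measurable_curve_eval[OF r, where 'a='a]
      have "distr ?\<pi> borel (\<lambda>\<gamma>. \<gamma> r) = distr ?U borel (\<lambda>\<gamma>. \<gamma> ?r)"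
        using r by (subst distr_distr) (auto simp: o_def restrict_curve_def)
      then have "emeasure (distr ?\<pi> borel (\<lambda>\<gamma>. \<gamma> r)) A = emeasure ?U ((\<lambda>\<gamma>. \<gamma> ?r) -` A \<inter> space ?U)"
        by (simp add: emeasure_distr)
      also have "\<dots> = emeasure \<pi> (B \<inter> ((\<lambda>\<gamma>. \<gamma> ?r) -` A \<inter> space \<pi>)) / emeasure \<pi> B"
        using B by (subst emeasure_uniform_measure) auto
      also have "\<dots> \<le> emeasure \<pi> ((\<lambda>\<gamma>. \<gamma> ?r) -` A \<inter> space \<pi>) / emeasure \<pi> B"
        by (intro divide_right_mono_ennreal emeasure_mono) auto
      also have "\<dots> = emeasure (distr \<pi> borel (\<lambda>\<gamma>. \<gamma> ?r)) A / emeasure \<pi> B"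
        by (simp add: emeasure_distr)
      also have "\<dots> \<le> (ennreal C * emeasure m A) / emeasure \<pi> B"
        by (intro divide_right_mono_ennreal C(2) r' A)
      also have "\<dots> = ennreal (C / b) * emeasure m A"
        using b C by (simp add: divide_ennreal_def divide_inverse ennreal_mult inverse_ennreal mult_ac)
      finally show "emeasure (distr ?\<pi> borel (\<lambda>\<gamma>. \<gamma> r)) A \<le> ennreal (C / b) * emeasure m A" .
    qed
  qed
qed

text \<open>If the bound failed on a set \<open>B\<close> of curves of positive probability, the test plan obtained from \<open>B\<close> and
the time interval \<open>[s,t]\<close> would contradict the integrated inequality.\<close>

lemma weak_upper_gradient_between_times:
  fixes m :: "'a::{complete_space, second_countable_topology} measure"
  assumes m: "sets m = sets borel" and f[measurable]: "f \<in> borel_measurable borel"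
    and wug: "weak_upper_gradient m f G"
    and \<pi>: "test_plan m \<pi>" and st: "0 \<le> s" "s < t" "t \<le> 1"
  shows "AE \<gamma> in \<pi>. ennreal \<bar>f (\<gamma> t) - f (\<gamma> s)\<bar> \<le> (\<integral>\<^sup>+r\<in>{s..t}. weighted_speed G \<gamma> r \<partial>lborel)"
proof -
  interpret P: prob_space \<pi> using test_planD[OF \<pi>] by simp
  note setsp = test_planD(1)[OF \<pi>] and spacep = test_planD(2)[OF \<pi>]
  have G2: "G \<in> L2 m" using wug by (simp add: weak_upper_gradient_def)
  then have G[measurable]: "G \<in> borel_measurable borel" using m by (rule L2_borel)
  have ev: "(\<lambda>\<gamma>. \<gamma> r) \<in> borel_measurable \<pi>" if "r \<in> {0..1}" for r
    using measurable_curve_eval[OF that] measurable_cong_sets[OF setsp refl] by blast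
  have [measurable]: "(\<lambda>\<gamma>. \<gamma> s) \<in> borel_measurable \<pi>" "(\<lambda>\<gamma>. \<gamma> t) \<in> borel_measurable \<pi>"
    using st by (auto intro!: ev)
  note [measurable] = measurable_integral_weighted_speed[OF G setsp, of s t]
  have [measurable]: "(\<lambda>\<gamma>. ennreal \<bar>f (\<gamma> t) - f (\<gamma> s)\<bar>) \<in> borel_measurable \<pi>"
    using st by measurable
  define L where "L \<gamma> = ennreal \<bar>f (\<gamma> t) - f (\<gamma> s)\<bar>" for \<gamma>
  define R where "R \<gamma> = (\<integral>\<^sup>+r\<in>{s..t}. weighted_speed G \<gamma> r \<partial>lborel)" for \<gamma>
  have [measurable]: "L \<in> borel_measurable \<pi>" "R \<in> borel_measurable \<pi>" unfolding L_def R_def by measurable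
  define B where "B = {\<gamma>\<in>space \<pi>. R \<gamma> < L \<gamma>}"
  have [measurable]: "B \<in> sets \<pi>" unfolding B_def by measurable
  have "emeasure \<pi> B = 0"
  proof (rule ccontr)
    assume B0: "emeasure \<pi> B \<noteq> 0"
    let ?U = "uniform_measure \<pi> B"
    let ?\<pi> = "distr ?U curves_borel (restrict_curve s t)"
    have plan: "test_plan m ?\<pi>" by (rule test_plan_restrict[OF \<pi> st _ B0]) measurable
    have setsU: "sets ?U = sets curves_borel" using setsp by simp
    have rU: "restrict_curve s t \<in> ?U \<rightarrow>\<^sub>M curves_borel"
      using measurable_restrict_curve[OF st] measurable_cong_sets[OF setsU refl] by blast
    have [measurable]: "(\<lambda>\<gamma>. \<gamma> 0) \<in> borel_measurable (curves_borel :: (real \<Rightarrow> 'a) measure)"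
      "(\<lambda>\<gamma>. \<gamma> 1) \<in> borel_measurable (curves_borel :: (real \<Rightarrow> 'a) measure)"
      by (rule measurable_curve_eval, simp)+
    have [measurable]: "(\<lambda>\<gamma>. ennreal \<bar>f (\<gamma> 1) - f (\<gamma> 0)\<bar>) \<in> borel_measurable curves_borel"
      by measurable
    have "(\<integral>\<^sup>+\<gamma>. L \<gamma> * indicator B \<gamma> \<partial>\<pi>) / emeasure \<pi> B = (\<integral>\<^sup>+\<gamma>. L \<gamma> \<partial>?U)"
      by (subst nn_integral_uniform_measure) auto
    also have "\<dots> = (\<integral>\<^sup>+\<gamma>. ennreal \<bar>f (\<gamma> 1) - f (\<gamma> 0)\<bar> \<partial>?\<pi>)"
      by (subst nn_integral_distr[OF rU]) (auto simp: L_def[abs_def] restrict_curve_def)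
    also have "\<dots> \<le> (\<integral>\<^sup>+\<gamma>. (\<integral>\<^sup>+r\<in>{0..1}. weighted_speed G \<gamma> r \<partial>lborel) \<partial>?\<pi>)"
      using wug plan by (simp add: weak_upper_gradient_def weighted_speed_def)
    also have "\<dots> = (\<integral>\<^sup>+\<gamma>. (\<integral>\<^sup>+r\<in>{0..1}. weighted_speed G (restrict_curve s t \<gamma>) r \<partial>lborel) \<partial>?U)"
      by (rule nn_integral_distr[OF rU]) (rule measurable_integral_weighted_speed[OF G], simp)
    also have "\<dots> \<le> (\<integral>\<^sup>+\<gamma>. R \<gamma> \<partial>?U)"
      unfolding R_def using spacep by (intro nn_integral_mono nn_integral_weighted_speed_restrict_curve_le st G) simp
    also have "\<dots> = (\<integral>\<^sup>+\<gamma>. R \<gamma> * indicator B \<gamma> \<partial>\<pi>) / emeasure \<pi> B"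
      by (subst nn_integral_uniform_measure) auto
    finally have le0: "(\<integral>\<^sup>+\<gamma>. L \<gamma> * indicator B \<gamma> \<partial>\<pi>) / emeasure \<pi> B \<le> (\<integral>\<^sup>+\<gamma>. R \<gamma> * indicator B \<gamma> \<partial>\<pi>) / emeasure \<pi> B" .
    have le: "(\<integral>\<^sup>+\<gamma>. L \<gamma> * indicator B \<gamma> \<partial>\<pi>) \<le> (\<integral>\<^sup>+\<gamma>. R \<gamma> * indicator B \<gamma> \<partial>\<pi>)"
    proof -
      define b where "b = measure \<pi> B"
      have b: "emeasure \<pi> B = ennreal b" "b > 0"
        using B0 by (auto simp: b_def P.emeasure_eq_measure zero_less_measure_iff)
      have *: "x / emeasure \<pi> B * emeasure \<pi> B = x" for x
        using b by (simp add: divide_ennreal_def mult.assoc inverse_ennreal flip: ennreal_mult)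
      from mult_right_mono[OF le0, of "emeasure \<pi> B"] show ?thesis by (simp add: *)
    qed
    have fin: "(\<integral>\<^sup>+\<gamma>. R \<gamma> * indicator B \<gamma> \<partial>\<pi>) < \<infinity>"
    proof -
      have "(\<integral>\<^sup>+\<gamma>. R \<gamma> * indicator B \<gamma> \<partial>\<pi>) \<le> (\<integral>\<^sup>+\<gamma>. (\<integral>\<^sup>+t\<in>{0..1}. weighted_speed G \<gamma> t \<partial>lborel) \<partial>\<pi>)"
      proof (rule nn_integral_mono)
        fix \<gamma>
        have "R \<gamma> \<le> (\<integral>\<^sup>+t\<in>{0..1}. weighted_speed G \<gamma> t \<partial>lborel)"
          unfolding R_def using st by (intro nn_integral_mono) (auto split: split_indicator)
        then show "R \<gamma> * indicator B \<gamma> \<le> (\<integral>\<^sup>+t\<in>{0..1}. weighted_speed G \<gamma> t \<partial>lborel)"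
          by (auto split: split_indicator)
      qed
      then show ?thesis using test_plan_weighted_speed_finite[OF \<pi> m G2] by (rule le_less_trans)
    qed
    have "(\<integral>\<^sup>+\<gamma>. R \<gamma> * indicator B \<gamma> \<partial>\<pi>) < (\<integral>\<^sup>+\<gamma>. L \<gamma> * indicator B \<gamma> \<partial>\<pi>)"
    proof (rule nn_integral_less)
      show "(\<integral>\<^sup>+\<gamma>. R \<gamma> * indicator B \<gamma> \<partial>\<pi>) \<noteq> \<infinity>" using fin by simp
      show "AE \<gamma> in \<pi>. R \<gamma> * indicator B \<gamma> \<le> L \<gamma> * indicator B \<gamma>"
        by (intro AE_I2) (auto simp: B_def split: split_indicator)
      show "\<not> (AE \<gamma> in \<pi>. L \<gamma> * indicator B \<gamma> \<le> R \<gamma> * indicator B \<gamma>)"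
      proof
        assume "AE \<gamma> in \<pi>. L \<gamma> * indicator B \<gamma> \<le> R \<gamma> * indicator B \<gamma>"
        then have "AE \<gamma> in \<pi>. \<gamma> \<notin> B"
          by eventually_elim (auto simp: B_def split: split_indicator_asm)
        then show False using B0 by (subst (asm) AE_iff_measurable[where N = B]) (auto simp: B_def)
      qed
    qed measurable
    then show False using le by simp
  qed
  then have "AE \<gamma> in \<pi>. \<gamma> \<notin> B" by (intro AE_not_in) auto
  with AE_space show ?thesis
    by eventually_elim (auto simp: B_def L_def R_def not_less)
qed

lemma weak_upper_gradientD:
  assumes "weak_upper_gradient m f G"
  shows "G \<in> L2 m" "0 \<le> G x"
  using assms by (auto simp: weak_upper_gradient_def)

text \<open>The bound holds for fixed times along almost every curve, hence for all rational times along almost every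
curve. By Fubini's theorem it also holds between a rational and almost every other time. The function
\<open>f\<close> along the curve therefore agrees almost everywhere with a controlled function.\<close>

lemma weak_upper_gradient_along_curves:
  fixes m :: "'a::{complete_space, second_countable_topology} measure"
  assumes m: "sets m = sets borel" and f[measurable]: "f \<in> borel_measurable borel"
    and wug: "weak_upper_gradient m f G" and \<pi>: "test_plan m \<pi>"
  shows "AE \<gamma> in \<pi>. (\<integral>\<^sup>+r\<in>{0..1}. weighted_speed G \<gamma> r \<partial>lborel) < \<infinity> \<and>
    (\<exists>U. controlled U (weighted_speed G \<gamma>) \<and> U 0 = f (\<gamma> 0) \<and> U 1 = f (\<gamma> 1) \<and>
       (AE t in lborel. t \<in> {0..1} \<longrightarrow> U t = f (\<gamma> t)))"
proof -
  interpret P: prob_space \<pi> using test_planD[OF \<pi>] by simp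
  interpret pair_sigma_finite \<pi> lborel ..
  note setsp = test_planD(1)[OF \<pi>] and spacep = test_planD(2)[OF \<pi>]
  have G2: "G \<in> L2 m" using wug by (rule weak_upper_gradientD)
  then have G[measurable]: "G \<in> borel_measurable borel" using m by (rule L2_borel)
  define I where "I \<gamma> s t = (\<integral>\<^sup>+r\<in>{min s t..max s t}. weighted_speed G \<gamma> r \<partial>lborel)" for \<gamma> s t
  define good where "good \<gamma> s t \<longleftrightarrow> ennreal \<bar>f (\<gamma> (unit_clamp t)) - f (\<gamma> s)\<bar> \<le> I \<gamma> s t" for \<gamma> s t
  have each: "AE \<gamma> in \<pi>. good \<gamma> s t" if "s \<in> {0..1}" "t \<in> {0..1}" for s t
  proof (cases s t rule: linorder_cases)
    case less
    then show ?thesis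
      using weak_upper_gradient_between_times[OF m f wug \<pi>, of s t] that
      by (auto simp: good_def I_def unit_clamp min_def max_def)
  next
    case equal
    then show ?thesis using that by (simp add: good_def unit_clamp)
  next
    case greater
    then show ?thesis
      using weak_upper_gradient_between_times[OF m f wug \<pi>, of t s] that
      by (auto simp: good_def I_def unit_clamp min_def max_def abs_minus_commute)
  qed
  have rat: "AE \<gamma> in \<pi>. \<forall>s\<in>\<rat> \<inter> {0..1}. \<forall>t\<in>\<rat> \<inter> {0..1}. good \<gamma> s t"
    by (intro AE_ball_countable' countable_Int1 countable_rat) (auto intro!: each)
  have meas: "{x\<in>space (\<pi> \<Otimes>\<^sub>M lborel). good (fst x) s (snd x)} \<in> sets (\<pi> \<Otimes>\<^sub>M lborel)" if s: "s \<in> {0..1}" for s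
  proof -
    have eval: "(\<lambda>x. fst x (unit_clamp (snd x))) \<in> borel_measurable (\<pi> \<Otimes>\<^sub>M lborel)"
      using measurable_curve_eval_clamp[where 'a='a]
        measurable_cong_sets[OF sets_pair_measure_cong[OF setsp sets_lborel] refl]
      unfolding case_prod_beta' by blast
    have es: "(\<lambda>x. fst x s) \<in> borel_measurable (\<pi> \<Otimes>\<^sub>M lborel)"
      using measurable_compose[OF measurable_fst, of "\<lambda>\<gamma>. \<gamma> s" \<pi> borel] measurable_curve_eval[OF s, where 'a='a]
        measurable_cong_sets[OF setsp refl] by blast
    have "(\<lambda>x. weighted_speed G (fst x) (snd x)) \<in> borel_measurable (\<pi> \<Otimes>\<^sub>M lborel)"
      using measurable_weighted_speed[OF G setsp] by (simp add: case_prod_beta')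
    then have ws: "(\<lambda>y. weighted_speed G (fst (fst y)) (snd y)) \<in> borel_measurable ((\<pi> \<Otimes>\<^sub>M lborel) \<Otimes>\<^sub>M lborel)"
      using measurable_compose[of "\<lambda>y. (fst (fst y), snd y)" "(\<pi> \<Otimes>\<^sub>M lborel) \<Otimes>\<^sub>M lborel" "\<pi> \<Otimes>\<^sub>M lborel"
          "\<lambda>x. weighted_speed G (fst x) (snd x)" borel] by simp
    have mI: "(\<lambda>x. I (fst x) s (snd x)) \<in> borel_measurable (\<pi> \<Otimes>\<^sub>M lborel)"
      unfolding I_def
    proof (rule lborel.borel_measurable_nn_integral, unfold case_prod_beta', rule borel_measurable_times_ennreal[OF ws])
      have "(\<lambda>y. indicator {min s (snd (fst y))..max s (snd (fst y))} (snd y) :: ennreal)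
         = (\<lambda>y :: ((real \<Rightarrow> 'a) \<times> real) \<times> real. if min s (snd (fst y)) \<le> snd y \<and> snd y \<le> max s (snd (fst y)) then 1 else 0)"
        by (auto simp: fun_eq_iff indicator_def)
      also have "\<dots> \<in> borel_measurable ((\<pi> \<Otimes>\<^sub>M lborel) \<Otimes>\<^sub>M lborel)" by measurable
      finally show "(\<lambda>y. indicator {min s (snd (fst y))..max s (snd (fst y))} (snd y) :: ennreal) \<in> borel_measurable ((\<pi> \<Otimes>\<^sub>M lborel) \<Otimes>\<^sub>M lborel)" .
    qed
    have mf: "(\<lambda>x. f (fst x (unit_clamp (snd x))) - f (fst x s)) \<in> borel_measurable (\<pi> \<Otimes>\<^sub>M lborel)"
      by (intro borel_measurable_diff measurable_compose[OF eval f] measurable_compose[OF es f])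
    then have ml: "(\<lambda>x. ennreal \<bar>f (fst x (unit_clamp (snd x))) - f (fst x s)\<bar>) \<in> borel_measurable (\<pi> \<Otimes>\<^sub>M lborel)"
      by simp
    show ?thesis unfolding good_def by (rule borel_measurable_le[OF ml mI])
  qed
  have "AE \<gamma> in \<pi>. AE t in lborel. t \<in> {0..1} \<longrightarrow> good \<gamma> s t" if s: "s \<in> \<rat> \<inter> {0..1}" for s
  proof (subst AE_commute)
    have "{x \<in> space (\<pi> \<Otimes>\<^sub>M lborel). snd x \<in> {0..1} \<longrightarrow> good (fst x) s (snd x)} =
      {x \<in> space (\<pi> \<Otimes>\<^sub>M lborel). snd x \<notin> {0..1}} \<union> {x\<in>space (\<pi> \<Otimes>\<^sub>M lborel). good (fst x) s (snd x)}" by auto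
    also have "\<dots> \<in> sets (\<pi> \<Otimes>\<^sub>M lborel)"
    proof (rule sets.Un)
      show "{x \<in> space (\<pi> \<Otimes>\<^sub>M lborel). snd x \<notin> {0..1::real}} \<in> sets (\<pi> \<Otimes>\<^sub>M lborel)" by measurable
    qed (rule meas, use s in simp)
    finally show "{x \<in> space (\<pi> \<Otimes>\<^sub>M lborel). snd x \<in> {0..1} \<longrightarrow> good (fst x) s (snd x)} \<in> sets (\<pi> \<Otimes>\<^sub>M lborel)" .
    show "AE t in lborel. AE \<gamma> in \<pi>. t \<in> {0..1} \<longrightarrow> good \<gamma> s t"
    proof (rule AE_I2)
      fix t :: real
      show "AE \<gamma> in \<pi>. t \<in> {0..1} \<longrightarrow> good \<gamma> s t"
        using each[of s t] s by (cases "t \<in> {0..1}") auto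
    qed
  qed
  then have "AE \<gamma> in \<pi>. \<forall>s\<in>\<rat> \<inter> {0..1}. AE t in lborel. t \<in> {0..1} \<longrightarrow> good \<gamma> s t"
    by (intro AE_ball_countable' countable_Int1 countable_rat)
  then have ae: "AE \<gamma> in \<pi>. AE t in lborel. \<forall>s\<in>\<rat> \<inter> {0..1}. t \<in> {0..1} \<longrightarrow> good \<gamma> s t"
    by eventually_elim (intro AE_ball_countable' countable_Int1 countable_rat, blast)
  have fin: "AE \<gamma> in \<pi>. (\<integral>\<^sup>+r\<in>{0..1}. weighted_speed G \<gamma> r \<partial>lborel) \<noteq> \<infinity>"
    using test_plan_weighted_speed_finite[OF \<pi> m G2] measurable_integral_weighted_speed[OF G setsp, of 0 1]
    by (intro nn_integral_PInf_AE) auto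
  show ?thesis
    using rat ae fin AE_space
  proof eventually_elim
    case (elim \<gamma>)
    have \<gamma>: "\<gamma> \<in> mspace curves" using elim spacep by simp
    have fin: "(\<integral>\<^sup>+r\<in>{0..1}. weighted_speed G \<gamma> r \<partial>lborel) < \<infinity>" using elim by (simp add: less_top)
    obtain U where "controlled U (weighted_speed G \<gamma>)" "U 0 = f (\<gamma> 0)" "U 1 = f (\<gamma> 1)" "AE t in lborel. t \<in> {0..1} \<longrightarrow> U t = f (\<gamma> t)"
    proof (rule controlled_extension[OF weighted_speed_borel[OF G \<gamma>] fin, of "\<lambda>t. f (\<gamma> t)"])
      fix s t :: real assume "s \<in> \<rat> \<inter> {0..1}" "t \<in> \<rat> \<inter> {0..1}"
      then show "ennreal \<bar>f (\<gamma> t) - f (\<gamma> s)\<bar> \<le> (\<integral>\<^sup>+r\<in>{min s t..max s t}. weighted_speed G \<gamma> r \<partial>lborel)"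
        using elim(1) by (auto simp: good_def I_def unit_clamp)
    next
      show "AE t in lborel. t \<in> {0..1} \<longrightarrow> (\<forall>s\<in>\<rat> \<inter> {0..1}. ennreal \<bar>f (\<gamma> t) - f (\<gamma> s)\<bar> \<le> (\<integral>\<^sup>+r\<in>{min s t..max s t}. weighted_speed G \<gamma> r \<partial>lborel))"
        using elim(2) by eventually_elim (auto simp: good_def I_def unit_clamp)
    qed blast
    then show ?case using fin by blast
  qed
qed

lemma weak_upper_gradientI:
  assumes "G \<in> L2 m" "\<And>x. 0 \<le> G x"
    and "\<And>\<pi>. test_plan m \<pi> \<Longrightarrow> AE \<gamma> in \<pi>. ennreal \<bar>f (\<gamma> 1) - f (\<gamma> 0)\<bar> \<le> (\<integral>\<^sup>+r\<in>{0..1}. weighted_speed G \<gamma> r \<partial>lborel)"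
  shows "weak_upper_gradient m f G"
  using assms unfolding weak_upper_gradient_def by (auto intro!: nn_integral_mono_AE simp flip: weighted_speed_def)

lemma L2_dominated:
  assumes "f \<in> borel_measurable m" "g \<in> L2 m" "\<And>x. \<bar>f x\<bar> \<le> C * \<bar>g x\<bar>"
  shows "f \<in> L2 m"
proof -
  have [measurable]: "f \<in> borel_measurable m" "g \<in> borel_measurable m" using assms by (auto simp: L2_def)
  have "integrable m (\<lambda>x. C\<^sup>2 * (g x)\<^sup>2)" using assms(2) by (simp add: L2_def)
  then have "integrable m (\<lambda>x. (f x)\<^sup>2)"
  proof (rule Bochner_Integration.integrable_bound)
    show "AE x in m. norm ((f x)\<^sup>2) \<le> norm (C\<^sup>2 * (g x)\<^sup>2)"
    proof (rule AE_I2)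
      fix x
      have "\<bar>f x\<bar>\<^sup>2 \<le> (C * \<bar>g x\<bar>)\<^sup>2" using assms(3)[of x] by (intro power_mono) auto
      then show "norm ((f x)\<^sup>2) \<le> norm (C\<^sup>2 * (g x)\<^sup>2)" by (simp add: power_mult_distrib)
    qed
  qed measurable
  then show ?thesis using assms by (simp add: L2_def)
qed

lemma L2_add:
  assumes "f \<in> L2 m" "g \<in> L2 m"
  shows "(\<lambda>x. f x + g x) \<in> L2 m"
proof -
  have [measurable]: "f \<in> borel_measurable m" "g \<in> borel_measurable m" using assms by (auto simp: L2_def)
  have "integrable m (\<lambda>x. 2 * (f x)\<^sup>2 + 2 * (g x)\<^sup>2)" using assms by (simp add: L2_def)
  then have "integrable m (\<lambda>x. (f x + g x)\<^sup>2)"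
  proof (rule Bochner_Integration.integrable_bound)
    show "AE x in m. norm ((f x + g x)\<^sup>2) \<le> norm (2 * (f x)\<^sup>2 + 2 * (g x)\<^sup>2)"
    proof (rule AE_I2)
      fix x
      have "(f x + g x)\<^sup>2 \<le> 2 * (f x)\<^sup>2 + 2 * (g x)\<^sup>2"
        using zero_le_power2[of "f x - g x"] by (simp add: power2_eq_square algebra_simps)
      then show "norm ((f x + g x)\<^sup>2) \<le> norm (2 * (f x)\<^sup>2 + 2 * (g x)\<^sup>2)" by simp
    qed
  qed measurable
  then show ?thesis by (simp add: L2_def)
qed

lemma L2_cmult: "f \<in> L2 m \<Longrightarrow> (\<lambda>x. c * f x) \<in> L2 m"
  by (rule L2_dominated[of _ _ f "\<bar>c\<bar>"]) (auto simp: L2_def abs_mult)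

lemma L2_diff:
  assumes "f \<in> L2 m" "g \<in> L2 m"
  shows "(\<lambda>x. f x - g x) \<in> L2 m"
  using L2_add[OF assms(1) L2_cmult[OF assms(2), of "-1"]] by simp

lemma L2_bounded_mult:
  assumes "b \<in> borel_measurable m" "f \<in> L2 m" "\<And>x. \<bar>b x\<bar> \<le> C"
  shows "(\<lambda>x. b x * f x) \<in> L2 m"
proof (rule L2_dominated[OF _ assms(2), of _ C])
  have "f \<in> borel_measurable m" using assms(2) by (simp add: L2_def)
  with assms(1) show "(\<lambda>x. b x * f x) \<in> borel_measurable m" by (rule borel_measurable_times)
  show "\<bar>b x * f x\<bar> \<le> C * \<bar>f x\<bar>" for x
    unfolding abs_mult by (intro mult_right_mono assms(3)) simp
qed

lemma L2_min:
  assumes "f \<in> L2 m" "g \<in> L2 m" "\<And>x. 0 \<le> f x" "\<And>x. 0 \<le> g x"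
  shows "(\<lambda>x. min (f x) (g x)) \<in> L2 m"
proof (rule L2_dominated[OF _ assms(1), of _ 1])
  show "(\<lambda>x. min (f x) (g x)) \<in> borel_measurable m"
    using assms(1,2) by (intro borel_measurable_min) (auto simp: L2_def)
  show "\<bar>min (f x) (g x)\<bar> \<le> 1 * \<bar>f x\<bar>" for x
    using assms(3)[of x] assms(4)[of x] by simp
qed

text \<open>Along almost every curve the controlled representatives for \<open>G1\<close> and \<open>G2\<close> are continuous and agree
almost everywhere, so they are the same function, which is controlled by both.\<close>

lemma weak_upper_gradient_min:
  fixes m :: "'a::{complete_space, second_countable_topology} measure"
  assumes m: "sets m = sets borel" and f: "f \<in> borel_measurable borel"
    and G1: "weak_upper_gradient m f G1" and G2: "weak_upper_gradient m f G2"
  shows "weak_upper_gradient m f (\<lambda>x. min (G1 x) (G2 x))"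
proof (rule weak_upper_gradientI)
  show "(\<lambda>x. min (G1 x) (G2 x)) \<in> L2 m"
    by (intro L2_min weak_upper_gradientD[OF G1] weak_upper_gradientD[OF G2])
  show "0 \<le> min (G1 x) (G2 x)" for x
    using weak_upper_gradientD(2)[OF G1, of x] weak_upper_gradientD(2)[OF G2, of x] by simp
  fix \<pi> assume \<pi>: "test_plan m \<pi>"
  have b: "G1 \<in> borel_measurable borel" "G2 \<in> borel_measurable borel"
    using L2_borel m weak_upper_gradientD(1)[OF G1] weak_upper_gradientD(1)[OF G2] by blast+
  show "AE \<gamma> in \<pi>. ennreal \<bar>f (\<gamma> 1) - f (\<gamma> 0)\<bar> \<le> (\<integral>\<^sup>+r\<in>{0..1}. weighted_speed (\<lambda>x. min (G1 x) (G2 x)) \<gamma> r \<partial>lborel)"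
    using weak_upper_gradient_along_curves[OF m f G1 \<pi>] weak_upper_gradient_along_curves[OF m f G2 \<pi>] AE_space
  proof eventually_elim
    case (elim \<gamma>)
    have \<gamma>: "\<gamma> \<in> mspace curves" using elim test_planD(2)[OF \<pi>] by simp
    note w = weighted_speed_borel[OF b(1) \<gamma>] weighted_speed_borel[OF b(2) \<gamma>]
    obtain U V where U: "controlled U (weighted_speed G1 \<gamma>)" "U 0 = f (\<gamma> 0)" "U 1 = f (\<gamma> 1)" "AE t in lborel. t \<in> {0..1} \<longrightarrow> U t = f (\<gamma> t)"
      and V: "controlled V (weighted_speed G2 \<gamma>)" "AE t in lborel. t \<in> {0..1} \<longrightarrow> V t = f (\<gamma> t)"
      using elim by blast
    have "AE t in lborel. t \<in> {0..1} \<longrightarrow> U t = V t" using U(4) V(2) by eventually_elim auto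
    moreover have "continuous_on {0..1} U" "continuous_on {0..1} V"
      using elim controlled_continuous_on[OF U(1) w(1)] controlled_continuous_on[OF V(1) w(2)] by blast+
    ultimately have "U t = V t" if "t \<in> {0..1}" for t
      using continuous_AE_eq_on_unit_interval that by blast
    then have "controlled U (weighted_speed G2 \<gamma>)" using V(1) by (auto simp: controlled_def)
    from controlled_min[OF U(1) this w] elim
    have "controlled U (\<lambda>r. min (weighted_speed G1 \<gamma> r) (weighted_speed G2 \<gamma> r))" by auto
    from controlledD[OF this, of 0 1] U(2,3)
    have "ennreal \<bar>f (\<gamma> 1) - f (\<gamma> 0)\<bar> \<le> (\<integral>\<^sup>+r\<in>{0..1}. min (weighted_speed G1 \<gamma> r) (weighted_speed G2 \<gamma> r) \<partial>lborel)" by simp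
    also have "\<dots> \<le> (\<integral>\<^sup>+r\<in>{0..1}. weighted_speed (\<lambda>x. min (G1 x) (G2 x)) \<gamma> r \<partial>lborel)"
      by (intro nn_integral_mono mult_right_mono) (auto simp: weighted_speed_def min_def)
    finally show ?case .
  qed
qed

text \<open>A minimizing sequence for the \<open>L\<^sup>2\<close> norm may be taken decreasing, by passing to minima. Its limit \<open>L\<close> is a
weak upper gradient of least norm. For any other one, the minimum with \<open>L\<close> has the same norm as \<open>L\<close>, so it
equals \<open>L\<close> almost everywhere.\<close>

lemma ex_minimal_weak_upper_gradient:
  fixes m :: "'a::{complete_space, second_countable_topology} measure"
  assumes m: "sets m = sets borel" and f: "f \<in> borel_measurable borel"
    and ex: "weak_upper_gradient m f G0"
  shows "\<exists>G. weak_upper_gradient m f G \<and> (\<forall>G'. weak_upper_gradient m f G' \<longrightarrow> (AE x in m. G x \<le> G' x))"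
proof -
  define E where "E G = (\<integral>x. (G x)\<^sup>2 \<partial>m)" for G :: "'a \<Rightarrow> real"
  define W where "W = {G. weak_upper_gradient m f G}"
  have E0: "0 \<le> E G" for G by (simp add: E_def)
  have bdd: "bdd_below (E ` W)" using E0 by (intro bdd_belowI2[of _ 0]) auto
  define e where "e = (INF G\<in>W. E G)"
  have le: "e \<le> E G" if "G \<in> W" for G unfolding e_def by (rule cINF_lower[OF bdd that])
  have "\<exists>G\<in>W. E G < e + 1 / real (Suc n)" for n
    using cINF_less_iff[OF _ bdd, of "e + 1 / real (Suc n)"] ex by (auto simp: e_def W_def)
  then obtain S where S: "\<And>n. S n \<in> W" "\<And>n. E (S n) < e + 1 / real (Suc n)" by metis
  define H where "H = rec_nat (S 0) (\<lambda>n G x. min (G x) (S (Suc n) x))"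
  have Hs: "H 0 = S 0" "H (Suc n) = (\<lambda>x. min (H n x) (S (Suc n) x))" for n by (simp_all add: H_def)
  have HW: "H n \<in> W" for n
  proof (induction n)
    case (Suc n) then show ?case
      using S(1)[of "Suc n"] weak_upper_gradient_min[OF m f, of "H n" "S (Suc n)"] by (simp add: W_def Hs)
  qed (use S in \<open>simp add: Hs\<close>)
  have HS: "H n x \<le> S n x" for n x by (cases n) (auto simp: Hs)
  have dec: "decseq (\<lambda>n. H n x)" for x by (rule decseq_SucI) (simp add: Hs)
  have H0: "0 \<le> H n x" for n x using HW[of n] weak_upper_gradientD(2) by (auto simp: W_def)
  have HL2: "H n \<in> L2 m" for n using HW[of n] weak_upper_gradientD(1) by (auto simp: W_def)
  define L where "L x = (INF n. H n x)" for x
  have bx: "bdd_below (range (\<lambda>n. H n x))" for x using H0 by (intro bdd_belowI2[of _ 0]) auto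
  have LH: "L x \<le> H n x" for n x unfolding L_def by (rule cINF_lower[OF bx]) simp
  have L0: "0 \<le> L x" for x unfolding L_def by (rule cINF_greatest) (auto simp: H0)
  have limL: "(\<lambda>n. H n x) \<longlonglongrightarrow> L x" for x unfolding L_def by (rule LIMSEQ_decseq_INF[OF bx dec])
  have Lm: "L \<in> borel_measurable m"
    by (rule borel_measurable_LIMSEQ_metric[where f = H]) (use HL2 limL in \<open>auto simp: L2_def\<close>)
  have LL2: "L \<in> L2 m" by (rule L2_dominated[OF Lm HL2[of 0], of 1]) (use LH[of _ 0] L0 H0 in simp)
  have LW: "weak_upper_gradient m f L"
  proof (rule weak_upper_gradientI[OF LL2 L0])
    fix \<pi> assume \<pi>: "test_plan m \<pi>"
    have a: "AE \<gamma> in \<pi>. \<forall>n\<in>UNIV. (\<integral>\<^sup>+r\<in>{0..1}. weighted_speed (H n) \<gamma> r \<partial>lborel) < \<infinity> \<and>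
       ennreal \<bar>f (\<gamma> 1) - f (\<gamma> 0)\<bar> \<le> (\<integral>\<^sup>+r\<in>{0..1}. weighted_speed (H n) \<gamma> r \<partial>lborel)"
    proof (rule AE_ball_countable')
      fix n
      have "weak_upper_gradient m f (H n)" using HW[of n] by (simp add: W_def)
      from weak_upper_gradient_along_curves[OF m f this \<pi>]
      show "AE \<gamma> in \<pi>. (\<integral>\<^sup>+r\<in>{0..1}. weighted_speed (H n) \<gamma> r \<partial>lborel) < \<infinity> \<and>
       ennreal \<bar>f (\<gamma> 1) - f (\<gamma> 0)\<bar> \<le> (\<integral>\<^sup>+r\<in>{0..1}. weighted_speed (H n) \<gamma> r \<partial>lborel)"
      proof eventually_elim
        case (elim \<gamma>)
        then obtain U where "controlled U (weighted_speed (H n) \<gamma>)" "U 0 = f (\<gamma> 0)" "U 1 = f (\<gamma> 1)" by blast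
        from controlledD[OF this(1), of 0 1] this elim show ?case by simp
      qed
    qed simp
    show "AE \<gamma> in \<pi>. ennreal \<bar>f (\<gamma> 1) - f (\<gamma> 0)\<bar> \<le> (\<integral>\<^sup>+r\<in>{0..1}. weighted_speed L \<gamma> r \<partial>lborel)"
      using a AE_space
    proof eventually_elim
      case (elim \<gamma>)
      have \<gamma>: "\<gamma> \<in> mspace curves" using elim test_planD(2)[OF \<pi>] by simp
      have Hb: "H n \<in> borel_measurable borel" for n using L2_borel[OF HL2 m] .
      note [measurable] = weighted_speed_borel[OF Hb \<gamma>]
      have fin0: "(\<integral>\<^sup>+r\<in>{0..1}. weighted_speed (H 0) \<gamma> r \<partial>lborel) < \<infinity>" using elim(1) by blast
      then have "AE r in lborel. weighted_speed (H 0) \<gamma> r * indicator {0..1} r \<noteq> \<infinity>"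
        by (intro nn_integral_PInf_AE) (simp_all add: less_top)
      then have eq: "AE r in lborel. weighted_speed L \<gamma> r * indicator {0..1} r = (INF n. weighted_speed (H n) \<gamma> r * indicator {0..1} r)"
      proof eventually_elim
        case (elim r)
        show ?case
        proof (cases "r \<in> {0..1}")
          case True
          have lim: "(\<lambda>n. ennreal (H n (\<gamma> r))) \<longlonglongrightarrow> ennreal (L (\<gamma> r))" by (intro tendsto_ennrealI limL)
          have lim2: "(\<lambda>n. ennreal (H n (\<gamma> r)) * metric_speed \<gamma> r) \<longlonglongrightarrow> weighted_speed L \<gamma> r"
          proof (cases "metric_speed \<gamma> r = \<top>")
            case False
            then show ?thesis unfolding weighted_speed_def by (intro tendsto_mult_ennreal lim tendsto_const) auto
          next
            case T: True
            then have "H 0 (\<gamma> r) \<le> 0" using elim True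
              by (auto simp: weighted_speed_def ennreal_mult_eq_top_iff ennreal_eq_0_iff)
            then have "H n (\<gamma> r) = 0" "L (\<gamma> r) = 0" for n
              using decseqD[OF dec, of 0 n "\<gamma> r"] H0[of n "\<gamma> r"] LH[of "\<gamma> r" 0] L0[of "\<gamma> r"] by auto
            then show ?thesis by (simp add: weighted_speed_def)
          qed
          have "decseq (\<lambda>n. ennreal (H n (\<gamma> r)) * metric_speed \<gamma> r)"
            using dec by (auto simp: decseq_def intro!: mult_right_mono ennreal_leI)
          from LIMSEQ_unique[OF lim2 LIMSEQ_INF[OF this]] show ?thesis using True by (simp add: weighted_speed_def)
        qed simp
      qed
      have "ennreal \<bar>f (\<gamma> 1) - f (\<gamma> 0)\<bar> \<le> (INF n. \<integral>\<^sup>+r\<in>{0..1}. weighted_speed (H n) \<gamma> r \<partial>lborel)"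
        using elim by (intro INF_greatest) auto
      also have "\<dots> = (\<integral>\<^sup>+r. (INF n. weighted_speed (H n) \<gamma> r * indicator {0..1} r) \<partial>lborel)"
      proof (rule nn_integral_monotone_convergence_INF_decseq[symmetric])
        show "decseq (\<lambda>n r. weighted_speed (H n) \<gamma> r * indicator {0..1} r)"
          by (intro decseq_SucI le_funI) (auto simp: weighted_speed_def Hs intro!: mult_right_mono ennreal_leI)
        show "(\<integral>\<^sup>+r\<in>{0..1}. weighted_speed (H 0) \<gamma> r \<partial>lborel) < \<infinity>" using elim by auto
      qed measurable
      also have "\<dots> = (\<integral>\<^sup>+r\<in>{0..1}. weighted_speed L \<gamma> r \<partial>lborel)"
        using eq by (intro nn_integral_cong_AE) auto
      finally show ?case .
    qed
  qed
  have EL: "E L \<le> e"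
  proof (rule field_le_epsilon)
    fix d :: real assume "d > 0"
    then obtain n where n: "inverse (real (Suc n)) < d" using reals_Archimedean by blast
    have "E L \<le> E (S n)"
      unfolding E_def
    proof (rule integral_mono)
      show "integrable m (\<lambda>x. (L x)\<^sup>2)" using LL2 by (simp add: L2_def)
      show "integrable m (\<lambda>x. (S n x)\<^sup>2)" using S(1)[of n] weak_upper_gradientD(1) by (auto simp: W_def L2_def)
      show "(L x)\<^sup>2 \<le> (S n x)\<^sup>2" for x
        using L0[of x] LH[of x n] HS[of n x] by (intro power_mono) auto
    qed
    then show "E L \<le> e + d" using S(2)[of n] n by (simp add: inverse_eq_divide)
  qed
  show ?thesis
  proof (intro exI[of _ L] conjI allI impI LW)
    fix G' assume G': "weak_upper_gradient m f G'"
    define M where "M x = min (L x) (G' x)" for x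
    have M: "weak_upper_gradient m f M" unfolding M_def by (rule weak_upper_gradient_min[OF m f LW G'])
    have G'0: "0 \<le> G' x" for x using weak_upper_gradientD(2)[OF G'] .
    have iM: "integrable m (\<lambda>x. (M x)\<^sup>2)" using weak_upper_gradientD(1)[OF M] by (simp add: L2_def)
    have iL: "integrable m (\<lambda>x. (L x)\<^sup>2)" using LL2 by (simp add: L2_def)
    have nn: "0 \<le> (L x)\<^sup>2 - (M x)\<^sup>2" for x
      using L0[of x] G'0[of x] power_mono[of "M x" "L x" 2] by (simp add: M_def)
    have "(\<integral>x. (L x)\<^sup>2 - (M x)\<^sup>2 \<partial>m) = E L - E M" using iM iL by (simp add: E_def)
    also have "\<dots> \<le> 0" using EL le[of M] M by (simp add: W_def)
    finally have "(\<integral>x. (L x)\<^sup>2 - (M x)\<^sup>2 \<partial>m) \<le> 0" .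
    moreover have "0 \<le> (\<integral>x. (L x)\<^sup>2 - (M x)\<^sup>2 \<partial>m)" by (intro integral_nonneg_AE AE_I2 nn)
    ultimately have "(\<integral>x. (L x)\<^sup>2 - (M x)\<^sup>2 \<partial>m) = 0" by (rule order_antisym)
    then have "AE x in m. (L x)\<^sup>2 - (M x)\<^sup>2 = 0"
      using iM iL nn by (subst (asm) integral_nonneg_eq_0_iff_AE) auto
    then show "AE x in m. L x \<le> G' x"
    proof eventually_elim
      case (elim x)
      then have "L x = M x" using L0[of x] G'0[of x] power2_eq_iff_nonneg[of "L x" "M x"] by (simp add: M_def)
      then show ?case by (simp add: M_def)
    qed
  qed
qed

lemma min_weak_upper_gradient:
  fixes m :: "'a::{complete_space, second_countable_topology} measure"
  assumes m: "sets m = sets borel" and f: "f \<in> S2 m"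
  shows "weak_upper_gradient m f (min_weak_upper_gradient m f)"
    and "weak_upper_gradient m f G \<Longrightarrow> AE x in m. min_weak_upper_gradient m f x \<le> G x"
proof -
  have fb: "f \<in> borel_measurable borel" and "\<exists>G. weak_upper_gradient m f G" using f by (auto simp: S2_def)
  then have "\<exists>G. weak_upper_gradient m f G \<and> (\<forall>G'. weak_upper_gradient m f G' \<longrightarrow> (AE x in m. G x \<le> G' x))"
    using ex_minimal_weak_upper_gradient[OF m fb] by blast
  then have *: "weak_upper_gradient m f (min_weak_upper_gradient m f) \<and>
    (\<forall>G'. weak_upper_gradient m f G' \<longrightarrow> (AE x in m. min_weak_upper_gradient m f x \<le> G' x))"
    unfolding min_weak_upper_gradient_def by (rule someI_ex)
  then show "weak_upper_gradient m f (min_weak_upper_gradient m f)" by blast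
  show "weak_upper_gradient m f G \<Longrightarrow> AE x in m. min_weak_upper_gradient m f x \<le> G x" using * by blast
qed

section \<open>The Leibniz bound and the energy of weighted functions\<close>

text \<open>The slope of \<open>\<Theta> (\<psi> (\<gamma> r))\<close> in \<open>r\<close> is at most \<open>|\<Theta>' (\<psi> (\<gamma> r))|\<close> times the speed, wherever the speed is finite.\<close>

lemma controlled_lipschitz_composite:
  fixes \<gamma> :: "real \<Rightarrow> 'a::{metric_space,second_countable_topology}"
  assumes \<gamma>: "\<gamma> \<in> mspace curves" and ac: "abs_cont_curve \<gamma>"
    and fin: "(\<integral>\<^sup>+r\<in>{0..1}. metric_speed \<gamma> r \<partial>lborel) < \<infinity>"
    and lip: "\<And>x y. \<bar>\<psi> x - \<psi> y\<bar> \<le> dist x y" and range: "\<And>x. \<psi> x \<in> {0..R}"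
    and deriv: "\<And>u. (\<Theta> has_real_derivative \<Theta>' u) (at u)" and cont: "continuous_on UNIV \<Theta>'"
  shows "controlled (\<lambda>r. \<Theta> (\<psi> (\<gamma> r))) (weighted_speed (\<lambda>x. \<bar>\<Theta>' (\<psi> x)\<bar>) \<gamma>)"
    and "(\<integral>\<^sup>+r\<in>{0..1}. weighted_speed (\<lambda>x. \<bar>\<Theta>' (\<psi> x)\<bar>) \<gamma> r \<partial>lborel) < \<infinity>"
proof -
  have contg: "continuous_on {0..1} \<gamma>" using \<gamma> by (simp add: mspace_curves)
  have contpsi: "continuous_on UNIV \<psi>"
    unfolding continuous_on_iff using lip by (metis dist_real_def le_less_trans)
  have "compact (\<Theta>' ` {0..R})" using cont by (intro compact_continuous_image continuous_on_subset[OF cont]) auto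
  then obtain L0 where "\<forall>y\<in>\<Theta>' ` {0..R}. norm y \<le> L0" using compact_imp_bounded bounded_iff by blast
  then have L0: "\<bar>\<Theta>' u\<bar> \<le> L0" if "u \<in> {0..R}" for u using that by auto
  define L where "L = \<bar>L0\<bar>"
  have L: "\<bar>\<Theta>' u\<bar> \<le> L" if "u \<in> {0..R}" for u using L0[OF that] by (simp add: L_def)
  have L1: "0 \<le> L" by (simp add: L_def)
  have lipT: "\<bar>\<Theta> a - \<Theta> b\<bar> \<le> L * \<bar>a - b\<bar>" if "a \<in> {0..R}" "b \<in> {0..R}" for a b
    using field_differentiable_bound[of "{0..R}" \<Theta> \<Theta>' L a b] deriv L that
    by (auto intro: has_field_derivative_at_within)
  define k where "k = weighted_speed (\<lambda>x. \<bar>\<Theta>' (\<psi> x)\<bar>) \<gamma>"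
  have "continuous_on UNIV (\<lambda>x. \<bar>\<Theta>' (\<psi> x)\<bar>)"
    by (intro continuous_intros continuous_on_compose2[OF cont contpsi]) auto
  then have bm: "(\<lambda>x. \<bar>\<Theta>' (\<psi> x)\<bar>) \<in> borel_measurable borel" by (rule borel_measurable_continuous_onI)
  have [measurable]: "k \<in> borel_measurable borel" unfolding k_def by (rule weighted_speed_borel[OF bm \<gamma>])
  have [measurable]: "metric_speed \<gamma> \<in> borel_measurable borel"
    using weighted_speed_borel[of "\<lambda>x. 1", OF _ \<gamma>] by (simp add: weighted_speed_def[abs_def])
  have finL: "(\<integral>\<^sup>+r\<in>{0..1}. ennreal L * metric_speed \<gamma> r \<partial>lborel) < \<infinity>"
  proof -
    have "(\<integral>\<^sup>+r\<in>{0..1}. ennreal L * metric_speed \<gamma> r \<partial>lborel) = ennreal L * (\<integral>\<^sup>+r\<in>{0..1}. metric_speed \<gamma> r \<partial>lborel)"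
      by (simp add: mult.assoc nn_integral_cmult)
    then show ?thesis using fin by (simp add: ennreal_mult_less_top)
  qed
  have k_le: "k r \<le> ennreal L * metric_speed \<gamma> r" for r
    unfolding k_def weighted_speed_def by (intro mult_right_mono ennreal_leI L range) simp
  have "(\<integral>\<^sup>+r\<in>{0..1}. k r \<partial>lborel) \<le> (\<integral>\<^sup>+r\<in>{0..1}. ennreal L * metric_speed \<gamma> r \<partial>lborel)"
    by (intro nn_integral_mono mult_right_mono k_le) simp
  then have fink: "(\<integral>\<^sup>+r\<in>{0..1}. k r \<partial>lborel) < \<infinity>" using finL by (rule le_less_trans)
  then show "(\<integral>\<^sup>+r\<in>{0..1}. weighted_speed (\<lambda>x. \<bar>\<Theta>' (\<psi> x)\<bar>) \<gamma> r \<partial>lborel) < \<infinity>" by (simp add: k_def)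
  have "controlled (\<lambda>r. \<Theta> (\<psi> (\<gamma> r))) (\<lambda>r. ennreal L * metric_speed \<gamma> r)"
    unfolding controlled_def
  proof safe
    fix s t :: real assume st: "0 \<le> s" "s \<le> t" "t \<le> 1"
    have "\<bar>\<Theta> (\<psi> (\<gamma> t)) - \<Theta> (\<psi> (\<gamma> s))\<bar> \<le> L * \<bar>\<psi> (\<gamma> t) - \<psi> (\<gamma> s)\<bar>" by (intro lipT range)
    also have "\<dots> \<le> L * dist (\<gamma> s) (\<gamma> t)" using lip[of "\<gamma> t" "\<gamma> s"] L1 by (intro mult_left_mono) (auto simp: dist_commute)
    finally have "ennreal \<bar>\<Theta> (\<psi> (\<gamma> t)) - \<Theta> (\<psi> (\<gamma> s))\<bar> \<le> ennreal L * ennreal (dist (\<gamma> s) (\<gamma> t))"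
      using L1 by (simp add: ennreal_leI flip: ennreal_mult)
    also have "\<dots> \<le> ennreal L * (\<integral>\<^sup>+r\<in>{s..t}. metric_speed \<gamma> r \<partial>lborel)"
      by (intro mult_left_mono abs_cont_curve_dist_le_speed[OF \<gamma> ac fin st]) simp
    also have "\<dots> = (\<integral>\<^sup>+r\<in>{s..t}. ennreal L * metric_speed \<gamma> r \<partial>lborel)"
      by (simp add: mult.assoc nn_integral_cmult)
    finally show "ennreal \<bar>\<Theta> (\<psi> (\<gamma> t)) - \<Theta> (\<psi> (\<gamma> s))\<bar> \<le> (\<integral>\<^sup>+r\<in>{s..t}. ennreal L * metric_speed \<gamma> r \<partial>lborel)" .
  qed
  then have "controlled (\<lambda>r. \<Theta> (\<psi> (\<gamma> r))) k"
  proof (rule controlled_by_slope[OF _ _ _ finL fink])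
    have "AE r in lborel. metric_speed \<gamma> r * indicator {0..1} r \<noteq> \<infinity>"
      using fin by (intro nn_integral_PInf_AE) auto
    then show "AE r in lborel. r \<in> {0..1} \<longrightarrow>
      Limsup (at r within {0..1}) (\<lambda>s. ennreal (\<bar>\<Theta> (\<psi> (\<gamma> s)) - \<Theta> (\<psi> (\<gamma> r))\<bar> / \<bar>s - r\<bar>)) \<le> k r"
    proof eventually_elim
      case (elim r)
      show ?case
      proof
        assume r: "r \<in> {0..1}"
        then obtain l where l: "metric_speed \<gamma> r = ennreal l" "l \<ge> 0"
          using elim by (cases "metric_speed \<gamma> r") auto
        define D where "D = \<bar>\<Theta>' (\<psi> (\<gamma> r))\<bar>"
        have D: "D \<ge> 0" by (simp add: D_def)
        have kr: "k r = ennreal (D * l)" using l D by (simp add: k_def weighted_speed_def D_def ennreal_mult)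
        show "Limsup (at r within {0..1}) (\<lambda>s. ennreal (\<bar>\<Theta> (\<psi> (\<gamma> s)) - \<Theta> (\<psi> (\<gamma> r))\<bar> / \<bar>s - r\<bar>)) \<le> k r"
        proof (rule ennreal_le_epsilon)
          fix e :: real assume e: "e > 0"
          define \<eta> where "\<eta> = min 1 (e / (D + l + 1))"
          have pos: "D + l + 1 > 0" using D l by simp
          have \<eta>: "0 < \<eta>" "\<eta> \<le> 1" using e pos by (auto simp: \<eta>_def)
          have "\<eta> * (D + l + 1) \<le> e / (D + l + 1) * (D + l + 1)"
            using pos by (intro mult_right_mono) (auto simp: \<eta>_def)
          then have "\<eta> * (D + l + 1) \<le> e" using pos by simp
          moreover have "\<eta> * \<eta> \<le> \<eta> * 1" using \<eta> by (intro mult_left_mono) auto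
          ultimately have prod: "(D + \<eta>) * (l + \<eta>) \<le> D * l + e"
            by (simp add: algebra_simps)
          have "((\<lambda>v. (\<Theta> v - \<Theta> (\<psi> (\<gamma> r))) / (v - \<psi> (\<gamma> r))) \<longlongrightarrow> \<Theta>' (\<psi> (\<gamma> r))) (at (\<psi> (\<gamma> r)))"
            using deriv by (simp add: has_field_derivative_iff)
          from tendstoD[OF this \<eta>(1)] obtain d where d: "d > 0"
            "\<And>v. v \<noteq> \<psi> (\<gamma> r) \<Longrightarrow> dist v (\<psi> (\<gamma> r)) < d \<Longrightarrow>
               dist ((\<Theta> v - \<Theta> (\<psi> (\<gamma> r))) / (v - \<psi> (\<gamma> r))) (\<Theta>' (\<psi> (\<gamma> r))) < \<eta>"
            unfolding eventually_at by auto
          have dT: "\<bar>\<Theta> v - \<Theta> (\<psi> (\<gamma> r))\<bar> \<le> (D + \<eta>) * \<bar>v - \<psi> (\<gamma> r)\<bar>" if "\<bar>v - \<psi> (\<gamma> r)\<bar> < d" for v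
          proof (cases "v = \<psi> (\<gamma> r)")
            case False
            have "\<bar>(\<Theta> v - \<Theta> (\<psi> (\<gamma> r))) / (v - \<psi> (\<gamma> r))\<bar> \<le> D + \<eta>"
              using d(2)[OF False, unfolded dist_real_def, OF that] unfolding D_def by linarith
            then show ?thesis using False by (simp add: abs_divide divide_le_eq)
          qed simp
          have "Limsup (at r within {0..1}) (\<lambda>z. ennreal (dist (\<gamma> z) (\<gamma> r) / \<bar>z - r\<bar>)) < ennreal (l + \<eta>)"
            using l \<eta> by (simp add: metric_speed_def ennreal_lessI)
          then have ev1: "eventually (\<lambda>z. ennreal (dist (\<gamma> z) (\<gamma> r) / \<bar>z - r\<bar>) < ennreal (l + \<eta>)) (at r within {0..1})"
            by (rule Limsup_lessD)
          have "(\<gamma> \<longlongrightarrow> \<gamma> r) (at r within {0..1})" using contg r by (auto simp: continuous_on_def)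
          from tendstoD[OF this d(1)] have ev2: "eventually (\<lambda>z. dist (\<gamma> z) (\<gamma> r) < d) (at r within {0..1})" .
          have ev3: "eventually (\<lambda>z. z \<noteq> r) (at r within {0..1})"
            by (simp add: eventually_at_filter)
          have "eventually (\<lambda>z. ennreal (\<bar>\<Theta> (\<psi> (\<gamma> z)) - \<Theta> (\<psi> (\<gamma> r))\<bar> / \<bar>z - r\<bar>) \<le> ennreal (D * l + e)) (at r within {0..1})"
            using ev1 ev2 ev3
          proof eventually_elim
            case (elim z)
            have "\<bar>\<psi> (\<gamma> z) - \<psi> (\<gamma> r)\<bar> \<le> dist (\<gamma> z) (\<gamma> r)" by (rule lip)
            then have "\<bar>\<Theta> (\<psi> (\<gamma> z)) - \<Theta> (\<psi> (\<gamma> r))\<bar> \<le> (D + \<eta>) * dist (\<gamma> z) (\<gamma> r)"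
              using dT[of "\<psi> (\<gamma> z)"] elim(2) D \<eta> by (meson add_nonneg_nonneg le_less_trans less_imp_le mult_left_mono order_trans)
            then have "\<bar>\<Theta> (\<psi> (\<gamma> z)) - \<Theta> (\<psi> (\<gamma> r))\<bar> / \<bar>z - r\<bar> \<le> (D + \<eta>) * dist (\<gamma> z) (\<gamma> r) / \<bar>z - r\<bar>"
              by (rule divide_right_mono) simp
            also have "\<dots> = (D + \<eta>) * (dist (\<gamma> z) (\<gamma> r) / \<bar>z - r\<bar>)" by simp
            also have "\<dots> \<le> (D + \<eta>) * (l + \<eta>)"
              using elim(1) D \<eta> by (intro mult_left_mono) (auto simp: ennreal_less_iff)
            also note prod
            finally show ?case by (rule ennreal_leI)
          qed
          then have "Limsup (at r within {0..1}) (\<lambda>s. ennreal (\<bar>\<Theta> (\<psi> (\<gamma> s)) - \<Theta> (\<psi> (\<gamma> r))\<bar> / \<bar>s - r\<bar>)) \<le> ennreal (D * l + e)"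
            by (rule Limsup_bounded)
          then show "Limsup (at r within {0..1}) (\<lambda>s. ennreal (\<bar>\<Theta> (\<psi> (\<gamma> s)) - \<Theta> (\<psi> (\<gamma> r))\<bar> / \<bar>s - r\<bar>)) \<le> k r + ennreal e"
            using e D l by (simp add: kr ennreal_plus)
        qed
      qed
    qed
  qed measurable
  then show "controlled (\<lambda>r. \<Theta> (\<psi> (\<gamma> r))) (weighted_speed (\<lambda>x. \<bar>\<Theta>' (\<psi> x)\<bar>) \<gamma>)" by (simp add: k_def)
qed

text \<open>The Leibniz bound is formulated for functions \<open>\<Theta> \<circ> \<psi>\<close> of a bounded Lipschitz function, because then the
slope of the factor is known pointwise and not only through a global Lipschitz constant. The sharp
constant in the Gaussian exponent depends on this.\<close>

lemma weak_upper_gradient_mult: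
  fixes m :: "'a::{complete_space, second_countable_topology} measure"
  assumes m: "sets m = sets borel" and w: "w \<in> L2 m" and G: "weak_upper_gradient m w G"
    and lip: "\<And>x y. \<bar>\<psi> x - \<psi> y\<bar> \<le> dist x y" and range: "\<And>x. \<psi> x \<in> {0..R}"
    and deriv: "\<And>u. (\<Theta> has_real_derivative \<Theta>' u) (at u)" and cont: "continuous_on UNIV \<Theta>'"
  shows "weak_upper_gradient m (\<lambda>x. \<Theta> (\<psi> x) * w x) (\<lambda>x. \<bar>\<Theta> (\<psi> x)\<bar> * G x + \<bar>\<Theta>' (\<psi> x)\<bar> * \<bar>w x\<bar>)"
    and "(\<lambda>x. \<Theta> (\<psi> x) * w x) \<in> L2 m"
proof -
  have contpsi: "continuous_on UNIV \<psi>"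
    unfolding continuous_on_iff using lip by (metis dist_real_def le_less_trans)
  have contT: "continuous_on UNIV \<Theta>" using deriv by (auto intro: DERIV_isCont continuous_at_imp_continuous_on)
  have bdd: "\<exists>L. \<forall>x. \<bar>h (\<psi> x)\<bar> \<le> L" if h: "continuous_on UNIV h" for h :: "real \<Rightarrow> real"
  proof -
    have "compact (h ` {0..R})" by (intro compact_continuous_image continuous_on_subset[OF h]) auto
    then obtain L0 where "\<forall>y\<in>h ` {0..R}. norm y \<le> L0" using compact_imp_bounded bounded_iff by blast
    then show ?thesis using range by (intro exI[of _ L0]) auto
  qed
  have meas: "(\<lambda>x. h (\<psi> x)) \<in> borel_measurable m" if h: "continuous_on UNIV h" for h :: "real \<Rightarrow> real"
  proof -
    have "(\<lambda>x. h (\<psi> x)) \<in> borel_measurable borel"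
      by (intro borel_measurable_continuous_onI continuous_on_compose2[OF h contpsi]) auto
    then show ?thesis using measurable_cong_sets[OF m refl] by blast
  qed
  have contA: "continuous_on UNIV (\<lambda>u. \<bar>\<Theta> u\<bar>)" "continuous_on UNIV (\<lambda>u. \<bar>\<Theta>' u\<bar>)"
    using contT cont by (intro continuous_intros; simp)+
  have L2m: "(\<lambda>x. h (\<psi> x) * f x) \<in> L2 m" if h: "continuous_on UNIV h" and f: "f \<in> L2 m" for h :: "real \<Rightarrow> real" and f
    using bdd[OF h] L2_bounded_mult[OF meas[OF h] f] by blast
  show "(\<lambda>x. \<Theta> (\<psi> x) * w x) \<in> L2 m" by (rule L2m[OF contT w])
  have wb: "w \<in> borel_measurable borel" using L2_borel[OF w m] .
  have G2: "G \<in> L2 m" and G0: "0 \<le> G x" for x using weak_upper_gradientD[OF G] by auto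
  have Gb: "G \<in> borel_measurable borel" using L2_borel[OF G2 m] .
  have absw: "(\<lambda>x. \<bar>w x\<bar>) \<in> L2 m" using w by (auto simp: L2_def)
  show "weak_upper_gradient m (\<lambda>x. \<Theta> (\<psi> x) * w x) (\<lambda>x. \<bar>\<Theta> (\<psi> x)\<bar> * G x + \<bar>\<Theta>' (\<psi> x)\<bar> * \<bar>w x\<bar>)"
  proof (rule weak_upper_gradientI)
    show "(\<lambda>x. \<bar>\<Theta> (\<psi> x)\<bar> * G x + \<bar>\<Theta>' (\<psi> x)\<bar> * \<bar>w x\<bar>) \<in> L2 m"
      by (intro L2_add L2m[OF contA(1) G2] L2m[OF contA(2) absw])
    show "0 \<le> \<bar>\<Theta> (\<psi> x)\<bar> * G x + \<bar>\<Theta>' (\<psi> x)\<bar> * \<bar>w x\<bar>" for x using G0 by simp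
    fix \<pi> assume \<pi>: "test_plan m \<pi>"
    have ms: "(\<lambda>\<gamma>. \<integral>\<^sup>+t\<in>{0..1}. (metric_speed \<gamma> t)\<^sup>2 \<partial>lborel) \<in> borel_measurable \<pi>"
    proof -
      have [measurable]: "(\<lambda>x. metric_speed (fst x) (snd x)) \<in> borel_measurable (\<pi> \<Otimes>\<^sub>M lborel)"
        using measurable_metric_speed_lborel[OF test_planD(1)[OF \<pi>]] by (simp add: case_prod_beta')
      show ?thesis by (intro lborel.borel_measurable_nn_integral) (simp add: case_prod_beta')
    qed
    have "AE \<gamma> in \<pi>. (\<integral>\<^sup>+t\<in>{0..1}. (metric_speed \<gamma> t)\<^sup>2 \<partial>lborel) \<noteq> \<infinity>"
      using test_planD(5)[OF \<pi>] ms by (intro nn_integral_PInf_AE) auto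
    with weak_upper_gradient_along_curves[OF m wb G \<pi>] test_planD(4)[OF \<pi>] AE_space
    show "AE \<gamma> in \<pi>. ennreal \<bar>\<Theta> (\<psi> (\<gamma> 1)) * w (\<gamma> 1) - \<Theta> (\<psi> (\<gamma> 0)) * w (\<gamma> 0)\<bar>
      \<le> (\<integral>\<^sup>+r\<in>{0..1}. weighted_speed (\<lambda>x. \<bar>\<Theta> (\<psi> x)\<bar> * G x + \<bar>\<Theta>' (\<psi> x)\<bar> * \<bar>w x\<bar>) \<gamma> r \<partial>lborel)"
    proof eventually_elim
      case (elim \<gamma>)
      have \<gamma>: "\<gamma> \<in> mspace curves" using elim test_planD(2)[OF \<pi>] by simp
      have fin: "(\<integral>\<^sup>+r\<in>{0..1}. metric_speed \<gamma> r \<partial>lborel) < \<infinity>"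
        using elim by (intro nn_integral_metric_speed_finite[OF \<gamma>]) (simp add: less_top)
      note c = controlled_lipschitz_composite[OF \<gamma> elim(2) fin lip range deriv cont]
      obtain U where U: "controlled U (weighted_speed G \<gamma>)" "U 0 = w (\<gamma> 0)" "U 1 = w (\<gamma> 1)" "AE t in lborel. t \<in> {0..1} \<longrightarrow> U t = w (\<gamma> t)"
        and finG: "(\<integral>\<^sup>+r\<in>{0..1}. weighted_speed G \<gamma> r \<partial>lborel) < \<infinity>"
        using elim(1) by blast
      have "continuous_on UNIV (\<lambda>x. \<bar>\<Theta>' (\<psi> x)\<bar>)"
        by (rule continuous_on_compose2[OF contA(2) contpsi]) auto
      then have bm: "(\<lambda>x. \<bar>\<Theta>' (\<psi> x)\<bar>) \<in> borel_measurable borel" by (rule borel_measurable_continuous_onI)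
      from controlled_mult[OF c(1) U(1) weighted_speed_borel[OF bm \<gamma>] weighted_speed_borel[OF Gb \<gamma>] c(2) finG]
      have "controlled (\<lambda>r. \<Theta> (\<psi> (\<gamma> r)) * U r)
        (\<lambda>r. ennreal \<bar>\<Theta> (\<psi> (\<gamma> r))\<bar> * weighted_speed G \<gamma> r + ennreal \<bar>U r\<bar> * weighted_speed (\<lambda>x. \<bar>\<Theta>' (\<psi> x)\<bar>) \<gamma> r)" .
      then have "controlled (\<lambda>r. \<Theta> (\<psi> (\<gamma> r)) * U r) (weighted_speed (\<lambda>x. \<bar>\<Theta> (\<psi> x)\<bar> * G x + \<bar>\<Theta>' (\<psi> x)\<bar> * \<bar>w x\<bar>) \<gamma>)"
      proof (rule controlled_cong_AE)
        show "AE r in lborel. r \<in> {0..1} \<longrightarrow> ennreal \<bar>\<Theta> (\<psi> (\<gamma> r))\<bar> * weighted_speed G \<gamma> r + ennreal \<bar>U r\<bar> * weighted_speed (\<lambda>x. \<bar>\<Theta>' (\<psi> x)\<bar>) \<gamma> r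
          = weighted_speed (\<lambda>x. \<bar>\<Theta> (\<psi> x)\<bar> * G x + \<bar>\<Theta>' (\<psi> x)\<bar> * \<bar>w x\<bar>) \<gamma> r"
          using U(4)
        proof eventually_elim
          case (elim r)
          show ?case
          proof
            assume "r \<in> {0..1}"
            then have Ur: "U r = w (\<gamma> r)" using elim by simp
            show "ennreal \<bar>\<Theta> (\<psi> (\<gamma> r))\<bar> * weighted_speed G \<gamma> r + ennreal \<bar>U r\<bar> * weighted_speed (\<lambda>x. \<bar>\<Theta>' (\<psi> x)\<bar>) \<gamma> r
              = weighted_speed (\<lambda>x. \<bar>\<Theta> (\<psi> x)\<bar> * G x + \<bar>\<Theta>' (\<psi> x)\<bar> * \<bar>w x\<bar>) \<gamma> r"
              unfolding weighted_speed_def Ur using G0[of "\<gamma> r"]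
              by (simp add: ennreal_plus ennreal_mult distrib_left distrib_right mult_ac)
          qed
        qed
      qed
      from controlledD[OF this, of 0 1] U(2,3) show ?case by simp
    qed
  qed
qed

lemma W12D: "f \<in> W12 m \<Longrightarrow> f \<in> L2 m" "f \<in> W12 m \<Longrightarrow> f \<in> S2 m"
  by (auto simp: W12_def)

lemma W12I:
  fixes m :: "'a::{complete_space, second_countable_topology} measure"
  assumes "sets m = sets borel" "f \<in> L2 m" "weak_upper_gradient m f G"
  shows "f \<in> W12 m"
  using assms L2_borel[OF assms(2,1)] by (auto simp: W12_def S2_def)

lemma W12_mult:
  fixes m :: "'a::{complete_space, second_countable_topology} measure"
  assumes m: "sets m = sets borel" and w: "w \<in> W12 m"
    and lip: "\<And>x y. \<bar>\<psi> x - \<psi> y\<bar> \<le> dist x y" and range: "\<And>x. \<psi> x \<in> {0..R}"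
    and deriv: "\<And>u. (\<Theta> has_real_derivative \<Theta>' u) (at u)" and cont: "continuous_on UNIV \<Theta>'"
  shows "(\<lambda>x. \<Theta> (\<psi> x) * w x) \<in> W12 m"
  using weak_upper_gradient_mult[OF m W12D(1)[OF w] min_weak_upper_gradient(1)[OF m W12D(2)[OF w]] lip range deriv cont]
  by (intro W12I[OF m])

lemma enn2real_cheeger_energy:
  "f \<in> W12 m \<Longrightarrow> enn2real (cheeger_energy m f) = (1/2) * (\<integral>x. (min_weak_upper_gradient m f x)\<^sup>2 \<partial>m)"
  by (simp add: cheeger_energy_def integral_nonneg_AE)

text \<open>The integrated form of \<open>\<nabla>(\<phi> f) \<cdot> \<nabla>f \<ge> - \<alpha>\<^sup>2 \<phi> f\<^sup>2\<close>, obtained from upper bounds on weak gradients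
only, as explained at the beginning of the file. The parameter \<open>\<Theta>\<close> is \<open>u \<mapsto> tanh (\<alpha> * u)\<close>, written with
exponentials to match \<open>\<phi>\<close>.\<close>

lemma dirichlet_form_exp_weight_ge:
  fixes m :: "'a::{complete_space, second_countable_topology} measure"
  assumes m: "sets m = sets borel" and f: "f \<in> W12 m"
    and lip: "\<And>x y. \<bar>\<psi> x - \<psi> y\<bar> \<le> dist x y" and range: "\<And>x. \<psi> x \<in> {0..R}"
  shows "(\<lambda>x. exp (2 * \<alpha> * \<psi> x) * f x) \<in> W12 m"
    and "- (\<alpha>\<^sup>2 * (\<integral>x. exp (2 * \<alpha> * \<psi> x) * (f x)\<^sup>2 \<partial>m)) \<le> dirichlet_form m (\<lambda>x. exp (2 * \<alpha> * \<psi> x) * f x) f"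
proof -
  define \<phi> where "\<phi> x = exp (2 * \<alpha> * \<psi> x)" for x
  have dexp: "((\<lambda>u. exp (2 * \<alpha> * u) + c) has_real_derivative (2 * \<alpha> * exp (2 * \<alpha> * u))) (at u)" for u c
    by (auto intro!: derivative_eq_intros)
  have cexp: "continuous_on UNIV (\<lambda>u. 2 * \<alpha> * exp (2 * \<alpha> * u))" by (intro continuous_intros)
  have W: "(\<lambda>x. (\<phi> x + c) * f x) \<in> W12 m" for c
    unfolding \<phi>_def by (rule W12_mult[OF m f lip range dexp cexp])
  from W[of 0] show \<phi>W: "(\<lambda>x. exp (2 * \<alpha> * \<psi> x) * f x) \<in> W12 m" by (simp add: \<phi>_def)
  define w where "w x = (\<phi> x + 1) * f x" for x
  have wW: "w \<in> W12 m" using W[of 1] by (simp add: w_def[abs_def])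
  define \<Theta> where "\<Theta> u = (exp (2 * \<alpha> * u) - 1) / (exp (2 * \<alpha> * u) + 1)" for u
  define \<Theta>' where "\<Theta>' u = \<alpha> * (1 - (\<Theta> u)\<^sup>2)" for u
  have pos: "exp (2 * \<alpha> * u) + 1 \<noteq> 0" for u by (metis add_pos_pos exp_gt_zero less_irrefl zero_less_one)
  have one_minus: "1 - (\<Theta> u)\<^sup>2 = 4 * exp (2 * \<alpha> * u) / (exp (2 * \<alpha> * u) + 1)\<^sup>2" for u
    using pos[of u] by (simp add: \<Theta>_def power_divide divide_simps) (simp add: power2_eq_square algebra_simps)
  have dT: "(\<Theta> has_real_derivative \<Theta>' u) (at u)" for u
  proof -
    have "(\<Theta> has_real_derivative ((2 * \<alpha> * exp (2 * \<alpha> * u)) * (exp (2 * \<alpha> * u) + 1) - (exp (2 * \<alpha> * u) - 1) * (2 * \<alpha> * exp (2 * \<alpha> * u))) / (exp (2 * \<alpha> * u) + 1)^2) (at u)"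
      unfolding \<Theta>_def power2_eq_square using pos[of u] by (auto intro!: derivative_eq_intros)
    also have "((2 * \<alpha> * exp (2 * \<alpha> * u)) * (exp (2 * \<alpha> * u) + 1) - (exp (2 * \<alpha> * u) - 1) * (2 * \<alpha> * exp (2 * \<alpha> * u))) / (exp (2 * \<alpha> * u) + 1)^2 = \<Theta>' u"
      unfolding \<Theta>'_def one_minus by (simp add: algebra_simps)
    finally show ?thesis .
  qed
  have cT: "continuous_on UNIV \<Theta>" using dT by (auto intro: DERIV_isCont continuous_at_imp_continuous_on)
  have cT': "continuous_on UNIV \<Theta>'" unfolding \<Theta>'_def by (intro continuous_intros cT)
  define A where "A = min_weak_upper_gradient m w"
  have A: "weak_upper_gradient m w A" unfolding A_def by (rule min_weak_upper_gradient(1)[OF m W12D(2)[OF wW]])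
  note prod = weak_upper_gradient_mult[OF m W12D(1)[OF wW] A lip range dT cT']
  define v where "v x = \<Theta> (\<psi> x) * w x" for x
  have v_eq: "v x = (\<phi> x + - 1) * f x" for x
    using pos[of "\<psi> x"] by (simp add: v_def w_def \<Theta>_def \<phi>_def)
  have vW: "v \<in> W12 m" using W[of "-1"] by (simp only: v_eq[abs_def])
  define B where "B = min_weak_upper_gradient m v"
  have B: "weak_upper_gradient m v B" unfolding B_def by (rule min_weak_upper_gradient(1)[OF m W12D(2)[OF vW]])
  define G where "G x = \<bar>\<Theta> (\<psi> x)\<bar> * A x + \<bar>\<Theta>' (\<psi> x)\<bar> * \<bar>w x\<bar>" for x
  have G: "weak_upper_gradient m v G" using prod(1) by (simp add: v_def[abs_def] G_def[abs_def])
  have BG: "AE x in m. B x \<le> G x" unfolding B_def by (rule min_weak_upper_gradient(2)[OF m W12D(2)[OF vW] G])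
  have int: "integrable m (\<lambda>x. (A x)\<^sup>2)" "integrable m (\<lambda>x. (B x)\<^sup>2)" "integrable m (\<lambda>x. (G x)\<^sup>2)"
    using weak_upper_gradientD(1)[OF A] weak_upper_gradientD(1)[OF B] weak_upper_gradientD(1)[OF G] by (auto simp: L2_def)
  have intf: "integrable m (\<lambda>x. \<phi> x * (f x)\<^sup>2)"
  proof -
    have dexp2: "((\<lambda>u. exp (\<alpha> * u)) has_real_derivative (\<alpha> * exp (\<alpha> * u))) (at u)" for u
      by (auto intro!: derivative_eq_intros)
    have "(\<lambda>x. exp (\<alpha> * \<psi> x) * f x) \<in> W12 m"
      by (rule W12_mult[OF m f lip range dexp2]) (intro continuous_intros)
    then have "integrable m (\<lambda>x. (exp (\<alpha> * \<psi> x) * f x)\<^sup>2)" by (auto dest!: W12D(1) simp: L2_def)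
    also have "(\<lambda>x. (exp (\<alpha> * \<psi> x) * f x)\<^sup>2) = (\<lambda>x. \<phi> x * (f x)\<^sup>2)"
      by (simp add: \<phi>_def power_mult_distrib fun_eq_iff exp_double[symmetric] mult.assoc)
    finally show ?thesis .
  qed
  \<comment> \<open>Cauchy--Schwarz with the weights \<open>c\<^sup>2\<close> and \<open>q = 1 - c\<^sup>2\<close>\<close>
  have key: "(G x)\<^sup>2 \<le> (A x)\<^sup>2 + 4 * \<alpha>\<^sup>2 * (\<phi> x * (f x)\<^sup>2)" for x
  proof -
    define c where "c = \<Theta> (\<psi> x)"
    define q where "q = 1 - c\<^sup>2"
    have q: "q = 4 * \<phi> x / (\<phi> x + 1)\<^sup>2" using one_minus[of "\<psi> x"] by (simp add: q_def c_def \<phi>_def)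
    have q0: "q \<ge> 0" unfolding q by (simp add: \<phi>_def)
    have qw: "q * (w x)\<^sup>2 = 4 * (\<phi> x * (f x)\<^sup>2)"
      using pos[of "\<psi> x"] unfolding q w_def by (simp add: \<phi>_def power_mult_distrib)
    have "(G x)\<^sup>2 = (\<bar>c\<bar> * A x + \<bar>\<alpha>\<bar> * q * \<bar>w x\<bar>)\<^sup>2"
      using q0 by (simp add: G_def c_def[symmetric] \<Theta>'_def q_def[symmetric] abs_mult)
    also have "\<dots> = (c\<^sup>2 * (A x)\<^sup>2) + 2 * \<bar>c\<bar> * A x * \<bar>\<alpha>\<bar> * q * \<bar>w x\<bar> + \<alpha>\<^sup>2 * q\<^sup>2 * (w x)\<^sup>2"
      by (simp add: power2_sum power_mult_distrib)
    also have "2 * \<bar>c\<bar> * A x * \<bar>\<alpha>\<bar> * q * \<bar>w x\<bar> \<le> q * ((A x)\<^sup>2 + c\<^sup>2 * \<alpha>\<^sup>2 * (w x)\<^sup>2)"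
    proof -
      have "0 \<le> (A x - \<bar>c\<bar> * \<bar>\<alpha>\<bar> * \<bar>w x\<bar>)\<^sup>2" by simp
      then have "2 * \<bar>c\<bar> * A x * \<bar>\<alpha>\<bar> * \<bar>w x\<bar> \<le> (A x)\<^sup>2 + c\<^sup>2 * \<alpha>\<^sup>2 * (w x)\<^sup>2"
        by (simp add: power2_diff power_mult_distrib mult_ac)
      from mult_left_mono[OF this q0] show ?thesis by (simp add: mult_ac)
    qed
    also have "c\<^sup>2 * (A x)\<^sup>2 + q * ((A x)\<^sup>2 + c\<^sup>2 * \<alpha>\<^sup>2 * (w x)\<^sup>2) + \<alpha>\<^sup>2 * q\<^sup>2 * (w x)\<^sup>2
      = (c\<^sup>2 + q) * (A x)\<^sup>2 + \<alpha>\<^sup>2 * (q * (w x)\<^sup>2) * (c\<^sup>2 + q)" by (simp add: power2_eq_square algebra_simps)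
    also have "\<dots> = (A x)\<^sup>2 + 4 * \<alpha>\<^sup>2 * (\<phi> x * (f x)\<^sup>2)" unfolding qw by (simp add: q_def)
    finally show ?thesis by simp
  qed
  have "(\<integral>x. (B x)\<^sup>2 \<partial>m) \<le> (\<integral>x. (G x)\<^sup>2 \<partial>m)"
    using BG by (intro integral_mono_AE int, eventually_elim) (auto intro!: power_mono weak_upper_gradientD(2)[OF B])
  also have "\<dots> \<le> (\<integral>x. (A x)\<^sup>2 + 4 * \<alpha>\<^sup>2 * (\<phi> x * (f x)\<^sup>2) \<partial>m)"
    using int intf by (intro integral_mono key) auto
  also have "\<dots> = (\<integral>x. (A x)\<^sup>2 \<partial>m) + 4 * \<alpha>\<^sup>2 * (\<integral>x. \<phi> x * (f x)\<^sup>2 \<partial>m)"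
    using int intf by simp
  finally have le: "(\<integral>x. (B x)\<^sup>2 \<partial>m) \<le> (\<integral>x. (A x)\<^sup>2 \<partial>m) + 4 * \<alpha>\<^sup>2 * (\<integral>x. \<phi> x * (f x)\<^sup>2 \<partial>m)" .
  have "(\<lambda>x. \<phi> x * f x + f x) = w" "(\<lambda>x. \<phi> x * f x - f x) = v"
    by (simp_all add: w_def v_eq fun_eq_iff algebra_simps)
  then have "dirichlet_form m (\<lambda>x. \<phi> x * f x) f = ((1/2) * (\<integral>x. (A x)\<^sup>2 \<partial>m) - (1/2) * (\<integral>x. (B x)\<^sup>2 \<partial>m)) / 2"
    by (simp add: dirichlet_form_def enn2real_cheeger_energy wW vW A_def B_def)
  then show "- (\<alpha>\<^sup>2 * (\<integral>x. exp (2 * \<alpha> * \<psi> x) * (f x)\<^sup>2 \<partial>m)) \<le> dirichlet_form m (\<lambda>x. exp (2 * \<alpha> * \<psi> x) * f x) f"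
    using le by (simp add: \<phi>_def)
qed

lemma cheeger_energy_minus: "cheeger_energy m (\<lambda>x. - f x) = cheeger_energy m f"
proof -
  have wug: "weak_upper_gradient m (\<lambda>x. - f x) = weak_upper_gradient m f"
    by (rule ext) (simp add: weak_upper_gradient_def abs_minus_commute)
  have L2: "(\<lambda>x. - f x) \<in> L2 m \<longleftrightarrow> f \<in> L2 m" 
    using measurable_compose[of "\<lambda>x. - f x" m borel "\<lambda>y. - y" borel] by (auto simp: L2_def)
  have "(\<lambda>x. - f x) \<in> borel_measurable borel \<longleftrightarrow> f \<in> borel_measurable borel"
    using measurable_compose[of "\<lambda>x. - f x" borel borel "\<lambda>y. - y" borel] by auto
  then have "(\<lambda>x. - f x) \<in> W12 m \<longleftrightarrow> f \<in> W12 m" using L2 by (simp add: W12_def S2_def wug)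
  moreover have "min_weak_upper_gradient m (\<lambda>x. - f x) = min_weak_upper_gradient m f"
    by (simp add: min_weak_upper_gradient_def wug)
  ultimately show ?thesis by (simp add: cheeger_energy_def)
qed

text \<open>The polarization formula is symmetric because the energy is even.\<close>

lemma dirichlet_form_commute: "dirichlet_form m f g = dirichlet_form m g f"
proof -
  have "cheeger_energy m (\<lambda>x. g x - f x) = cheeger_energy m (\<lambda>x. f x - g x)"
    using cheeger_energy_minus[of m "\<lambda>x. f x - g x"] by simp
  then show ?thesis by (simp add: dirichlet_form_def add.commute)
qed

section \<open>Weighted energy estimates and symmetry of the heat flow\<close>

lemma L2_mult_integrable:
  assumes "f \<in> L2 m" "g \<in> L2 m"
  shows "integrable m (\<lambda>x. f x * g x)"
proof -
  have [measurable]: "f \<in> borel_measurable m" "g \<in> borel_measurable m" using assms by (auto simp: L2_def)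
  have "integrable m (\<lambda>x. (f x)\<^sup>2 + (g x)\<^sup>2)" using assms by (simp add: L2_def)
  then show ?thesis
  proof (rule Bochner_Integration.integrable_bound)
    show "AE x in m. norm (f x * g x) \<le> norm ((f x)\<^sup>2 + (g x)\<^sup>2)"
    proof (rule AE_I2)
      fix x
      have "2 * (\<bar>f x\<bar> * \<bar>g x\<bar>) \<le> (f x)\<^sup>2 + (g x)\<^sup>2" using sum_squares_bound[of "\<bar>f x\<bar>" "\<bar>g x\<bar>"] by simp
      moreover have "0 \<le> \<bar>f x\<bar> * \<bar>g x\<bar>" by simp
      ultimately have "\<bar>f x\<bar> * \<bar>g x\<bar> \<le> (f x)\<^sup>2 + (g x)\<^sup>2" by linarith
      then show "norm (f x * g x) \<le> norm ((f x)\<^sup>2 + (g x)\<^sup>2)" by (simp add: abs_mult)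
    qed
  qed measurable
qed

lemma L2_Cauchy_Schwarz:
  assumes f: "f \<in> L2 m" and g: "g \<in> L2 m"
  shows "\<bar>\<integral>x. f x * g x \<partial>m\<bar> \<le> L2_norm m f * L2_norm m g"
proof -
  define A where "A = (\<integral>x. (f x)\<^sup>2 \<partial>m)"
  define B where "B = (\<integral>x. f x * g x \<partial>m)"
  define C where "C = (\<integral>x. (g x)\<^sup>2 \<partial>m)"
  have int: "integrable m (\<lambda>x. (f x)\<^sup>2)" "integrable m (\<lambda>x. (g x)\<^sup>2)" "integrable m (\<lambda>x. f x * g x)"
    using f g L2_mult_integrable[OF f g] by (auto simp: L2_def)
  have quad: "0 \<le> A + 2 * t * B + t\<^sup>2 * C" for t
  proof -
    have "0 \<le> (\<integral>x. (f x + t * g x)\<^sup>2 \<partial>m)" by (intro integral_nonneg_AE) simp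
    also have "(\<lambda>x. (f x + t * g x)\<^sup>2) = (\<lambda>x. (f x)\<^sup>2 + 2 * t * (f x * g x) + t\<^sup>2 * (g x)\<^sup>2)"
      by (simp add: fun_eq_iff power2_eq_square algebra_simps)
    also have "(\<integral>x. (f x)\<^sup>2 + 2 * t * (f x * g x) + t\<^sup>2 * (g x)\<^sup>2 \<partial>m) = A + 2 * t * B + t\<^sup>2 * C"
      using int by (simp add: A_def B_def C_def)
    finally show ?thesis .
  qed
  have C0: "0 \<le> C" "0 \<le> A" by (simp_all add: C_def A_def)
  have "B\<^sup>2 \<le> A * C"
  proof (cases "C = 0")
    case True
    have "B = 0"
    proof (rule ccontr)
      assume "B \<noteq> 0"
      then have "2 * (- (A + 1) / (2 * B)) * B = - (A + 1)" by simp
      with quad[of "- (A + 1) / (2 * B)"] have "0 \<le> A + - (A + 1)" unfolding True by (simp only: mult_zero_right add_0_right)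
      then show False by simp
    qed
    then show ?thesis using True by simp
  next
    case False
    then have "C > 0" using C0 by simp
    have "0 \<le> A + 2 * (- B / C) * B + (- B / C)\<^sup>2 * C" by (rule quad)
    also have "\<dots> = A - B\<^sup>2 / C" using \<open>C > 0\<close> by (simp add: field_simps power2_eq_square)
    finally show ?thesis using \<open>C > 0\<close> by (simp add: divide_le_eq)
  qed
  then have "sqrt (B\<^sup>2) \<le> sqrt (A * C)" by (rule real_sqrt_le_mono)
  then show ?thesis by (simp add: A_def B_def C_def L2_norm_def real_sqrt_mult)
qed

lemma L2_norm_bounded_mult:
  assumes b: "b \<in> borel_measurable m" and f: "f \<in> L2 m" and C: "\<And>x. \<bar>b x\<bar> \<le> C"
  shows "L2_norm m (\<lambda>x. b x * f x) \<le> C * L2_norm m f"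
proof -
  have C0: "0 \<le> C" using C[of undefined] by linarith
  have "(\<integral>x. (b x * f x)\<^sup>2 \<partial>m) \<le> (\<integral>x. C\<^sup>2 * (f x)\<^sup>2 \<partial>m)"
  proof (rule integral_mono)
    show "integrable m (\<lambda>x. (b x * f x)\<^sup>2)" using L2_bounded_mult[OF b f C] by (simp add: L2_def)
    show "integrable m (\<lambda>x. C\<^sup>2 * (f x)\<^sup>2)" using f by (simp add: L2_def)
    show "(b x * f x)\<^sup>2 \<le> C\<^sup>2 * (f x)\<^sup>2" for x
      unfolding power_mult_distrib using C[of x] power_mono[of "\<bar>b x\<bar>" C 2] by (intro mult_right_mono) auto
  qed
  then have "L2_norm m (\<lambda>x. b x * f x) \<le> sqrt (C\<^sup>2 * (\<integral>x. (f x)\<^sup>2 \<partial>m))"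
    unfolding L2_norm_def by simp
  then show ?thesis using C0 by (simp add: L2_norm_def real_sqrt_mult)
qed

lemma L2_norm_nonneg: "0 \<le> L2_norm m f"
  by (simp add: L2_norm_def)

lemma L2_inner_tendsto:
  assumes aL: "eventually (\<lambda>s. a s \<in> L2 m) F" and bL: "eventually (\<lambda>s. b s \<in> L2 m) F"
    and a0: "a0 \<in> L2 m" and b0: "b0 \<in> L2 m"
    and a: "((\<lambda>s. L2_norm m (\<lambda>x. a s x - a0 x)) \<longlongrightarrow> 0) F"
    and b: "((\<lambda>s. L2_norm m (\<lambda>x. b s x - b0 x)) \<longlongrightarrow> 0) F"
  shows "((\<lambda>s. \<integral>x. a s x * b s x \<partial>m) \<longlongrightarrow> (\<integral>x. a0 x * b0 x \<partial>m)) F"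
proof (rule LIM_zero_cancel, rule Lim_null_comparison)
  let ?a = "\<lambda>s. L2_norm m (\<lambda>x. a s x - a0 x)" and ?b = "\<lambda>s. L2_norm m (\<lambda>x. b s x - b0 x)"
  show "((\<lambda>s. ?a s * ?b s + ?a s * L2_norm m b0 + L2_norm m a0 * ?b s) \<longlongrightarrow> 0) F"
    by (rule tendsto_eq_intros a b refl | simp)+
  show "eventually (\<lambda>s. norm ((\<integral>x. a s x * b s x \<partial>m) - (\<integral>x. a0 x * b0 x \<partial>m))
    \<le> ?a s * ?b s + ?a s * L2_norm m b0 + L2_norm m a0 * ?b s) F"
    using aL bL
  proof eventually_elim
    case (elim s)
    have d: "(\<lambda>x. a s x - a0 x) \<in> L2 m" "(\<lambda>x. b s x - b0 x) \<in> L2 m" using elim a0 b0 by (auto intro: L2_diff)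
    note i = L2_mult_integrable[OF d] L2_mult_integrable[OF d(1) b0] L2_mult_integrable[OF a0 d(2)] L2_mult_integrable[OF a0 b0]
    have "(\<lambda>x. a s x * b s x) = (\<lambda>x. (a s x - a0 x) * (b s x - b0 x) + (a s x - a0 x) * b0 x + a0 x * (b s x - b0 x) + a0 x * b0 x)"
      by (simp add: fun_eq_iff algebra_simps)
    then have "(\<integral>x. a s x * b s x \<partial>m) = (\<integral>x. (a s x - a0 x) * (b s x - b0 x) \<partial>m) + (\<integral>x. (a s x - a0 x) * b0 x \<partial>m)
       + (\<integral>x. a0 x * (b s x - b0 x) \<partial>m) + (\<integral>x. a0 x * b0 x \<partial>m)"
      using i by simp
    then show ?case
      using L2_Cauchy_Schwarz[OF d] L2_Cauchy_Schwarz[OF d(1) b0] L2_Cauchy_Schwarz[OF a0 d(2)] by simp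
  qed
qed

lemma L2_norm_zero [simp]: "L2_norm m (\<lambda>x. 0) = 0"
  by (simp add: L2_norm_def)

text \<open>The product rule for curves in \<open>L\<^sup>2\<close>. It is formulated with difference quotients that converge in norm
because the heat flow is specified in this way.\<close>

lemma L2_inner_has_derivative:
  fixes u v :: "real \<Rightarrow> 'a \<Rightarrow> real"
  assumes uL: "eventually (\<lambda>s. u (t + s) \<in> L2 m) (at 0)" and vL: "eventually (\<lambda>s. v (t + s) \<in> L2 m) (at 0)"
    and L: "u t \<in> L2 m" "v t \<in> L2 m" "u' \<in> L2 m" "v' \<in> L2 m"
    and u: "((\<lambda>s. L2_norm m (\<lambda>x. (u (t + s) x - u t x) / s - u' x)) \<longlongrightarrow> 0) (at 0)"
    and v: "((\<lambda>s. L2_norm m (\<lambda>x. (v (t + s) x - v t x) / s - v' x)) \<longlongrightarrow> 0) (at 0)"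
  shows "((\<lambda>s. \<integral>x. u s x * v s x \<partial>m) has_real_derivative ((\<integral>x. u' x * v t x \<partial>m) + (\<integral>x. u t x * v' x \<partial>m))) (at t)"
proof -
  define Du where "Du s x = (u (t + s) x - u t x) / s" for s x
  define Dv where "Dv s x = (v (t + s) x - v t x) / s" for s x
  have DuL: "eventually (\<lambda>s. Du s \<in> L2 m) (at 0)"
    using uL
  proof eventually_elim
    case (elim s)
    from L2_cmult[OF L2_diff[OF elim L(1)], of "1 / s"] show ?case by (simp add: Du_def[abs_def])
  qed
  have DvL: "eventually (\<lambda>s. Dv s \<in> L2 m) (at 0)"
    using vL
  proof eventually_elim
    case (elim s)
    from L2_cmult[OF L2_diff[OF elim L(2)], of "1 / s"] show ?case by (simp add: Dv_def[abs_def])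
  qed
  have "((\<lambda>s. (\<integral>x. Du s x * v t x \<partial>m) + s * (\<integral>x. Du s x * Dv s x \<partial>m) + (\<integral>x. u t x * Dv s x \<partial>m))
      \<longlongrightarrow> (\<integral>x. u' x * v t x \<partial>m) + 0 * (\<integral>x. u' x * v' x \<partial>m) + (\<integral>x. u t x * v' x \<partial>m)) (at 0)"
    using u v L DuL DvL
    by (intro tendsto_intros L2_inner_tendsto) (auto simp: Du_def[abs_def] Dv_def[abs_def])
  then have lim: "((\<lambda>s. (\<integral>x. Du s x * v t x \<partial>m) + s * (\<integral>x. Du s x * Dv s x \<partial>m) + (\<integral>x. u t x * Dv s x \<partial>m))
      \<longlongrightarrow> (\<integral>x. u' x * v t x \<partial>m) + (\<integral>x. u t x * v' x \<partial>m)) (at 0)" by simp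
  have ev: "eventually (\<lambda>s. (\<integral>x. Du s x * v t x \<partial>m) + s * (\<integral>x. Du s x * Dv s x \<partial>m) + (\<integral>x. u t x * Dv s x \<partial>m)
     = ((\<integral>x. u (t + s) x * v (t + s) x \<partial>m) - (\<integral>x. u t x * v t x \<partial>m)) / s) (at 0)"
    using uL vL DuL DvL eventually_neq_at_within[of 0 0 UNIV]
  proof eventually_elim
    case (elim s)
    have pt: "u (t + s) x * v (t + s) x = s * (Du s x * v t x) + s * s * (Du s x * Dv s x) + s * (u t x * Dv s x) + u t x * v t x" for x
    proof -
      have "u (t + s) x = u t x + s * Du s x" "v (t + s) x = v t x + s * Dv s x"
        using elim by (auto simp: Du_def Dv_def)
      then show ?thesis by (simp add: algebra_simps)
    qed
    have "(\<integral>x. u (t + s) x * v (t + s) x \<partial>m) = s * (\<integral>x. Du s x * v t x \<partial>m) + s * s * (\<integral>x. Du s x * Dv s x \<partial>m)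
      + s * (\<integral>x. u t x * Dv s x \<partial>m) + (\<integral>x. u t x * v t x \<partial>m)"
      unfolding pt using L2_mult_integrable[OF elim(3) L(2)] L2_mult_integrable[OF elim(3,4)] L2_mult_integrable[OF L(1) elim(4)]
        L2_mult_integrable[OF L(1,2)] by simp
    then show ?case using elim by (simp add: field_simps)
  qed
  show ?thesis
    unfolding DERIV_def using lim ev by (rule Lim_transform_eventually)
qed

context
  fixes m :: "'a::{complete_space, second_countable_topology} measure"
    and h :: "real \<Rightarrow> ('a \<Rightarrow> real) \<Rightarrow> 'a \<Rightarrow> real"
  assumes m: "sets m = sets borel" and heat: "heat_flow m h"
begin

lemma heat_flow_laplacian:
  assumes "f \<in> L2 m" "t > 0"
  obtains g where "has_laplacian m (h t f) g"
    "((\<lambda>s. L2_norm m (\<lambda>x. (h (t + s) f x - h t f x) / s - g x)) \<longlongrightarrow> 0) (at 0)"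
  using heat assms unfolding heat_flow_def by blast

lemma heat_flow_W12: "f \<in> L2 m \<Longrightarrow> t > 0 \<Longrightarrow> h t f \<in> W12 m"
  by (erule (1) heat_flow_laplacian) (simp add: has_laplacian_def)

lemma heat_flow_L2: "f \<in> L2 m \<Longrightarrow> t > 0 \<Longrightarrow> h t f \<in> L2 m"
  using heat_flow_W12 W12D(1) by blast

lemma heat_flow_initial:
  "f \<in> L2 m \<Longrightarrow> ((\<lambda>t. L2_norm m (\<lambda>x. h t f x - f x)) \<longlongrightarrow> 0) (at_right 0)"
  using heat unfolding heat_flow_def by blast

lemma eventually_heat_flow_L2:
  assumes "f \<in> L2 m" "t > 0"
  shows "eventually (\<lambda>s. h (t + s) f \<in> L2 m) (at 0)"
proof -
  have "eventually (\<lambda>s::real. s > - t) (at 0)" using assms by (intro eventually_at_in_open'[of "{-t<..}", simplified]) auto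
  then show ?thesis by eventually_elim (use assms in \<open>auto intro: heat_flow_L2\<close>)
qed

text \<open>Davies' estimate: the function \<open>F s * exp (- 2 * \<alpha>\<^sup>2 * s)\<close> is nonincreasing for \<open>s > 0\<close>, and the value at
\<open>0\<close> is reached as a limit.\<close>

lemma heat_flow_exp_weight_L2_bound:
  assumes f: "f \<in> L2 m" and t: "t > 0"
    and lip: "\<And>x y. \<bar>\<psi> x - \<psi> y\<bar> \<le> dist x y" and range: "\<And>x. \<psi> x \<in> {0..R}"
  shows "(\<integral>x. exp (2 * \<alpha> * \<psi> x) * (h t f x)\<^sup>2 \<partial>m) \<le> exp (2 * \<alpha>\<^sup>2 * t) * (\<integral>x. exp (2 * \<alpha> * \<psi> x) * (f x)\<^sup>2 \<partial>m)"
proof -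
  define \<phi> where "\<phi> x = exp (2 * \<alpha> * \<psi> x)" for x
  define C where "C = exp (2 * \<bar>\<alpha>\<bar> * R)"
  have \<phi>C: "\<bar>\<phi> x\<bar> \<le> C" for x
  proof -
    have "\<alpha> * \<psi> x \<le> \<bar>\<alpha>\<bar> * R" using range[of x] by (intro mult_mono) auto
    then show ?thesis by (simp add: \<phi>_def C_def)
  qed
  have contpsi: "continuous_on UNIV \<psi>"
    unfolding continuous_on_iff using lip by (metis dist_real_def le_less_trans)
  have "\<phi> \<in> borel_measurable borel" unfolding \<phi>_def
    by (intro borel_measurable_continuous_onI continuous_intros contpsi)
  then have \<phi>m: "\<phi> \<in> borel_measurable m" using measurable_cong_sets[OF m refl] by blast
  have \<phi>L: "(\<lambda>x. \<phi> x * k x) \<in> L2 m" if "k \<in> L2 m" for k by (rule L2_bounded_mult[OF \<phi>m that \<phi>C])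
  define F where "F s = (\<integral>x. (\<phi> x * h s f x) * h s f x \<partial>m)" for s
  have dF: "\<exists>D. (F has_real_derivative D) (at s) \<and> D \<le> 2 * \<alpha>\<^sup>2 * F s" if s: "s > 0" for s
  proof -
    obtain g where g: "has_laplacian m (h s f) g"
      "((\<lambda>\<sigma>. L2_norm m (\<lambda>x. (h (s + \<sigma>) f x - h s f x) / \<sigma> - g x)) \<longlongrightarrow> 0) (at 0)"
      using heat_flow_laplacian[OF f s] by blast
    have gL: "g \<in> L2 m" and gE: "\<And>k. k \<in> W12 m \<Longrightarrow> (\<integral>x. k x * g x \<partial>m) = - dirichlet_form m k (h s f)"
      using g(1) by (auto simp: has_laplacian_def)
    have hs: "h s f \<in> L2 m" by (rule heat_flow_L2[OF f s])
    have lim\<phi>: "((\<lambda>\<sigma>. L2_norm m (\<lambda>x. (\<phi> x * h (s + \<sigma>) f x - \<phi> x * h s f x) / \<sigma> - \<phi> x * g x)) \<longlongrightarrow> 0) (at 0)"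
    proof (rule Lim_null_comparison)
      show "((\<lambda>\<sigma>. C * L2_norm m (\<lambda>x. (h (s + \<sigma>) f x - h s f x) / \<sigma> - g x)) \<longlongrightarrow> 0) (at 0)"
        using tendsto_mult_right_zero[OF g(2), of C] .
      show "eventually (\<lambda>\<sigma>. norm (L2_norm m (\<lambda>x. (\<phi> x * h (s + \<sigma>) f x - \<phi> x * h s f x) / \<sigma> - \<phi> x * g x))
        \<le> C * L2_norm m (\<lambda>x. (h (s + \<sigma>) f x - h s f x) / \<sigma> - g x)) (at 0)"
        using eventually_heat_flow_L2[OF f s]
      proof eventually_elim
        case (elim \<sigma>)
        have "(\<lambda>x. (h (s + \<sigma>) f x - h s f x) / \<sigma> - g x) \<in> L2 m"
          using L2_diff[OF L2_cmult[OF L2_diff[OF elim hs], of "1/\<sigma>"] gL] by simp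
        from L2_norm_bounded_mult[OF \<phi>m this \<phi>C]
        show ?case by (simp add: L2_norm_nonneg algebra_simps diff_divide_distrib)
      qed
    qed
    have "(F has_real_derivative ((\<integral>x. (\<phi> x * g x) * h s f x \<partial>m) + (\<integral>x. (\<phi> x * h s f x) * g x \<partial>m))) (at s)"
      unfolding F_def
      by (rule L2_inner_has_derivative[where u = "\<lambda>s x. \<phi> x * h s f x" and v = "\<lambda>s. h s f"])
         (use eventually_heat_flow_L2[OF f s] hs gL g(2) lim\<phi> in \<open>auto intro: \<phi>L elim: eventually_mono\<close>)
    moreover have "(\<integral>x. (\<phi> x * g x) * h s f x \<partial>m) + (\<integral>x. (\<phi> x * h s f x) * g x \<partial>m) = 2 * (\<integral>x. (\<phi> x * h s f x) * g x \<partial>m)"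
      by (simp add: mult_ac)
    moreover have "2 * (\<integral>x. (\<phi> x * h s f x) * g x \<partial>m) \<le> 2 * \<alpha>\<^sup>2 * F s"
    proof -
      note d = dirichlet_form_exp_weight_ge[OF m heat_flow_W12[OF f s] lip range, of \<alpha>]
      have "(\<integral>x. (\<phi> x * h s f x) * g x \<partial>m) = - dirichlet_form m (\<lambda>x. \<phi> x * h s f x) (h s f)"
        using gE d(1) by (simp add: \<phi>_def)
      also have "\<dots> \<le> \<alpha>\<^sup>2 * F s"
        using d(2) by (simp add: \<phi>_def F_def power2_eq_square mult_ac)
      finally show ?thesis by simp
    qed
    ultimately show ?thesis by auto
  qed
  define P where "P s = F s * exp (- (2 * \<alpha>\<^sup>2 * s))" for s
  have mono: "P t \<le> P s" if "0 < s" "s \<le> t" for s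
  proof (rule DERIV_nonpos_imp_nonincreasing[OF that(2)])
    fix q assume "s \<le> q" "q \<le> t"
    then have "q > 0" using that by simp
    then obtain D where D: "(F has_real_derivative D) (at q)" "D \<le> 2 * \<alpha>\<^sup>2 * F q" using dF by blast
    have "(P has_real_derivative (D * exp (- (2 * \<alpha>\<^sup>2 * q)) + F q * (exp (- (2 * \<alpha>\<^sup>2 * q)) * (- (2 * \<alpha>\<^sup>2))))) (at q)"
      unfolding P_def by (rule derivative_eq_intros D(1) refl | simp)+
    moreover have "D * exp (- (2 * \<alpha>\<^sup>2 * q)) + F q * (exp (- (2 * \<alpha>\<^sup>2 * q)) * (- (2 * \<alpha>\<^sup>2))) = (D - 2 * \<alpha>\<^sup>2 * F q) * exp (- (2 * \<alpha>\<^sup>2 * q))"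
      by (simp add: algebra_simps)
    moreover have "(D - 2 * \<alpha>\<^sup>2 * F q) * exp (- (2 * \<alpha>\<^sup>2 * q)) \<le> 0" using D(2) by (simp add: mult_le_0_iff)
    ultimately show "\<exists>y. (P has_real_derivative y) (at q) \<and> y \<le> 0" by auto
  qed
  have ev: "eventually (\<lambda>s::real. 0 < s \<and> s \<le> t) (at_right 0)"
    using t by (intro eventually_conj eventually_at_right_less) (auto simp: eventually_at_right_field intro: exI[of _ t])
  have evL: "eventually (\<lambda>s. h s f \<in> L2 m) (at_right 0)" using ev by eventually_elim (auto intro: heat_flow_L2 f)
  have "(F \<longlongrightarrow> (\<integral>x. (\<phi> x * f x) * f x \<partial>m)) (at_right 0)"
    unfolding F_def
  proof (rule L2_inner_tendsto)
    show "eventually (\<lambda>s. (\<lambda>x. \<phi> x * h s f x) \<in> L2 m) (at_right 0)" using evL by eventually_elim (rule \<phi>L)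
    show "((\<lambda>s. L2_norm m (\<lambda>x. \<phi> x * h s f x - \<phi> x * f x)) \<longlongrightarrow> 0) (at_right 0)"
    proof (rule Lim_null_comparison)
      show "((\<lambda>s. C * L2_norm m (\<lambda>x. h s f x - f x)) \<longlongrightarrow> 0) (at_right 0)"
        using tendsto_mult_right_zero[OF heat_flow_initial[OF f], of C] .
      show "eventually (\<lambda>s. norm (L2_norm m (\<lambda>x. \<phi> x * h s f x - \<phi> x * f x)) \<le> C * L2_norm m (\<lambda>x. h s f x - f x)) (at_right 0)"
        using evL
      proof eventually_elim
        case (elim s)
        from L2_norm_bounded_mult[OF \<phi>m L2_diff[OF elim f] \<phi>C] show ?case
          by (simp add: L2_norm_nonneg algebra_simps)
      qed
    qed
  qed (use evL f \<phi>L heat_flow_initial[OF f] in auto)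
  then have "(P \<longlongrightarrow> (\<integral>x. (\<phi> x * f x) * f x \<partial>m) * exp (- (2 * \<alpha>\<^sup>2 * 0))) (at_right 0)"
    unfolding P_def by (intro tendsto_intros)
  then have "P t \<le> (\<integral>x. (\<phi> x * f x) * f x \<partial>m) * exp (- (2 * \<alpha>\<^sup>2 * 0))"
    by (rule tendsto_lowerbound) (use ev mono in \<open>auto elim: eventually_mono\<close>)
  then have "P t * exp (2 * \<alpha>\<^sup>2 * t) \<le> (\<integral>x. (\<phi> x * f x) * f x \<partial>m) * exp (2 * \<alpha>\<^sup>2 * t)"
    by (intro mult_right_mono) auto
  moreover have "P t * exp (2 * \<alpha>\<^sup>2 * t) = F t" by (simp add: P_def mult.assoc flip: exp_add)
  ultimately have "F t \<le> (\<integral>x. (\<phi> x * f x) * f x \<partial>m) * exp (2 * \<alpha>\<^sup>2 * t)" by simp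
  then show ?thesis unfolding F_def \<phi>_def power2_eq_square by (simp only: mult_ac)
qed

lemma heat_flow_L2_continuous:
  assumes f: "f \<in> L2 m" and t: "t > 0"
  shows "((\<lambda>s. L2_norm m (\<lambda>x. h (t + s) f x - h t f x)) \<longlongrightarrow> 0) (at 0)"
proof -
  obtain g where g: "has_laplacian m (h t f) g"
    "((\<lambda>\<sigma>. L2_norm m (\<lambda>x. (h (t + \<sigma>) f x - h t f x) / \<sigma> - g x)) \<longlongrightarrow> 0) (at 0)"
    using heat_flow_laplacian[OF f t] by blast
  have gL: "g \<in> L2 m" using g(1) by (auto simp: has_laplacian_def)
  have hs: "h t f \<in> L2 m" by (rule heat_flow_L2[OF f t])
  have DL: "eventually (\<lambda>\<sigma>. (\<lambda>x. (h (t + \<sigma>) f x - h t f x) / \<sigma>) \<in> L2 m) (at 0)"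
    using eventually_heat_flow_L2[OF f t]
  proof eventually_elim
    case (elim s)
    from L2_cmult[OF L2_diff[OF elim hs], of "1 / s"] show ?case by simp
  qed
  have "((\<lambda>\<sigma>. \<integral>x. (h (t + \<sigma>) f x - h t f x) / \<sigma> * ((h (t + \<sigma>) f x - h t f x) / \<sigma>) \<partial>m) \<longlongrightarrow> (\<integral>x. g x * g x \<partial>m)) (at 0)"
    by (rule L2_inner_tendsto[OF DL DL gL gL g(2) g(2)])
  then have "((\<lambda>\<sigma>. sqrt (\<sigma>\<^sup>2 * (\<integral>x. (h (t + \<sigma>) f x - h t f x) / \<sigma> * ((h (t + \<sigma>) f x - h t f x) / \<sigma>) \<partial>m))) \<longlongrightarrow> sqrt (0\<^sup>2 * (\<integral>x. g x * g x \<partial>m))) (at 0)"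
    by (intro tendsto_intros)
  then have "((\<lambda>\<sigma>. sqrt (\<sigma>\<^sup>2 * (\<integral>x. (h (t + \<sigma>) f x - h t f x) / \<sigma> * ((h (t + \<sigma>) f x - h t f x) / \<sigma>) \<partial>m))) \<longlongrightarrow> 0) (at 0)" by simp
  then show ?thesis
  proof (rule Lim_transform_eventually)
    show "eventually (\<lambda>\<sigma>. sqrt (\<sigma>\<^sup>2 * (\<integral>x. (h (t + \<sigma>) f x - h t f x) / \<sigma> * ((h (t + \<sigma>) f x - h t f x) / \<sigma>) \<partial>m)) =
      L2_norm m (\<lambda>x. h (t + \<sigma>) f x - h t f x)) (at 0)"
      using eventually_neq_at_within[of 0 0 UNIV]
    proof eventually_elim
      case (elim \<sigma>)
      have "\<sigma>\<^sup>2 * (\<integral>x. (h (t + \<sigma>) f x - h t f x) / \<sigma> * ((h (t + \<sigma>) f x - h t f x) / \<sigma>) \<partial>m)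
        = (\<integral>x. \<sigma>\<^sup>2 * ((h (t + \<sigma>) f x - h t f x) / \<sigma> * ((h (t + \<sigma>) f x - h t f x) / \<sigma>)) \<partial>m)" by simp
      also have "\<dots> = (\<integral>x. (h (t + \<sigma>) f x - h t f x)\<^sup>2 \<partial>m)"
        using elim by (simp add: power2_eq_square)
      finally show ?case by (simp add: L2_norm_def)
    qed
  qed
qed

text \<open>The product of \<open>h\<^sub>s f\<close> and \<open>h\<^sub>T\<^sub>-\<^sub>s g\<close> has derivative \<open>- \<E>(h\<^sub>T\<^sub>-\<^sub>s g, h\<^sub>s f) + \<E>(h\<^sub>s f, h\<^sub>T\<^sub>-\<^sub>s g) = 0\<close> for \<open>0 < s < T\<close>.
Comparing \<open>s \<rightarrow> 0\<close> with the midpoint \<open>T / 2\<close>, where \<open>f\<close> and \<open>g\<close> play the same role, gives the symmetry of \<open>h\<^sub>T\<close>.\<close>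

lemma heat_flow_inner_half:
  assumes f: "f \<in> L2 m" and g: "g \<in> L2 m" and T: "T > 0"
  shows "(\<integral>x. f x * h T g x \<partial>m) = (\<integral>x. h (T/2) f x * h (T/2) g x \<partial>m)"
proof -
  define P where "P s = (\<integral>x. h s f x * h (T - s) g x \<partial>m)" for s
  have dP: "(P has_real_derivative 0) (at s)" if s: "0 < s" "s < T" for s
  proof -
    have s': "T - s > 0" using s by simp
    obtain k where k: "has_laplacian m (h s f) k"
      "((\<lambda>\<sigma>. L2_norm m (\<lambda>x. (h (s + \<sigma>) f x - h s f x) / \<sigma> - k x)) \<longlongrightarrow> 0) (at 0)"
      using heat_flow_laplacian[OF f s(1)] by blast
    obtain l where l: "has_laplacian m (h (T - s) g) l"
      "((\<lambda>\<sigma>. L2_norm m (\<lambda>x. (h (T - s + \<sigma>) g x - h (T - s) g x) / \<sigma> - l x)) \<longlongrightarrow> 0) (at 0)"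
      using heat_flow_laplacian[OF g s'] by blast
    have kl: "k \<in> L2 m" "l \<in> L2 m" using k(1) l(1) by (auto simp: has_laplacian_def)
    have neg: "filterlim (\<lambda>\<sigma>::real. - \<sigma>) (at 0) (at 0)"
      unfolding filterlim_at by (auto intro!: tendsto_eq_intros simp: eventually_at_filter)
    have "((\<lambda>\<sigma>. L2_norm m (\<lambda>x. (h (T - s + - \<sigma>) g x - h (T - s) g x) / (- \<sigma>) - l x)) \<longlongrightarrow> 0) (at 0)"
      using filterlim_compose[OF l(2) neg] .
    also have "(\<lambda>\<sigma>. L2_norm m (\<lambda>x. (h (T - s + - \<sigma>) g x - h (T - s) g x) / (- \<sigma>) - l x))
      = (\<lambda>\<sigma>. L2_norm m (\<lambda>x. (h (T - (s + \<sigma>)) g x - h (T - s) g x) / \<sigma> - - l x))"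
    proof
      fix \<sigma>
      have "((h (T - s + - \<sigma>) g x - h (T - s) g x) / (- \<sigma>) - l x)\<^sup>2 = ((h (T - (s + \<sigma>)) g x - h (T - s) g x) / \<sigma> - - l x)\<^sup>2" for x
      proof -
        have "T - s + - \<sigma> = T - (s + \<sigma>)" by simp
        then have eq: "h (T - s + - \<sigma>) g x = h (T - (s + \<sigma>)) g x" by (rule arg_cong[where f = "\<lambda>q. h q g x"])
        have "(h (T - s + - \<sigma>) g x - h (T - s) g x) / (- \<sigma>) - l x = - ((h (T - (s + \<sigma>)) g x - h (T - s) g x) / \<sigma> - - l x)"
          unfolding eq by simp
        then show ?thesis by (metis power2_minus)
      qed
      then show "L2_norm m (\<lambda>x. (h (T - s + - \<sigma>) g x - h (T - s) g x) / (- \<sigma>) - l x) = L2_norm m (\<lambda>x. (h (T - (s + \<sigma>)) g x - h (T - s) g x) / \<sigma> - - l x)"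
        unfolding L2_norm_def by simp
    qed
    finally have l': "((\<lambda>\<sigma>. L2_norm m (\<lambda>x. (h (T - (s + \<sigma>)) g x - h (T - s) g x) / \<sigma> - - l x)) \<longlongrightarrow> 0) (at 0)" .
    have evg: "eventually (\<lambda>\<sigma>. h (T - (s + \<sigma>)) g \<in> L2 m) (at 0)"
    proof -
      have "eventually (\<lambda>\<sigma>::real. \<sigma> < T - s) (at 0)" using s' by (intro eventually_at_in_open'[of "{..<T-s}", simplified]) auto
      then show ?thesis by eventually_elim (auto intro!: heat_flow_L2 g)
    qed
    have "(P has_real_derivative ((\<integral>x. k x * h (T - s) g x \<partial>m) + (\<integral>x. h s f x * - l x \<partial>m))) (at s)"
      unfolding P_def
      by (rule L2_inner_has_derivative[where u = "\<lambda>s. h s f" and v = "\<lambda>s. h (T - s) g"])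
         (use eventually_heat_flow_L2[OF f s(1)] evg k(2) l' kl heat_flow_L2[OF f s(1)] heat_flow_L2[OF g s'] L2_cmult[OF kl(2), of "-1"] in auto)
    moreover have "(\<integral>x. h (T - s) g x * k x \<partial>m) = - dirichlet_form m (h (T - s) g) (h s f)"
      using k(1) heat_flow_W12[OF g s'] by (simp add: has_laplacian_def)
    then have "(\<integral>x. k x * h (T - s) g x \<partial>m) = - dirichlet_form m (h (T - s) g) (h s f)"
      by (simp add: mult.commute)
    moreover have "(\<integral>x. h s f x * l x \<partial>m) = - dirichlet_form m (h s f) (h (T - s) g)"
      using l(1) heat_flow_W12[OF f s(1)] by (simp add: has_laplacian_def)
    ultimately show ?thesis using dirichlet_form_commute[of m "h s f" "h (T - s) g"] by simp
  qed
  have "\<exists>c. \<forall>s\<in>{0<..<T}. P s = c"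
  proof (rule has_derivative_zero_constant)
    fix s assume "s \<in> {0<..<T}"
    then have "(P has_real_derivative 0) (at s)" by (intro dP) auto
    then have "(P has_derivative ((*) 0)) (at s within {0<..<T})"
      unfolding has_field_derivative_def by (rule has_derivative_at_withinI)
    moreover have "(*) (0::real) = (\<lambda>h. 0)" by (simp add: fun_eq_iff)
    ultimately show "(P has_derivative (\<lambda>h. 0)) (at s within {0<..<T})" by (simp only:)
  qed (rule convex_real_interval)
  then have const: "P s = P (T/2)" if "0 < s" "s < T" for s using that T by force
  have ev: "eventually (\<lambda>s::real. 0 < s \<and> s < T) (at_right 0)"
    using T by (intro eventually_conj eventually_at_right_less) (auto simp: eventually_at_right_field intro: exI[of _ T])
  have "(P \<longlongrightarrow> (\<integral>x. f x * h T g x \<partial>m)) (at_right 0)"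
    unfolding P_def
  proof (rule L2_inner_tendsto)
    show "eventually (\<lambda>s. h s f \<in> L2 m) (at_right 0)" "eventually (\<lambda>s. h (T - s) g \<in> L2 m) (at_right 0)"
      using ev by (eventually_elim, auto intro!: heat_flow_L2 f g)+
    have neg: "filterlim (\<lambda>\<sigma>::real. - \<sigma>) (at 0) (at_right 0)"
      unfolding filterlim_at by (auto intro!: tendsto_eq_intros simp: eventually_at_filter)
    show "((\<lambda>s. L2_norm m (\<lambda>x. h (T - s) g x - h T g x)) \<longlongrightarrow> 0) (at_right 0)"
      using filterlim_compose[OF heat_flow_L2_continuous[OF g T] neg] by simp
  qed (rule f heat_flow_L2[OF g T] heat_flow_initial[OF f])+
  moreover have "(P \<longlongrightarrow> P (T/2)) (at_right 0)"
  proof (rule tendsto_eventually)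
    show "eventually (\<lambda>s. P s = P (T/2)) (at_right 0)"
      using ev by eventually_elim (rule const, auto)
  qed
  ultimately have "(\<integral>x. f x * h T g x \<partial>m) = P (T/2)"
    by (rule tendsto_unique[rotated]) simp
  then show ?thesis by (simp add: P_def)
qed

lemma heat_flow_symmetric:
  assumes "f \<in> L2 m" "g \<in> L2 m" "T > 0"
  shows "(\<integral>x. f x * h T g x \<partial>m) = (\<integral>x. h T f x * g x \<partial>m)"
  using heat_flow_inner_half[OF assms] heat_flow_inner_half[OF assms(2,1,3)] by (simp add: mult.commute)

end

section \<open>Hoelder's inequality and the Harnack exponent\<close>

lemma integral_powr_Hoelder:
  fixes f g :: "'a \<Rightarrow> real"
  assumes f: "integrable M f" "\<And>x. 0 \<le> f x" and g: "integrable M g" "\<And>x. 0 \<le> g x"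
    and ab: "0 < \<alpha>" "0 < \<beta>" "\<alpha> + \<beta> = 1"
  shows "integrable M (\<lambda>x. f x powr \<alpha> * g x powr \<beta>)"
    and "(\<integral>x. f x powr \<alpha> * g x powr \<beta> \<partial>M) \<le> (\<integral>x. f x \<partial>M) powr \<alpha> * (\<integral>x. g x \<partial>M) powr \<beta>"
proof -
  have [measurable]: "f \<in> borel_measurable M" "g \<in> borel_measurable M" using f g by auto
  have young: "a powr \<alpha> * b powr \<beta> \<le> \<alpha> * a + \<beta> * b" if "0 \<le> a" "0 \<le> b" for a b :: real
  proof (cases "a = 0 \<or> b = 0")
    case True
    then show ?thesis using that ab by auto
  next
    case False
    then show ?thesis using Youngs_inequality_0[of \<alpha> \<beta> a b] that ab by simp
  qed
  show int: "integrable M (\<lambda>x. f x powr \<alpha> * g x powr \<beta>)"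
  proof (rule Bochner_Integration.integrable_bound)
    show "integrable M (\<lambda>x. \<alpha> * f x + \<beta> * g x)" using f g by simp
    show "AE x in M. norm (f x powr \<alpha> * g x powr \<beta>) \<le> norm (\<alpha> * f x + \<beta> * g x)"
    proof (rule AE_I2)
      fix x
      have "0 \<le> \<alpha> * f x + \<beta> * g x" using f(2)[of x] g(2)[of x] ab by simp
      then show "norm (f x powr \<alpha> * g x powr \<beta>) \<le> norm (\<alpha> * f x + \<beta> * g x)"
        using young[OF f(2) g(2), of x x] by simp
    qed
  qed measurable
  define A where "A = (\<integral>x. f x \<partial>M)"
  define B where "B = (\<integral>x. g x \<partial>M)"
  have AB: "0 \<le> A" "0 \<le> B" using f g by (auto simp: A_def B_def)
  have "(\<integral>x. f x powr \<alpha> * g x powr \<beta> \<partial>M) \<le> A powr \<alpha> * B powr \<beta>"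
  proof (cases "A = 0 \<or> B = 0")
    case True
    have "AE x in M. f x powr \<alpha> * g x powr \<beta> = 0"
    proof (cases "A = 0")
      case True
      then have "AE x in M. f x = 0" using f by (simp add: A_def integral_nonneg_eq_0_iff_AE)
      then show ?thesis by eventually_elim (use ab in simp)
    next
      case False
      then have "AE x in M. g x = 0" using g \<open>A = 0 \<or> B = 0\<close> by (simp add: B_def integral_nonneg_eq_0_iff_AE)
      then show ?thesis by eventually_elim (use ab in simp)
    qed
    then have "(\<integral>x. f x powr \<alpha> * g x powr \<beta> \<partial>M) = (\<integral>x. 0 \<partial>M)" by (intro integral_cong_AE) auto
    then show ?thesis by simp
  next
    case False
    then have pos: "A > 0" "B > 0" using AB by auto
    have "(\<integral>x. f x powr \<alpha> * g x powr \<beta> \<partial>M) \<le> (\<integral>x. A powr \<alpha> * B powr \<beta> * (\<alpha> * (f x / A) + \<beta> * (g x / B)) \<partial>M)"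
    proof (rule integral_mono[OF int])
      show "integrable M (\<lambda>x. A powr \<alpha> * B powr \<beta> * (\<alpha> * (f x / A) + \<beta> * (g x / B)))" using f g by simp
      fix x
      have "(f x / A) powr \<alpha> * (g x / B) powr \<beta> \<le> \<alpha> * (f x / A) + \<beta> * (g x / B)"
        using f(2)[of x] g(2)[of x] pos by (intro young) auto
      then have "A powr \<alpha> * B powr \<beta> * ((f x / A) powr \<alpha> * (g x / B) powr \<beta>) \<le> A powr \<alpha> * B powr \<beta> * (\<alpha> * (f x / A) + \<beta> * (g x / B))"
        by (intro mult_left_mono) auto
      moreover have "A powr \<alpha> * B powr \<beta> * ((f x / A) powr \<alpha> * (g x / B) powr \<beta>) = f x powr \<alpha> * g x powr \<beta>"
        using f(2)[of x] g(2)[of x] pos by (simp add: powr_divide)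
      ultimately show "f x powr \<alpha> * g x powr \<beta> \<le> A powr \<alpha> * B powr \<beta> * (\<alpha> * (f x / A) + \<beta> * (g x / B))" by simp
    qed
    also have "\<dots> = A powr \<alpha> * B powr \<beta> * (\<alpha> * (A / A) + \<beta> * (B / B))"
      using f(1) g(1) by (simp add: A_def B_def)
    also have "\<dots> = A powr \<alpha> * B powr \<beta>" using pos ab by simp
    finally show ?thesis .
  qed
  then show "(\<integral>x. f x powr \<alpha> * g x powr \<beta> \<partial>M) \<le> (\<integral>x. f x \<partial>M) powr \<alpha> * (\<integral>x. g x \<partial>M) powr \<beta>"
    by (simp add: A_def B_def)
qed

lemma bounded_integrable_L2:
  assumes f: "integrable m f" and b: "\<And>x. 0 \<le> f x" "\<And>x. f x \<le> C"
  shows "f \<in> L2 m"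
proof -
  have "integrable m (\<lambda>x. (f x)\<^sup>2)"
  proof (rule Bochner_Integration.integrable_bound)
    show "integrable m (\<lambda>x. C * f x)" using f by simp
    show "AE x in m. norm ((f x)\<^sup>2) \<le> norm (C * f x)"
    proof (rule AE_I2)
      fix x
      have "f x * f x \<le> C * f x" using b[of x] by (intro mult_right_mono) auto
      then show "norm ((f x)\<^sup>2) \<le> norm (C * f x)" by (simp add: power2_eq_square)
    qed
  qed (use f in measurable)
  then show ?thesis using f by (simp add: L2_def)
qed

lemma bounded_integrable_powr:
  fixes f :: "'a \<Rightarrow> real"
  assumes f: "integrable m f" and b: "\<And>x. 0 \<le> f x" "\<And>x. f x \<le> C" and p: "1 \<le> p"
  shows "integrable m (\<lambda>x. f x powr p)"
proof (rule Bochner_Integration.integrable_bound)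
  have [measurable]: "f \<in> borel_measurable m" using f by auto
  show "integrable m (\<lambda>x. C powr (p - 1) * f x)" using f by simp
  show "AE x in m. norm (f x powr p) \<le> norm (C powr (p - 1) * f x)"
  proof (rule AE_I2)
    fix x
    have "f x powr p = f x powr (p - 1) * f x"
      using b(1)[of x] powr_add[of "f x" "p - 1" 1] by simp
    also have "\<dots> \<le> C powr (p - 1) * f x"
      using b[of x] p by (intro mult_right_mono powr_mono2) auto
    finally show "norm (f x powr p) \<le> norm (C powr (p - 1) * f x)" using b(1)[of x] by simp
  qed
  show "(\<lambda>x. f x powr p) \<in> borel_measurable m" by measurable
qed

text \<open>For \<open>K \<ge> 0\<close> this is \<open>e\<^sup>x - 1 \<ge> x\<close>. For \<open>K < 0\<close> it is \<open>x / (1 - e\<^sup>-\<^sup>x) \<le> 1 + x\<close>, and the extra term \<open>- K\<close> is the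
source of the constant \<open>C\<^sub>K\<close>.\<close>

lemma harnack_coeff_bounds:
  assumes t: "t > 0"
  shows "0 \<le> harnack_coeff K t" "harnack_coeff K t \<le> 1 / (2 * t) + max 0 (- K)"
proof -
  consider "K = 0" | "K > 0" | "K < 0" by linarith
  then have "0 \<le> harnack_coeff K t \<and> harnack_coeff K t \<le> 1 / (2 * t) + max 0 (- K)"
  proof cases
    case 1
    then show ?thesis using t by (simp add: harnack_coeff_def)
  next
    case 2
    have pos: "2 * K * t > 0" using 2 t by simp
    have ge: "2 * K * t \<le> exp (2 * K * t) - 1" using exp_ge_add_one_self[of "2 * K * t"] by linarith
    have "K / (exp (2 * K * t) - 1) \<le> K / (2 * K * t)" using pos ge 2 by (intro divide_left_mono) auto
    then show ?thesis using 2 t pos ge by (simp add: harnack_coeff_def)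
  next
    case 3
    define k where "k = - K"
    define x where "x = 2 * k * t"
    have k: "k > 0" using 3 by (simp add: k_def)
    then have "x > 0" using t by (simp add: x_def)
    note k = k this
    have "exp (- x) = 1 / exp x" by (simp add: exp_minus inverse_eq_divide)
    also have "\<dots> \<le> 1 / (1 + x)" using k exp_ge_add_one_self[of x] by (intro divide_left_mono) auto
    finally have e: "x / (1 + x) \<le> 1 - exp (- x)" using k by (simp add: field_simps)
    have e0: "0 < x / (1 + x)" using k by simp
    have "harnack_coeff K t = k / (1 - exp (- x))"
    proof -
      define E where "E = exp (- x)"
      have "E < 1" using k by (simp add: E_def)
      then have "K / (E - 1) = k / (1 - E)" by (simp add: k_def field_simps)
      moreover have "exp (2 * K * t) = E" by (simp add: E_def x_def k_def)
      ultimately show ?thesis using 3 by (simp add: harnack_coeff_def E_def)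
    qed
    moreover have "k / (1 - exp (- x)) \<le> k / (x / (1 + x))"
      using k e e0 by (intro divide_left_mono mult_pos_pos) auto
    moreover have "k / (x / (1 + x)) = 1 / (2 * t) + k"
      using k t by (simp add: x_def field_simps)
    moreover have "0 \<le> k / (1 - exp (- x))" using k e e0 by simp
    ultimately show ?thesis using 3 by (simp add: k_def)
  qed
  then show "0 \<le> harnack_coeff K t" "harnack_coeff K t \<le> 1 / (2 * t) + max 0 (- K)" by auto
qed

context
  fixes m :: "'a::{complete_space, second_countable_topology} measure"
    and h :: "real \<Rightarrow> ('a \<Rightarrow> real) \<Rightarrow> 'a \<Rightarrow> real"
    and r :: "real \<Rightarrow> 'a \<Rightarrow> 'a \<Rightarrow> real"
  assumes mm: "metric_measure m" and heat: "heat_flow m h" and kernel: "heat_kernel m h r"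
begin

lemma sets_m: "sets m = sets borel" and emeasure_bounded: "bounded A \<Longrightarrow> emeasure m A < \<infinity>"
  using mm by (auto simp: metric_measure_def)

lemma kernel_pos: "t > 0 \<Longrightarrow> 0 < r t x y"
  and kernel_measurable: "t > 0 \<Longrightarrow> r t x \<in> borel_measurable m"
  and kernel_mass: "t > 0 \<Longrightarrow> (\<integral>\<^sup>+y. ennreal (r t x y) \<partial>m) = 1"
  and heat_flow_kernel: "t > 0 \<Longrightarrow> f \<in> L2 m \<Longrightarrow> h t f x = (\<integral>y. f y * r t x y \<partial>m)"
  and kernel_convolution: "s > 0 \<Longrightarrow> t > 0 \<Longrightarrow> r (s + t) x y = (\<integral>z. r s x z * r t y z \<partial>m)"
  using kernel by (auto simp: heat_kernel_def)

lemma kernel_integrable: "t > 0 \<Longrightarrow> integrable m (r t x)" and kernel_integral: "t > 0 \<Longrightarrow> (\<integral>y. r t x y \<partial>m) = 1"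
proof -
  assume t: "t > 0"
  show "integrable m (r t x)"
    using kernel_pos[OF t] kernel_measurable[OF t] kernel_mass[OF t]
    by (intro integrableI_nonneg) (auto simp: less_imp_le)
  then show "(\<integral>y. r t x y \<partial>m) = 1"
    using kernel_pos[OF t] kernel_mass[OF t, of x] nn_integral_eq_integral[of m "r t x"]
    by (auto simp: less_imp_le ennreal_eq_1)
qed

text \<open>The kernel is positive, so the convolution integral for \<open>r (t + t) x x\<close> is not \<open>0\<close>; as the
integral of a non-integrable function is \<open>0\<close>, the integrand is integrable.\<close>

lemma kernel_L2:
  assumes t: "t > 0"
  shows "r t x \<in> L2 m"
proof -
  have "(\<integral>z. r t x z * r t x z \<partial>m) = r (t + t) x x" using kernel_convolution[OF t t] by simp
  then have "(\<integral>z. r t x z * r t x z \<partial>m) \<noteq> 0" using kernel_pos[of "t + t" x x] t by simp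
  then have "integrable m (\<lambda>z. r t x z * r t x z)" using not_integrable_integral_eq by blast
  then show ?thesis using kernel_measurable[OF t] by (simp add: L2_def power2_eq_square)
qed

lemma heat_flow_nonneg:
  assumes "t > 0" "f \<in> L2 m" "\<And>x. 0 \<le> f x"
  shows "0 \<le> h t f x"
  using assms kernel_pos[OF assms(1)] by (simp add: heat_flow_kernel less_imp_le)

text \<open>By symmetry, the integral of \<open>h\<^sub>t f\<close> over a ball is that of \<open>f\<close> times \<open>h\<^sub>t\<close> of the indicator of the ball, which is at
most \<open>1\<close>; then the balls exhaust the space.\<close>

lemma heat_flow_mass_le:
  assumes t: "t > 0" and f: "f \<in> L2 m" "integrable m f" "\<And>x. 0 \<le> f x"
  shows "integrable m (h t f)" "(\<integral>x. h t f x \<partial>m) \<le> (\<integral>x. f x \<partial>m)"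
proof -
  have hL: "h t f \<in> L2 m" by (rule heat_flow_L2[OF sets_m heat f(1) t])
  then have hm[measurable]: "h t f \<in> borel_measurable m" by (simp add: L2_def)
  have h0: "0 \<le> h t f x" for x by (rule heat_flow_nonneg[OF t f(1,3)])
  fix x0 :: 'a
  define I where "I n x = (indicator (ball x0 (real n)) x :: real)" for n x
  have bs: "ball x0 (real n) \<in> sets m" for n using sets_m by simp
  have Iint: "integrable m (I n)" for n
    unfolding I_def using bs emeasure_bounded[OF bounded_ball, of x0 "real n"] by simp
  have IL: "I n \<in> L2 m" for n by (rule bounded_integrable_L2[OF Iint, of _ 1]) (auto simp: I_def split: split_indicator)
  have hI: "h t (I n) x \<le> 1" for n x
  proof -
    have "h t (I n) x = (\<integral>y. I n y * r t x y \<partial>m)" by (rule heat_flow_kernel[OF t IL])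
    also have "\<dots> \<le> (\<integral>y. r t x y \<partial>m)"
      using kernel_pos[OF t, of x]
      by (intro integral_mono L2_mult_integrable IL kernel_L2 kernel_integrable t) (auto simp: I_def less_imp_le split: split_indicator)
    finally show ?thesis using kernel_integral[OF t] by simp
  qed
  have le: "(\<integral>x. h t f x * I n x \<partial>m) \<le> (\<integral>x. f x \<partial>m)" for n
  proof -
    have "(\<integral>x. h t f x * I n x \<partial>m) = (\<integral>x. f x * h t (I n) x \<partial>m)"
      by (rule heat_flow_symmetric[OF sets_m heat f(1) IL t, symmetric])
    also have "\<dots> \<le> (\<integral>x. f x \<partial>m)"
    proof (rule integral_mono)
      show "integrable m (\<lambda>x. f x * h t (I n) x)"
        by (rule L2_mult_integrable[OF f(1) heat_flow_L2[OF sets_m heat IL t]])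
      show "f x * h t (I n) x \<le> f x" for x using hI[of n x] f(3)[of x] by (simp add: mult_left_le)
    qed (rule f(2))
    finally show ?thesis .
  qed
  have lim: "(\<lambda>n. h t f x * I n x) \<longlonglongrightarrow> h t f x" for x
  proof (rule tendsto_eventually)
    obtain n where "dist x0 x < real n" using reals_Archimedean2 by blast
    then have "I k x = 1" if "k \<ge> n" for k
      using that by (auto simp: I_def indicator_def)
    then show "eventually (\<lambda>n. h t f x * I n x = h t f x) sequentially"
      by (auto simp: eventually_sequentially)
  qed
  have inc: "I n x \<le> I k x" if "n \<le> k" for n k x using that by (auto simp: I_def indicator_def)
  have nn: "(\<integral>\<^sup>+x. ennreal (h t f x) \<partial>m) \<le> ennreal (\<integral>x. f x \<partial>m)"
  proof -
    have "(\<integral>\<^sup>+x. ennreal (h t f x) \<partial>m) = (SUP n. \<integral>\<^sup>+x. ennreal (h t f x * I n x) \<partial>m)"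
    proof -
      have "(\<integral>\<^sup>+x. ennreal (h t f x) \<partial>m) = (\<integral>\<^sup>+x. (SUP n. ennreal (h t f x * I n x)) \<partial>m)"
      proof (rule nn_integral_cong)
        fix x
        have "incseq (\<lambda>n. ennreal (h t f x * I n x))"
          by (intro monoI ennreal_leI mult_left_mono inc h0)
        from LIMSEQ_unique[OF tendsto_ennrealI[OF lim] LIMSEQ_SUP[OF this]]
        show "ennreal (h t f x) = (SUP n. ennreal (h t f x * I n x))" .
      qed
      also have "\<dots> = (SUP n. \<integral>\<^sup>+x. ennreal (h t f x * I n x) \<partial>m)"
      proof (rule nn_integral_monotone_convergence_SUP)
        show "incseq (\<lambda>n x. ennreal (h t f x * I n x))"
          by (intro monoI le_funI ennreal_leI mult_left_mono inc h0)
        show "(\<lambda>x. ennreal (h t f x * I n x)) \<in> borel_measurable m" for n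
          using hm borel_measurable_integrable[OF Iint[of n]] by simp
      qed
      finally show ?thesis .
    qed
    also have "\<dots> \<le> ennreal (\<integral>x. f x \<partial>m)"
    proof (rule SUP_least)
      fix n
      have "(\<integral>\<^sup>+x. ennreal (h t f x * I n x) \<partial>m) = ennreal (\<integral>x. h t f x * I n x \<partial>m)"
        by (intro nn_integral_eq_integral L2_mult_integrable hL IL AE_I2) (auto simp: I_def h0)
      then show "(\<integral>\<^sup>+x. ennreal (h t f x * I n x) \<partial>m) \<le> ennreal (\<integral>x. f x \<partial>m)"
        using le[of n] by (simp add: ennreal_leI)
    qed
    finally show ?thesis .
  qed
  show int: "integrable m (h t f)"
    using nn h0 by (intro integrableI_nonneg) (auto intro: le_less_trans)
  have "ennreal (\<integral>x. h t f x \<partial>m) \<le> ennreal (\<integral>x. f x \<partial>m)"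
    using nn nn_integral_eq_integral[OF int] h0 by simp
  moreover have "0 \<le> (\<integral>x. f x \<partial>m)" using f(3) by simp
  ultimately show "(\<integral>x. h t f x \<partial>m) \<le> (\<integral>x. f x \<partial>m)" by simp
qed

context
  fixes K :: real
  assumes harnack: "dimension_free_harnack m h K"
begin

text \<open>With \<open>\<alpha> = \<beta> / (q - 1)\<close> and \<open>W = exp (- 2 * \<alpha> * \<psi>)\<close>, the function \<open>f\<^sup>p\<close> is a product of powers of
\<open>a = f\<^sup>2 W\<^sup>q\<^sup>-\<^sup>1\<close> and \<open>b = f W\<^sup>q\<^sup>/\<^sup>2\<^sup>-\<^sup>1\<close>. These are chosen so that \<open>a = W b\<^sup>2\<close>: the mass of \<open>h\<^sub>t a\<close> and the weighted
\<open>L\<^sup>2\<close> norm of \<open>h\<^sub>t b\<close> are then both bounded by the integral of \<open>a\<close>, and Hoelder's inequality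
combines the two bounds.\<close>

lemma ball_measure_heat_flow_sq_le:
  assumes f: "integrable m f" "\<And>x. 0 \<le> f x" "\<And>x. f x \<le> C"
    and t: "t > 0" and q: "1 < q" "q < 2" and \<rho>: "\<rho> > 0"
    and lip: "\<And>x y. \<bar>\<psi> x - \<psi> y\<bar> \<le> dist x y" and range: "\<And>x. \<psi> x \<in> {0..R}"
  shows "measure m (ball x \<rho>) * (h t f x)\<^sup>2 \<le>
    exp (\<rho>\<^sup>2 * harnack_coeff K t / (2 / q - 1) + 2 * \<beta>\<^sup>2 * t / (q - 1) + 2 * \<beta> * \<psi> x + 2 * \<bar>\<beta>\<bar> * \<rho>) *
    (\<integral>z. (f z)\<^sup>2 * exp (- (2 * \<beta> * \<psi> z)) \<partial>m)"
proof -
  define \<alpha> where "\<alpha> = \<beta> / (q - 1)"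
  have \<alpha>\<beta>: "\<alpha> * (q - 1) = \<beta>" using q by (simp add: \<alpha>_def)
  define p where "p = 2 / q"
  have p: "1 < p" "p * q = 2" using q by (auto simp: p_def)
  define \<kappa> where "\<kappa> = harnack_coeff K t"
  have \<kappa>: "0 \<le> \<kappa>" unfolding \<kappa>_def by (rule harnack_coeff_bounds(1)[OF t])
  define W where "W x = exp (- (2 * \<alpha> * \<psi> x))" for x
  have contpsi: "continuous_on UNIV \<psi>"
    unfolding continuous_on_iff using lip by (metis dist_real_def le_less_trans)
  have em: "(\<lambda>x. exp (c * \<psi> x)) \<in> borel_measurable m" for c
  proof -
    have "(\<lambda>x. exp (c * \<psi> x)) \<in> borel_measurable borel"
      by (intro borel_measurable_continuous_onI continuous_intros contpsi)
    then show ?thesis using measurable_cong_sets[OF sets_m refl] by blast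
  qed
  have eb: "exp (c * \<psi> x) \<le> exp (\<bar>c\<bar> * R)" for c x
  proof -
    have "c * \<psi> x \<le> \<bar>c\<bar> * R" using range[of x] by (intro mult_mono) auto
    then show ?thesis by simp
  qed
  have C0: "0 \<le> C" using f(2)[of x] f(3)[of x] by linarith
  have weighted: "integrable m (\<lambda>x. f x * exp (c * \<psi> x))" "\<And>x. 0 \<le> f x * exp (c * \<psi> x)" "\<And>x. f x * exp (c * \<psi> x) \<le> C * exp (\<bar>c\<bar> * R)" for c
  proof -
    show "integrable m (\<lambda>x. f x * exp (c * \<psi> x))"
    proof (rule Bochner_Integration.integrable_bound)
      show "integrable m (\<lambda>x. exp (\<bar>c\<bar> * R) * f x)" using f by simp
      show "(\<lambda>x. f x * exp (c * \<psi> x)) \<in> borel_measurable m" using em[of c] f(1) by simp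
      show "AE x in m. norm (f x * exp (c * \<psi> x)) \<le> norm (exp (\<bar>c\<bar> * R) * f x)"
      proof (rule AE_I2)
        fix x
        have "f x * exp (c * \<psi> x) \<le> f x * exp (\<bar>c\<bar> * R)" by (rule mult_left_mono[OF eb f(2)])
        then show "norm (f x * exp (c * \<psi> x)) \<le> norm (exp (\<bar>c\<bar> * R) * f x)"
          using f(2)[of x] by (simp add: abs_mult mult.commute)
      qed
    qed
    show "0 \<le> f x * exp (c * \<psi> x)" for x using f(2)[of x] by simp
    show "f x * exp (c * \<psi> x) \<le> C * exp (\<bar>c\<bar> * R)" for x
      using eb[of c x] f(2,3)[of x] C0 by (intro mult_mono) auto
  qed
  define u where "u x = f x powr p" for x
  define b where "b x = f x * exp (\<alpha> * (2 - q) * \<psi> x)" for x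
  define a where "a x = (f x)\<^sup>2 * exp (- (2 * \<beta> * \<psi> x))" for x
  have aeq: "a x = (f x * exp (- \<beta> * \<psi> x)) * (f x * exp (- \<beta> * \<psi> x))" for x
    by (simp add: a_def power2_eq_square mult_ac flip: exp_add)
  have uint: "integrable m u" unfolding u_def using bounded_integrable_powr[OF f, of p] p by simp
  have u0: "0 \<le> u x" for x by (simp add: u_def)
  have "u x \<le> C powr p" for x unfolding u_def using f p by (intro powr_mono2) auto
  then have uL: "u \<in> L2 m" by (intro bounded_integrable_L2[OF uint u0])
  have bL: "b \<in> L2 m" unfolding b_def by (rule bounded_integrable_L2[OF weighted])
  have b0: "0 \<le> b x" for x using f(2)[of x] by (simp add: b_def)
  have fL: "f \<in> L2 m" by (rule bounded_integrable_L2[OF f])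
  have cL: "(\<lambda>x. f x * exp (- \<beta> * \<psi> x)) \<in> L2 m" by (rule bounded_integrable_L2[OF weighted])
  have aint: "integrable m a" using L2_mult_integrable[OF cL cL] by (simp add: aeq[abs_def])
  have a0: "0 \<le> a x" for x by (simp add: a_def)
  have aC: "a x \<le> (C * exp (\<bar>- \<beta>\<bar> * R)) * (C * exp (\<bar>- \<beta>\<bar> * R))" for x
    unfolding aeq by (intro mult_mono weighted) (use C0 in auto)
  have aL: "a \<in> L2 m" by (rule bounded_integrable_L2[OF aint a0 aC])
  define J where "J = (\<integral>z. a z \<partial>m)"
  have J0: "0 \<le> J" unfolding J_def using a0 by simp
  have ha0: "0 \<le> h t a y" and hb0: "0 \<le> h t b y" and hu0: "0 \<le> h t u y" and hf0: "0 \<le> h t f y" for y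
    by (auto intro!: heat_flow_nonneg t aL bL uL fL a0 b0 u0 f(2))
  note hs = heat_flow_L2[OF sets_m heat]
  \<comment> \<open>the powers of \<open>W\<close> cancel because \<open>(q - 1) * (2 - q) / q + (q / 2 - 1) * (2 * (q - 1) / q) = 0\<close>\<close>
  have split: "u z = a z powr ((2 - q) / q) * b z powr (2 * (q - 1) / q)" for z
  proof (cases "f z = 0")
    case False
    then have fz: "f z > 0" using f(2)[of z] by simp
    have "a z = exp (2 * ln (f z) - 2 * \<beta> * \<psi> z)"
      using fz by (simp add: a_def exp_diff exp_minus exp_double field_simps)
    moreover have "b z = exp (ln (f z) + \<alpha> * (2 - q) * \<psi> z)" using fz by (simp add: b_def exp_add)
    ultimately have "a z powr ((2 - q) / q) * b z powr (2 * (q - 1) / q)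
      = exp ((2 * ln (f z) - 2 * \<beta> * \<psi> z) * ((2 - q) / q) + (ln (f z) + \<alpha> * (2 - q) * \<psi> z) * (2 * (q - 1) / q))"
      by (simp only: exp_powr_real exp_add[symmetric])
    also have "(2 * ln (f z) - 2 * \<beta> * \<psi> z) * ((2 - q) / q) + (ln (f z) + \<alpha> * (2 - q) * \<psi> z) * (2 * (q - 1) / q) = p * ln (f z)"
      using q unfolding \<alpha>\<beta>[symmetric] p_def by (simp add: field_simps)
    finally show ?thesis using fz by (simp add: u_def powr_def)
  qed (use q in \<open>simp add: u_def a_def b_def\<close>)
  have H1: "h t u y powr q \<le> h t a y powr (2 - q) * ((h t b y)\<^sup>2) powr (q - 1)" for y
  proof -
    have q': "0 < (2 - q) / q" "0 < 2 * (q - 1) / q" "(2 - q) / q + 2 * (q - 1) / q = 1" using q by (auto simp: field_simps)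
    have rp: "0 < r t y z" for z by (rule kernel_pos[OF t])
    have ia: "integrable m (\<lambda>z. a z * r t y z)" "integrable m (\<lambda>z. b z * r t y z)"
      by (intro L2_mult_integrable aL bL kernel_L2 t)+
    have "u z * r t y z = (a z * r t y z) powr ((2 - q) / q) * (b z * r t y z) powr (2 * (q - 1) / q)" for z
    proof -
      have "r t y z = r t y z powr ((2 - q) / q) * r t y z powr (2 * (q - 1) / q)"
        using rp[of z] q'(3) by (simp flip: powr_add)
      then show ?thesis using rp[of z] a0[of z] b0[of z] by (simp add: split powr_mult)
    qed
    then have "h t u y = (\<integral>z. (a z * r t y z) powr ((2 - q) / q) * (b z * r t y z) powr (2 * (q - 1) / q) \<partial>m)"
      using heat_flow_kernel[OF t uL] by simp
    also have "\<dots> \<le> (\<integral>z. a z * r t y z \<partial>m) powr ((2 - q) / q) * (\<integral>z. b z * r t y z \<partial>m) powr (2 * (q - 1) / q)"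
      by (rule integral_powr_Hoelder(2)[OF ia(1) _ ia(2) _ q']) (use rp a0 b0 in \<open>auto simp: less_imp_le\<close>)
    also have "\<dots> = h t a y powr ((2 - q) / q) * h t b y powr (2 * (q - 1) / q)"
      using heat_flow_kernel[OF t aL] heat_flow_kernel[OF t bL] by simp
    finally have "h t u y powr q \<le> (h t a y powr ((2 - q) / q) * h t b y powr (2 * (q - 1) / q)) powr q"
      using q hu0 by (intro powr_mono2) auto
    also have "\<dots> = h t a y powr (2 - q) * h t b y powr (2 * (q - 1))"
      using q by (simp add: powr_mult powr_powr)
    also have "h t b y powr (2 * (q - 1)) = ((h t b y)\<^sup>2) powr (q - 1)"
      using hb0[of y] by (cases "h t b y = 0") (auto simp: powr_powr simp flip: powr_numeral)
    finally show ?thesis .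
  qed
  define E where "E = exp (\<rho>\<^sup>2 * \<kappa> / (p - 1))"
  define E' where "E' = exp (2 * \<beta> * \<psi> x + 2 * \<bar>\<beta>\<bar> * \<rho>)"
  define Q where "Q y = h t a y powr (2 - q) * (W y * (h t b y)\<^sup>2) powr (q - 1)" for y
  have Q0: "0 \<le> Q y" for y by (simp add: Q_def)
  \<comment> \<open>the factor \<open>E'\<close> pays for the weight: by the Lipschitz bound on \<open>\<psi>\<close>, \<open>E' * W y powr (q - 1) \<ge> 1\<close> on the ball\<close>
  have H2: "(h t f x)\<^sup>2 \<le> E * E' * Q y" if y: "y \<in> ball x \<rho>" for y
  proof -
    have fm: "f \<in> L1_Linf m" unfolding L1_Linf_def using f by (auto intro!: exI[of _ C])
    have "\<bar>h t f x\<bar> powr p \<le> h t (\<lambda>z. \<bar>f z\<bar> powr p) y * exp (p * (dist x y)\<^sup>2 / (2 * (p - 1)) * harnack_coeff K t)"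
      using harnack p(1) t fm unfolding dimension_free_harnack_def by blast
    then have "h t f x powr p \<le> h t u y * exp (p * (dist x y)\<^sup>2 / (2 * (p - 1)) * \<kappa>)"
      using hf0[of x] f(2) by (simp add: u_def[abs_def] \<kappa>_def)
    then have "(h t f x powr p) powr q \<le> (h t u y * exp (p * (dist x y)\<^sup>2 / (2 * (p - 1)) * \<kappa>)) powr q"
      using q by (intro powr_mono2) auto
    also have "\<dots> = h t u y powr q * exp (q * (p * (dist x y)\<^sup>2 / (2 * (p - 1)) * \<kappa>))"
      using hu0[of y] by (simp add: powr_mult exp_powr_real mult.commute)
    also have "q * (p * (dist x y)\<^sup>2 / (2 * (p - 1)) * \<kappa>) = (dist x y)\<^sup>2 * \<kappa> / (p - 1)"
    proof -
      have "q * (p * (dist x y)\<^sup>2 / (2 * (p - 1)) * \<kappa>) = (p * q) * ((dist x y)\<^sup>2 / (2 * (p - 1)) * \<kappa>)"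
        by (simp only: divide_inverse mult_ac)
      also have "\<dots> = (dist x y)\<^sup>2 * \<kappa> / (p - 1)" unfolding p(2) using p(1) by (simp add: divide_simps)
      finally show ?thesis .
    qed
    also have "(h t f x powr p) powr q = (h t f x)\<^sup>2"
      using hf0[of x] p(2) by (cases "h t f x = 0") (auto simp: powr_powr)
    finally have 1: "(h t f x)\<^sup>2 \<le> h t u y powr q * exp ((dist x y)\<^sup>2 * \<kappa> / (p - 1))" .
    have dy: "dist x y \<le> \<rho>" using y by simp
    have "exp ((dist x y)\<^sup>2 * \<kappa> / (p - 1)) \<le> E"
      unfolding E_def using p \<kappa> dy by (simp add: divide_right_mono mult_right_mono power_mono)
    then have "h t u y powr q * exp ((dist x y)\<^sup>2 * \<kappa> / (p - 1)) \<le> h t u y powr q * E" by (intro mult_left_mono) auto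
    also have "\<dots> \<le> (h t a y powr (2 - q) * ((h t b y)\<^sup>2) powr (q - 1)) * E"
      using H1[of y] by (intro mult_right_mono) (auto simp: E_def)
    also have "\<dots> \<le> (E' * Q y) * E"
    proof -
      have "W y powr (q - 1) = exp (- (2 * \<beta> * \<psi> y))"
        unfolding W_def exp_powr_real \<alpha>\<beta>[symmetric] by (simp add: algebra_simps)
      moreover have "1 \<le> E' * exp (- (2 * \<beta> * \<psi> y))"
      proof -
        have "\<beta> * (\<psi> y - \<psi> x) \<le> \<bar>\<beta>\<bar> * \<rho>"
        proof -
          have "\<beta> * (\<psi> y - \<psi> x) \<le> \<bar>\<beta>\<bar> * \<bar>\<psi> y - \<psi> x\<bar>" by (metis abs_ge_self abs_mult)
          also have "\<dots> \<le> \<bar>\<beta>\<bar> * \<rho>" using lip[of y x] dy by (intro mult_left_mono) (auto simp: dist_commute)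
          finally show ?thesis .
        qed
        then have "0 \<le> 2 * \<beta> * \<psi> x + 2 * \<bar>\<beta>\<bar> * \<rho> + - (2 * \<beta> * \<psi> y)" by (simp add: algebra_simps)
        then show ?thesis unfolding E'_def by (simp flip: exp_add)
      qed
      ultimately have w: "1 \<le> E' * W y powr (q - 1)" by simp
      have "h t a y powr (2 - q) * ((h t b y)\<^sup>2) powr (q - 1) * 1
        \<le> h t a y powr (2 - q) * ((h t b y)\<^sup>2) powr (q - 1) * (E' * W y powr (q - 1))"
        by (intro mult_left_mono w) auto
      also have "\<dots> = E' * Q y" by (simp add: Q_def powr_mult W_def mult_ac)
      finally show ?thesis by (intro mult_right_mono) (auto simp: E_def)
    qed
    finally show ?thesis using 1 by (simp add: mult_ac)
  qed
  have i1: "integrable m (h t a)" and m1: "(\<integral>y. h t a y \<partial>m) \<le> J"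
    using heat_flow_mass_le[OF t aL aint a0] by (auto simp: J_def)
  have i2: "integrable m (\<lambda>y. W y * (h t b y)\<^sup>2)"
  proof -
    have "(\<lambda>y. exp (- \<alpha> * \<psi> y) * h t b y) \<in> L2 m"
      by (rule L2_bounded_mult[OF em hs[OF bL t], of _ "exp (\<bar>- \<alpha>\<bar> * R)"]) (use eb[of "- \<alpha>"] in simp)
    then have "integrable m (\<lambda>y. (exp (- \<alpha> * \<psi> y) * h t b y)\<^sup>2)" by (simp add: L2_def)
    then show ?thesis by (simp add: W_def power_mult_distrib mult_ac flip: exp_double)
  qed
  have m2: "(\<integral>y. W y * (h t b y)\<^sup>2 \<partial>m) \<le> exp (2 * \<alpha>\<^sup>2 * t) * J"
  proof -
    have "(\<integral>y. W y * (h t b y)\<^sup>2 \<partial>m) \<le> exp (2 * \<alpha>\<^sup>2 * t) * (\<integral>y. W y * (b y)\<^sup>2 \<partial>m)"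
      using heat_flow_exp_weight_L2_bound[OF sets_m heat bL t lip range, of "- \<alpha>"] by (simp add: W_def)
    also have "(\<lambda>y. W y * (b y)\<^sup>2) = a"
    proof
      fix y
      have "W y * (b y)\<^sup>2 = (f y)\<^sup>2 * exp (- (2 * \<alpha> * \<psi> y) + 2 * (\<alpha> * (2 - q) * \<psi> y))"
        unfolding W_def b_def power_mult_distrib exp_add exp_double by (simp only: mult_ac)
      also have "- (2 * \<alpha> * \<psi> y) + 2 * (\<alpha> * (2 - q) * \<psi> y) = - (2 * \<beta> * \<psi> y)"
        unfolding \<alpha>\<beta>[symmetric] by (simp add: algebra_simps)
      finally show "W y * (b y)\<^sup>2 = a y" by (simp add: a_def)
    qed
    finally show ?thesis by (simp add: J_def)
  qed
  have q'': "0 < 2 - q" "0 < q - 1" "2 - q + (q - 1) = 1" using q by auto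
  note hoelder = integral_powr_Hoelder[OF i1 ha0 i2 _ q'']
  have W0: "0 \<le> W y * (h t b y)\<^sup>2" for y by (simp add: W_def)
  have Qint: "integrable m Q" and "(\<integral>y. Q y \<partial>m) \<le> (\<integral>y. h t a y \<partial>m) powr (2 - q) * (\<integral>y. W y * (h t b y)\<^sup>2 \<partial>m) powr (q - 1)"
    using hoelder[OF W0] by (simp_all add: Q_def[abs_def])
  then have "(\<integral>y. Q y \<partial>m) \<le> J powr (2 - q) * (exp (2 * \<alpha>\<^sup>2 * t) * J) powr (q - 1)"
    using q m1 m2 ha0 W0 by (elim order_trans) (intro mult_mono powr_mono2; simp)
  also have "\<dots> = exp (2 * \<alpha>\<^sup>2 * t) powr (q - 1) * J"
  proof (cases "J = 0")
    case False
    then have "J powr (2 - q) * J powr (q - 1) = J" using J0 by (simp flip: powr_add)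
    then show ?thesis using J0 by (simp add: powr_mult mult_ac)
  qed (use q in simp)
  also have "exp (2 * \<alpha>\<^sup>2 * t) powr (q - 1) = exp (2 * \<beta>\<^sup>2 * t / (q - 1))"
    unfolding exp_powr_real using q by (simp add: \<alpha>_def power_divide) (simp add: power2_eq_square)
  finally have Qle: "(\<integral>y. Q y \<partial>m) \<le> exp (2 * \<beta>\<^sup>2 * t / (q - 1)) * J" .
  have bs: "ball x \<rho> \<in> sets m" using sets_m by simp
  have "measure m (ball x \<rho>) * (h t f x)\<^sup>2 = (\<integral>y. indicator (ball x \<rho>) y * (h t f x)\<^sup>2 \<partial>m)"
    using bs sets_eq_imp_space_eq[OF sets_m] by simp
  also have "\<dots> \<le> (\<integral>y. E * E' * Q y \<partial>m)"
  proof (rule integral_mono)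
    show "integrable m (\<lambda>y. indicator (ball x \<rho>) y * (h t f x)\<^sup>2)"
      using bs emeasure_bounded[OF bounded_ball, of x \<rho>] by simp
    show "integrable m (\<lambda>y. E * E' * Q y)" using Qint by simp
    show "indicator (ball x \<rho>) y * (h t f x)\<^sup>2 \<le> E * E' * Q y" for y
      using H2[of y] Q0[of y] by (auto simp: E_def E'_def split: split_indicator)
  qed
  also have "\<dots> = E * E' * (\<integral>y. Q y \<partial>m)" by simp
  also have "\<dots> \<le> E * E' * (exp (2 * \<beta>\<^sup>2 * t / (q - 1)) * J)"
    by (intro mult_left_mono Qle) (auto simp: E_def E'_def)
  also have "\<dots> = exp (\<rho>\<^sup>2 * \<kappa> / (p - 1) + 2 * \<beta>\<^sup>2 * t / (q - 1) + 2 * \<beta> * \<psi> x + 2 * \<bar>\<beta>\<bar> * \<rho>) * J"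
    by (simp add: E_def E'_def exp_add mult_ac)
  finally show ?thesis by (simp add: J_def a_def \<kappa>_def p_def)
qed

text \<open>The preceding bound is applied to \<open>f = min (r t x) n * exp (2 * \<beta> * \<psi>)\<close>. If \<open>S n\<close> is the weighted integral of
the squared truncation, then \<open>h\<^sub>t f x \<ge> S n\<close>, while \<open>S n\<close> is also the integral on the right-hand side.\<close>

lemma kernel_exp_weight_L2_bound:
  assumes t: "t > 0" and q: "1 < q" "q < 2" and \<rho>: "\<rho> > 0"
    and lip: "\<And>x y. \<bar>\<psi> x - \<psi> y\<bar> \<le> dist x y" and range: "\<And>x. \<psi> x \<in> {0..R}"
  shows "measure m (ball x \<rho>) * (\<integral>z. (r t x z)\<^sup>2 * exp (2 * \<beta> * \<psi> z) \<partial>m) \<le>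
    exp (\<rho>\<^sup>2 * harnack_coeff K t / (2 / q - 1) + 2 * \<beta>\<^sup>2 * t / (q - 1) + 2 * \<beta> * \<psi> x + 2 * \<bar>\<beta>\<bar> * \<rho>)" (is "?M * _ \<le> ?E")
proof -
  define w where "w z = exp (2 * \<beta> * \<psi> z)" for z
  define C where "C = exp (2 * \<bar>\<beta>\<bar> * R)"
  have wC: "w z \<le> C" for z
  proof -
    have "\<beta> * \<psi> z \<le> \<bar>\<beta>\<bar> * R" using range[of z] by (intro mult_mono) auto
    then show ?thesis by (simp add: w_def C_def)
  qed
  have wpos: "0 < w z" for z by (simp add: w_def)
  have contpsi: "continuous_on UNIV \<psi>"
    unfolding continuous_on_iff using lip by (metis dist_real_def le_less_trans)
  have "w \<in> borel_measurable borel" unfolding w_def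
    by (intro borel_measurable_continuous_onI continuous_intros contpsi)
  then have [measurable]: "w \<in> borel_measurable m" using measurable_cong_sets[OF sets_m refl] by blast
  have rp: "0 < r t x z" for z by (rule kernel_pos[OF t])
  have [measurable]: "r t x \<in> borel_measurable m" by (rule kernel_measurable[OF t])
  have int: "integrable m (\<lambda>z. (r t x z)\<^sup>2 * w z)"
  proof (rule Bochner_Integration.integrable_bound)
    show "integrable m (\<lambda>z. C * (r t x z)\<^sup>2)" using kernel_L2[OF t, of x] by (simp add: L2_def)
    show "AE z in m. norm ((r t x z)\<^sup>2 * w z) \<le> norm (C * (r t x z)\<^sup>2)"
      using wC wpos by (intro AE_I2) (auto simp: abs_mult mult.commute less_imp_le intro!: mult_right_mono, simp add: C_def)
  qed measurable
  define g where "g n z = min (r t x z) (real n)" for n z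
  have g0: "0 \<le> g n z" "g n z \<le> real n" "g n z \<le> r t x z" for n z using rp[of z] by (auto simp: g_def)
  have [measurable]: "g n \<in> borel_measurable m" for n unfolding g_def by measurable
  define S where "S n = (\<integral>z. (g n z)\<^sup>2 * w z \<partial>m)" for n
  have Sint: "integrable m (\<lambda>z. (g n z)\<^sup>2 * w z)" for n
  proof (rule Bochner_Integration.integrable_bound[OF int])
    show "AE z in m. norm ((g n z)\<^sup>2 * w z) \<le> norm ((r t x z)\<^sup>2 * w z)"
      using g0 wpos by (intro AE_I2) (auto simp: abs_mult intro!: mult_right_mono power_mono)
  qed measurable
  have S0: "0 \<le> S n" for n unfolding S_def using wpos by (simp add: less_imp_le)
  have each: "?M * S n \<le> ?E" for n
  proof -
    define f where "f z = g n z * w z" for z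
    have fint: "integrable m f"
    proof (rule Bochner_Integration.integrable_bound)
      show "integrable m (\<lambda>z. C * r t x z)" using kernel_integrable[OF t] by simp
      show "AE z in m. norm (f z) \<le> norm (C * r t x z)"
      proof (rule AE_I2)
        fix z
        have "g n z * w z \<le> r t x z * C" using g0[of n z] wC[of z] wpos[of z] rp[of z] by (intro mult_mono) auto
        then show "norm (f z) \<le> norm (C * r t x z)" using g0[of n z] wpos[of z] rp[of z]
          by (simp add: f_def abs_mult mult.commute C_def)
      qed
      show "f \<in> borel_measurable m" unfolding f_def by measurable
    qed
    have f0: "0 \<le> f z" for z using g0 wpos by (simp add: f_def less_imp_le)
    have fC: "f z \<le> real n * C" for z
      unfolding f_def using g0[of n z] wC[of z] wpos[of z] by (intro mult_mono) auto
    have fL: "f \<in> L2 m" by (rule bounded_integrable_L2[OF fint f0 fC])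
    have "S n \<le> (\<integral>z. f z * r t x z \<partial>m)"
      unfolding S_def
    proof (rule integral_mono[OF Sint L2_mult_integrable[OF fL kernel_L2[OF t]]])
      fix z
      have "g n z * (g n z * w z) \<le> r t x z * (g n z * w z)"
        using g0[of n z] wpos[of z] by (intro mult_right_mono) auto
      then show "(g n z)\<^sup>2 * w z \<le> f z * r t x z" by (simp add: f_def power2_eq_square mult_ac)
    qed
    then have "S n \<le> h t f x" using heat_flow_kernel[OF t fL] by simp
    then have "?M * (S n)\<^sup>2 \<le> ?M * (h t f x)\<^sup>2"
      using S0[of n] by (intro mult_left_mono power_mono) auto
    also have "\<dots> \<le> ?E * (\<integral>z. (f z)\<^sup>2 * exp (- (2 * \<beta> * \<psi> z)) \<partial>m)"
      by (rule ball_measure_heat_flow_sq_le[OF fint f0 fC t q \<rho> lip range])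
    also have "(\<integral>z. (f z)\<^sup>2 * exp (- (2 * \<beta> * \<psi> z)) \<partial>m) = S n"
    proof -
      have "(f z)\<^sup>2 * exp (- (2 * \<beta> * \<psi> z)) = (g n z)\<^sup>2 * w z" for z
        by (simp add: f_def w_def power2_eq_square exp_minus)
      then show ?thesis by (simp add: S_def)
    qed
    finally have "(?M * S n) * S n \<le> ?E * S n" by (simp add: power2_eq_square mult_ac)
    then show ?thesis
      using S0[of n] by (cases "S n = 0") (auto simp: mult_le_cancel_right)
  qed
  have "S \<longlonglongrightarrow> (\<integral>z. (r t x z)\<^sup>2 * w z \<partial>m)"
    unfolding S_def
  proof (rule integral_dominated_convergence[where w = "\<lambda>z. (r t x z)\<^sup>2 * w z"])
    show "AE z in m. (\<lambda>n. (g n z)\<^sup>2 * w z) \<longlonglongrightarrow> (r t x z)\<^sup>2 * w z"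
    proof (rule AE_I2, rule tendsto_eventually)
      fix z
      obtain N where "r t x z < real N" using reals_Archimedean2 by blast
      then have "g n z = r t x z" if "n \<ge> N" for n
        using that by (simp add: g_def min_def)
      then show "eventually (\<lambda>n. (g n z)\<^sup>2 * w z = (r t x z)\<^sup>2 * w z) sequentially"
        unfolding eventually_sequentially by (intro exI[of _ N]) simp
    qed
    show "AE z in m. norm ((g n z)\<^sup>2 * w z) \<le> (r t x z)\<^sup>2 * w z" for n
      using g0 wpos by (intro AE_I2) (auto simp: abs_mult less_imp_le intro!: mult_right_mono power_mono)
  qed (use int in measurable)
  then have "(\<lambda>n. ?M * S n) \<longlonglongrightarrow> ?M * (\<integral>z. (r t x z)\<^sup>2 * w z \<partial>m)" by (intro tendsto_intros)
  then have "?M * (\<integral>z. (r t x z)\<^sup>2 * w z \<partial>m) \<le> ?E"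
    by (rule LIMSEQ_le_const2) (use each in auto)
  then show ?thesis by (simp add: w_def)
qed

text \<open>The weight \<open>\<psi>\<close> vanishes at \<open>x\<close> and equals \<open>dist x y\<close> at \<open>y\<close>, so the bounds for the kernels at \<open>x\<close> and at \<open>y\<close>
with the parameters \<open>\<beta>\<close> and \<open>- \<beta>\<close> differ by the factor \<open>exp (- 2 * \<beta> * dist x y)\<close>.\<close>

lemma kernel_gaussian_bound:
  assumes T: "T > 0" and q: "1 < q" "q < 2" and \<beta>: "\<beta> \<ge> 0"
  shows "r T x y * sqrt (measure m (ball x (sqrt T)) * measure m (ball y (sqrt T))) \<le>
    exp ((1 + max 0 (- K) * T) / (2 / q - 1) + \<beta>\<^sup>2 * T / (q - 1) - \<beta> * dist x y + 2 * \<beta> * sqrt T)"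
proof -
  define t where "t = T / 2"
  have t: "t > 0" "t + t = T" using T by (auto simp: t_def)
  define d where "d = dist x y"
  define \<psi> where "\<psi> z = min (dist x z) d" for z
  have lip: "\<bar>\<psi> z - \<psi> z'\<bar> \<le> dist z z'" for z z'
  proof -
    have "\<bar>dist x z - dist x z'\<bar> \<le> dist z z'" by (metis abs_dist_diff_le dist_commute)
    then show ?thesis unfolding \<psi>_def by linarith
  qed
  have range: "\<psi> z \<in> {0..d}" for z by (auto simp: \<psi>_def d_def)
  define \<rho> where "\<rho> = sqrt T"
  have \<rho>: "\<rho> > 0" "\<rho>\<^sup>2 = T" using T by (auto simp: \<rho>_def)
  define c where "c = (1 + max 0 (- K) * T) / (2 / q - 1)"
  have p: "2 / q - 1 > 0" using q by simp
  have "\<rho>\<^sup>2 * harnack_coeff K t \<le> T * (1 / (2 * t) + max 0 (- K))"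
    unfolding \<rho>(2) using harnack_coeff_bounds(2)[OF t(1), of K] T by (intro mult_left_mono) auto
  also have "\<dots> = 1 + max 0 (- K) * T" using T by (simp add: t_def field_simps)
  finally have c: "\<rho>\<^sup>2 * harnack_coeff K t / (2 / q - 1) \<le> c"
    unfolding c_def using p by (intro divide_right_mono) auto
  have tq: "2 * \<beta>\<^sup>2 * t / (q - 1) = \<beta>\<^sup>2 * T / (q - 1)" by (simp add: t_def)
  define u where "u z = r t x z * exp (\<beta> * \<psi> z)" for z
  define v where "v z = r t y z * exp (- \<beta> * \<psi> z)" for z
  have usq: "(u z)\<^sup>2 = (r t x z)\<^sup>2 * exp (2 * \<beta> * \<psi> z)" and vsq: "(v z)\<^sup>2 = (r t y z)\<^sup>2 * exp (2 * (- \<beta>) * \<psi> z)" for z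
    by (simp_all add: u_def v_def power_mult_distrib mult.assoc flip: exp_double)
  have contpsi: "continuous_on UNIV \<psi>" unfolding \<psi>_def by (intro continuous_intros)
  have em: "(\<lambda>z. exp (b * \<psi> z)) \<in> borel_measurable m" for b
  proof -
    have "(\<lambda>z. exp (b * \<psi> z)) \<in> borel_measurable borel"
      by (intro borel_measurable_continuous_onI continuous_intros contpsi)
    then show ?thesis using measurable_cong_sets[OF sets_m refl] by blast
  qed
  have eb: "\<bar>exp (b * \<psi> z)\<bar> \<le> exp (\<bar>b\<bar> * d)" for b z
  proof -
    have "b * \<psi> z \<le> \<bar>b\<bar> * d" using range[of z] by (intro mult_mono) auto
    then show ?thesis by simp
  qed
  have uL: "u \<in> L2 m" and vL: "v \<in> L2 m"
    using L2_bounded_mult[OF em kernel_L2[OF t(1)] eb, of \<beta> x] L2_bounded_mult[OF em kernel_L2[OF t(1)] eb, of "- \<beta>" y]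
    by (simp_all add: u_def[abs_def] v_def[abs_def] mult.commute)
  define Mx where "Mx = measure m (ball x \<rho>)"
  define My where "My = measure m (ball y \<rho>)"
  define Su where "Su = (\<integral>z. (u z)\<^sup>2 \<partial>m)"
  define Sv where "Sv = (\<integral>z. (v z)\<^sup>2 \<partial>m)"
  have nn: "0 \<le> Mx" "0 \<le> My" "0 \<le> Su" "0 \<le> Sv" by (auto simp: Mx_def My_def Su_def Sv_def)
  have "\<psi> x = 0" by (simp add: \<psi>_def d_def)
  then have "Mx * Su \<le> exp (\<rho>\<^sup>2 * harnack_coeff K t / (2 / q - 1) + 2 * \<beta>\<^sup>2 * t / (q - 1) + 2 * \<beta> * \<rho>)"
    using kernel_exp_weight_L2_bound[OF t(1) q \<rho>(1) lip range, of x \<beta>] \<beta> by (simp add: Mx_def Su_def usq)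
  also have "\<dots> \<le> exp (c + \<beta>\<^sup>2 * T / (q - 1) + 2 * \<beta> * \<rho>)" using c by (simp add: tq)
  finally have X: "Mx * Su \<le> exp (c + \<beta>\<^sup>2 * T / (q - 1) + 2 * \<beta> * \<rho>)" .
  have "\<psi> y = d" by (simp add: \<psi>_def d_def)
  then have "My * Sv \<le> exp (\<rho>\<^sup>2 * harnack_coeff K t / (2 / q - 1) + 2 * \<beta>\<^sup>2 * t / (q - 1) - 2 * \<beta> * d + 2 * \<beta> * \<rho>)"
    using kernel_exp_weight_L2_bound[OF t(1) q \<rho>(1) lip range, of y "- \<beta>"] \<beta> by (simp add: My_def Sv_def vsq)
  also have "\<dots> \<le> exp (c + \<beta>\<^sup>2 * T / (q - 1) - 2 * \<beta> * d + 2 * \<beta> * \<rho>)" using c by (simp add: tq)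
  finally have Y: "My * Sv \<le> exp (c + \<beta>\<^sup>2 * T / (q - 1) - 2 * \<beta> * d + 2 * \<beta> * \<rho>)" .
  have "u z * v z = r t x z * r t y z" for z by (simp add: u_def v_def exp_minus)
  then have "r T x y = (\<integral>z. u z * v z \<partial>m)"
    using kernel_convolution[OF t(1) t(1), of x y] by (simp add: t(2))
  also have "\<dots> \<le> sqrt Su * sqrt Sv"
    using L2_Cauchy_Schwarz[OF uL vL] by (simp add: L2_norm_def Su_def Sv_def)
  finally have "r T x y * sqrt (Mx * My) \<le> sqrt Su * sqrt Sv * sqrt (Mx * My)"
    using nn by (intro mult_right_mono) auto
  also have "\<dots> = sqrt ((Mx * Su) * (My * Sv))" using nn by (simp add: real_sqrt_mult mult_ac)
  also have "\<dots> \<le> sqrt (exp (c + \<beta>\<^sup>2 * T / (q - 1) + 2 * \<beta> * \<rho>) * exp (c + \<beta>\<^sup>2 * T / (q - 1) - 2 * \<beta> * d + 2 * \<beta> * \<rho>))"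
    using nn by (intro real_sqrt_le_mono mult_mono X Y) auto
  also have "\<dots> = sqrt ((exp (c + \<beta>\<^sup>2 * T / (q - 1) - \<beta> * d + 2 * \<beta> * \<rho>))\<^sup>2)"
    by (simp add: power2_eq_square algebra_simps flip: exp_add)
  finally show ?thesis by (simp add: Mx_def My_def c_def d_def \<rho>_def)
qed

end

end

theorem theorem4p1:
  fixes m :: "'a::{complete_space, second_countable_topology} measure"
    and h :: "real \<Rightarrow> ('a \<Rightarrow> real) \<Rightarrow> 'a \<Rightarrow> real"
    and r :: "real \<Rightarrow> 'a \<Rightarrow> 'a \<Rightarrow> real"
    and K :: real
  assumes "metric_measure m"
    and "infinitesimally_hilbertian m"
    and "heat_flow m h"
    and "heat_kernel m h r"
    and "dimension_free_harnack m h K"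
  shows "\<forall>\<epsilon>>0. \<exists>C\<^sub>\<epsilon>>0. \<exists>C\<^sub>K\<ge>0. (K \<ge> 0 \<longrightarrow> C\<^sub>K = 0) \<and>
    (\<forall>x y. \<forall>t>0.
       ennreal (r t x y) \<le>
         1 / ennreal (sqrt (measure m (ball x (sqrt t)) * measure m (ball y (sqrt t)))) *
         ennreal (exp (C\<^sub>\<epsilon> * (1 + C\<^sub>K * t) - (dist x y)\<^sup>2 / ((4 + \<epsilon>) * t))))"
proof (intro allI impI)
  fix \<epsilon> :: real assume \<epsilon>: "\<epsilon> > 0"
  \<comment> \<open>\<open>4 + \<epsilon> = 4 * (1 + 2 * \<delta>)\<close>: one \<open>\<delta>\<close> is lost in \<open>1 / (q - 1) = 1 + \<delta>\<close>, the other in \<open>2 * \<beta> * sqrt t \<le> \<delta> * \<beta>\<^sup>2 * t + 1 / \<delta>\<close>\<close>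
  define \<delta> where "\<delta> = \<epsilon> / 8"
  define q where "q = 1 + 1 / (1 + \<delta>)"
  have \<delta>: "\<delta> > 0" using \<epsilon> by (simp add: \<delta>_def)
  have q: "1 < q" "q < 2" and q1: "1 / (q - 1) = 1 + \<delta>" using \<delta> by (auto simp: q_def)
  define C where "C = 1 / \<delta> + 1 / (2 / q - 1)"
  define CK where "CK = max 0 (- K)"
  have p: "2 / q - 1 > 0" using q by simp
  have C: "C > 0" using \<delta> p by (simp add: C_def add_pos_pos)
  show "\<exists>C\<^sub>\<epsilon>>0. \<exists>C\<^sub>K\<ge>0. (K \<ge> 0 \<longrightarrow> C\<^sub>K = 0) \<and>
    (\<forall>x y. \<forall>t>0.
       ennreal (r t x y) \<le>
         1 / ennreal (sqrt (measure m (ball x (sqrt t)) * measure m (ball y (sqrt t)))) *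
         ennreal (exp (C\<^sub>\<epsilon> * (1 + C\<^sub>K * t) - (dist x y)\<^sup>2 / ((4 + \<epsilon>) * t))))"
  proof (rule exI[of _ C], rule conjI[OF C], rule exI[of _ CK], intro conjI allI impI)
    fix x y :: 'a and t :: real assume t: "t > 0"
    define d where "d = dist x y"
    define M where "M = sqrt (measure m (ball x (sqrt t)) * measure m (ball y (sqrt t)))"
    \<comment> \<open>the minimizer of \<open>(1 + 2 * \<delta>) * \<beta>\<^sup>2 * t - \<beta> * d\<close>\<close>
    define \<beta> where "\<beta> = d / (2 * t * (1 + 2 * \<delta>))"
    have \<beta>: "\<beta> \<ge> 0" using t \<delta> by (simp add: \<beta>_def d_def)
    define G where "G = exp (C * (1 + CK * t) - d\<^sup>2 / ((4 + \<epsilon>) * t))"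
    have "r t x y * M \<le> exp ((1 + CK * t) / (2 / q - 1) + \<beta>\<^sup>2 * t / (q - 1) - \<beta> * d + 2 * \<beta> * sqrt t)"
      using kernel_gaussian_bound[OF assms(1,3,4,5) t q \<beta>, of x y] by (simp add: CK_def d_def M_def)
    also have "\<dots> \<le> G"
    proof -
      have 1: "2 * \<beta> * sqrt t \<le> \<delta> * \<beta>\<^sup>2 * t + 1 / \<delta>"
      proof -
        have "0 \<le> (\<delta> * (\<beta> * sqrt t) - 1)\<^sup>2 / \<delta>" using \<delta> by simp
        also have "(\<delta> * (\<beta> * sqrt t) - 1)\<^sup>2 / \<delta> = \<delta> * (\<beta>\<^sup>2 * (sqrt t)\<^sup>2) - 2 * \<beta> * sqrt t + 1 / \<delta>"
          using \<delta> by (simp add: power2_eq_square field_simps)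
        finally show ?thesis using t by simp
      qed
      have 2: "\<beta>\<^sup>2 * t / (q - 1) = (1 + \<delta>) * (\<beta>\<^sup>2 * t)" using q1 by (metis mult.commute times_divide_eq_right mult.right_neutral)
      have 3: "(1 + \<delta>) * (\<beta>\<^sup>2 * t) + \<delta> * \<beta>\<^sup>2 * t - \<beta> * d = - (d\<^sup>2 / ((4 + \<epsilon>) * t))"
      proof -
        define s where "s = 1 + 2 * \<delta>"
        have s: "s > 0" "4 + \<epsilon> = 4 * s" using \<delta> by (auto simp: s_def \<delta>_def)
        have "(1 + \<delta>) * (\<beta>\<^sup>2 * t) + \<delta> * \<beta>\<^sup>2 * t - \<beta> * d = s * \<beta>\<^sup>2 * t - \<beta> * d" by (simp add: s_def algebra_simps)
        also have "\<dots> = - (d\<^sup>2 / (4 * s * t))"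
          using s(1) t unfolding \<beta>_def s_def[symmetric] by (simp add: field_simps power2_eq_square)
        finally show ?thesis by (simp add: s(2))
      qed
      have 4: "(1 + CK * t) / (2 / q - 1) + 1 / \<delta> \<le> C * (1 + CK * t)"
      proof -
        have "0 \<le> 1 / \<delta> * (CK * t)" using \<delta> t by (simp add: CK_def)
        then show ?thesis by (simp add: C_def algebra_simps)
      qed
      show ?thesis unfolding G_def using 1 2 3 4 by simp
    qed
    finally have le: "r t x y * M \<le> G" .
    have "ennreal (r t x y) \<le> 1 / ennreal M * ennreal G"
    proof (cases "M = 0")
      case True
      then show ?thesis by (simp add: G_def ennreal_mult_eq_top_iff ennreal_top_mult)
    next
      case False
      then have M: "M > 0" by (simp add: M_def order_less_le)
      then have "ennreal (r t x y) \<le> ennreal (1 / M * G)"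
        using le by (intro ennreal_leI) (simp add: field_simps)
      also have "\<dots> = ennreal (1 / M) * ennreal G"
        using M by (intro ennreal_mult) (auto simp: G_def)
      also have "ennreal (1 / M) = 1 / ennreal M"
        using divide_ennreal[of 1 M] M by simp
      finally show ?thesis .
    qed
    then show "ennreal (r t x y) \<le>
         1 / ennreal (sqrt (measure m (ball x (sqrt t)) * measure m (ball y (sqrt t)))) *
         ennreal (exp (C * (1 + CK * t) - (dist x y)\<^sup>2 / ((4 + \<epsilon>) * t)))"
      by (simp add: M_def G_def d_def)
  qed (auto simp: CK_def)
qed

end
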